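(* Let $\mathcal T$ be the category $CGWH$ of compactly generated weakly Hausdorff spaces, or more generally any convenient category of topological spaces. Then the category $\mathcal T\mathrm{Grp}$ of group objects in $\mathcal T$ admits co-induction functors along all morphisms, i.e. it is Locally Algebraically Cartesian Closed: for every morphism $\alpha\colon E\to B$ in $\mathcal T\mathrm{Grp}$, the restriction functor $\alpha^*\colon Pt_B(\mathcal T\mathrm{Grp})\to Pt_E(\mathcal T\mathrm{Grp})$ has a right adjoint.
   Context: A category $\mathcal T$ is called a convenient category of topological spaces if: (1) $\mathcal T$ is a full subcategory of the category of topological spaces containing the one-point space; (2) $\mathcal T$ admits small limits; (3) $\mathcal T$ is cartesian closed; (4) for every object $T\in\mathcal T$ and every subset $X\subseteq T$, there is a topology $\tau$ on $X$ such that $(X,\tau)$ is in $\mathcal T$, the injection $(X,\tau)\hookrightarrow T$ is continuous, and every $f\colon Y\to T$ in $\mathcal T$ with $f(Y)\subseteq X$ defines a continuous map $f\colon Y\to(X,\tau)$. The category $CGWH$ is the full subcategory of spaces $X$ that are compactly generated (a subset $A\subseteq X$ is closed as soon as $f^{-1}(A)$ is closed for every continuous $f\colon K\to X$ with $K$ compact Hausdorff) and weakly Hausdorff (the image of every such $f$ is closed). $Pt_B(\mathcal C)$ is the category of points over $B$ in $\mathcal C$: split epimorphisms onto $B$ with given sections, with the obvious morphisms. For $\mathcal C=\mathcal T\mathrm{Grp}$ it is identified with the category of groups $G$ in $\mathcal T$ endowed with an action of $B$ by group automorphisms such that $B\times G\to G$ is a morphism in $\mathcal T$ (product taken in $\mathcal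 T$), and $B$-equivariant morphisms of $\mathcal T\mathrm{Grp}$. The functor $\alpha^*$ is pullback of points along $\alpha$, i.e. restriction of actions along $\alpha$. *)

theory Defs
  imports "HOL-Analysis.Analysis" "HOL-Library.Equipollence"
begin

section \<open>Categories, functors, adjunctions\<close>

text \<open>Hom-sets are indexed by pairs of objects and need not be disjoint, so composition and the
  arrow part of a functor take the objects concerned as arguments:
  \<open>Comp C a b c g f\<close> is the composite of \<open>f : a \<rightarrow> b\<close> and \<open>g : b \<rightarrow> c\<close>.
  Values outside \<open>Ob\<close> and \<open>Hom\<close> carry no meaning.\<close>

record ('o, 'm) category =
  Ob :: "'o set"
  Hom :: "'o \<Rightarrow> 'o \<Rightarrow> 'm set"
  Ident :: "'o \<Rightarrow> 'm"
  Comp :: "'o \<Rightarrow> 'o \<Rightarrow> 'o \<Rightarrow> 'm \<Rightarrow> 'm \<Rightarrow> 'm"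

definition is_category :: "('o, 'm) category \<Rightarrow> bool" where
  "is_category C \<longleftrightarrow>
     (\<forall>a\<in>Ob C. Ident C a \<in> Hom C a a) \<and>
     (\<forall>a\<in>Ob C. \<forall>b\<in>Ob C. \<forall>c\<in>Ob C. \<forall>f\<in>Hom C a b. \<forall>g\<in>Hom C b c. Comp C a b c g f \<in> Hom C a c) \<and>
     (\<forall>a\<in>Ob C. \<forall>b\<in>Ob C. \<forall>f\<in>Hom C a b.
        Comp C a a b f (Ident C a) = f \<and> Comp C a b b (Ident C b) f = f) \<and>
     (\<forall>a\<in>Ob C. \<forall>b\<in>Ob C. \<forall>c\<in>Ob C. \<forall>d\<in>Ob C. \<forall>f\<in>Hom C a b. \<forall>g\<in>Hom C b c. \<forall>h\<in>Hom C c d.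
        Comp C a c d h (Comp C a b c g f) = Comp C a b d (Comp C b c d h g) f)"

definition is_functor ::
  "('o, 'm) category \<Rightarrow> ('p, 'n) category \<Rightarrow> ('o \<Rightarrow> 'p) \<Rightarrow> ('o \<Rightarrow> 'o \<Rightarrow> 'm \<Rightarrow> 'n) \<Rightarrow> bool" where
  "is_functor C D Fo Fm \<longleftrightarrow>
     (\<forall>a\<in>Ob C. Fo a \<in> Ob D) \<and>
     (\<forall>a\<in>Ob C. \<forall>b\<in>Ob C. \<forall>f\<in>Hom C a b. Fm a b f \<in> Hom D (Fo a) (Fo b)) \<and>
     (\<forall>a\<in>Ob C. Fm a a (Ident C a) = Ident D (Fo a)) \<and>
     (\<forall>a\<in>Ob C. \<forall>b\<in>Ob C. \<forall>c\<in>Ob C. \<forall>f\<in>Hom C a b. \<forall>g\<in>Hom C b c.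
        Fm a c (Comp C a b c g f) = Comp D (Fo a) (Fo b) (Fo c) (Fm b c g) (Fm a b f))"

definition has_right_adjoint ::
  "('o, 'm) category \<Rightarrow> ('p, 'n) category \<Rightarrow> ('o \<Rightarrow> 'p) \<Rightarrow> ('o \<Rightarrow> 'o \<Rightarrow> 'm \<Rightarrow> 'n) \<Rightarrow> bool" where
  "has_right_adjoint C D Fo Fm \<longleftrightarrow>
     is_functor C D Fo Fm \<and>
     (\<exists>(Go :: 'p \<Rightarrow> 'o) (Gm :: 'p \<Rightarrow> 'p \<Rightarrow> 'n \<Rightarrow> 'm) (\<phi> :: 'o \<Rightarrow> 'p \<Rightarrow> 'n \<Rightarrow> 'm).
        is_functor D C Go Gm \<and>
        (\<forall>a\<in>Ob C. \<forall>b\<in>Ob D. bij_betw (\<phi> a b) (Hom D (Fo a) b) (Hom C a (Go b))) \<and>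
        (\<forall>a\<in>Ob C. \<forall>a'\<in>Ob C. \<forall>b\<in>Ob D. \<forall>b'\<in>Ob D.
           \<forall>u\<in>Hom C a' a. \<forall>h\<in>Hom D (Fo a) b. \<forall>v\<in>Hom D b b'.
             \<phi> a' b' (Comp D (Fo a') b b' v (Comp D (Fo a') (Fo a) b h (Fm a' a u))) =
             Comp C a' (Go b) (Go b') (Gm b b' v) (Comp C a' a (Go b) (\<phi> a b h) u)))"

section \<open>Limits and cartesian closedness\<close>

definition is_cone ::
  "('j, 'k) category \<Rightarrow> ('o, 'm) category \<Rightarrow> ('j \<Rightarrow> 'o) \<Rightarrow> ('j \<Rightarrow> 'j \<Rightarrow> 'k \<Rightarrow> 'm) \<Rightarrow> 'o \<Rightarrow> ('j \<Rightarrow> 'm) \<Rightarrow> bool"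
  where
  "is_cone J C Do Dm L \<pi> \<longleftrightarrow>
     L \<in> Ob C \<and> (\<forall>j\<in>Ob J. \<pi> j \<in> Hom C L (Do j)) \<and>
     (\<forall>j\<in>Ob J. \<forall>k\<in>Ob J. \<forall>u\<in>Hom J j k. Comp C L (Do j) (Do k) (Dm j k u) (\<pi> j) = \<pi> k)"

definition is_limit ::
  "('j, 'k) category \<Rightarrow> ('o, 'm) category \<Rightarrow> ('j \<Rightarrow> 'o) \<Rightarrow> ('j \<Rightarrow> 'j \<Rightarrow> 'k \<Rightarrow> 'm) \<Rightarrow> 'o \<Rightarrow> ('j \<Rightarrow> 'm) \<Rightarrow> bool"
  where
  "is_limit J C Do Dm L \<pi> \<longleftrightarrow>
     is_cone J C Do Dm L \<pi> \<and>
     (\<forall>X \<tau>. is_cone J C Do Dm X \<tau> \<longrightarrow>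
        (\<exists>!h. h \<in> Hom C X L \<and> (\<forall>j\<in>Ob J. Comp C X L (Do j) (\<pi> j) h = \<tau> j)))"

definition has_limits_of_shape :: "('j, 'k) category \<Rightarrow> ('o, 'm) category \<Rightarrow> bool" where
  "has_limits_of_shape J C \<longleftrightarrow> (\<forall>Do Dm. is_functor J C Do Dm \<longrightarrow> (\<exists>L \<pi>. is_limit J C Do Dm L \<pi>))"

definition is_terminal :: "('o, 'm) category \<Rightarrow> 'o \<Rightarrow> bool" where
  "is_terminal C Z \<longleftrightarrow> Z \<in> Ob C \<and> (\<forall>X\<in>Ob C. \<exists>!h. h \<in> Hom C X Z)"

definition is_product :: "('o, 'm) category \<Rightarrow> 'o \<Rightarrow> 'o \<Rightarrow> 'o \<times> 'm \<times> 'm \<Rightarrow> bool" where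
  "is_product C A B = (\<lambda>(P, p, q).
     P \<in> Ob C \<and> p \<in> Hom C P A \<and> q \<in> Hom C P B \<and>
     (\<forall>X\<in>Ob C. \<forall>f\<in>Hom C X A. \<forall>g\<in>Hom C X B.
        \<exists>!h. h \<in> Hom C X P \<and> Comp C X P A p h = f \<and> Comp C X P B q h = g))"

definition is_pullback ::
  "('o, 'm) category \<Rightarrow> 'o \<Rightarrow> 'o \<Rightarrow> 'o \<Rightarrow> 'm \<Rightarrow> 'm \<Rightarrow> 'o \<times> 'm \<times> 'm \<Rightarrow> bool" where
  "is_pullback C A B D f g = (\<lambda>(P, p, q).
     P \<in> Ob C \<and> p \<in> Hom C P A \<and> q \<in> Hom C P B \<and> Comp C P A D f p = Comp C P B D g q \<and>
     (\<forall>X\<in>Ob C. \<forall>x\<in>Hom C X A. \<forall>y\<in>Hom C X B. Comp C X A D f x = Comp C X B D g y \<longrightarrow>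
        (\<exists>!h. h \<in> Hom C X P \<and> Comp C X P A p h = x \<and> Comp C X P B q h = y)))"

definition has_finite_products :: "('o, 'm) category \<Rightarrow> bool" where
  "has_finite_products C \<longleftrightarrow>
     (\<exists>Z. is_terminal C Z) \<and> (\<forall>A\<in>Ob C. \<forall>B\<in>Ob C. \<exists>t. is_product C A B t)"

text \<open>Chosen terminal objects, products and pullbacks; meaningful when these exist.\<close>

definition termO :: "('o, 'm) category \<Rightarrow> 'o" where
  "termO C = (SOME Z. is_terminal C Z)"

definition to_term :: "('o, 'm) category \<Rightarrow> 'o \<Rightarrow> 'm" where
  "to_term C X = (THE h. h \<in> Hom C X (termO C))"

definition prod_cone :: "('o, 'm) category \<Rightarrow> 'o \<Rightarrow> 'o \<Rightarrow> 'o \<times> 'm \<times> 'm" where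
  "prod_cone C A B = (SOME t. is_product C A B t)"

definition prodO :: "('o, 'm) category \<Rightarrow> 'o \<Rightarrow> 'o \<Rightarrow> 'o" where
  "prodO C A B = fst (prod_cone C A B)"

definition proj1 :: "('o, 'm) category \<Rightarrow> 'o \<Rightarrow> 'o \<Rightarrow> 'm" where
  "proj1 C A B = fst (snd (prod_cone C A B))"

definition proj2 :: "('o, 'm) category \<Rightarrow> 'o \<Rightarrow> 'o \<Rightarrow> 'm" where
  "proj2 C A B = snd (snd (prod_cone C A B))"

definition pairing :: "('o, 'm) category \<Rightarrow> 'o \<Rightarrow> 'o \<Rightarrow> 'o \<Rightarrow> 'm \<Rightarrow> 'm \<Rightarrow> 'm" where
  "pairing C X A B f g =
     (THE h. h \<in> Hom C X (prodO C A B) \<and>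
        Comp C X (prodO C A B) A (proj1 C A B) h = f \<and>
        Comp C X (prodO C A B) B (proj2 C A B) h = g)"

definition prod_map :: "('o, 'm) category \<Rightarrow> 'o \<Rightarrow> 'o \<Rightarrow> 'o \<Rightarrow> 'o \<Rightarrow> 'm \<Rightarrow> 'm \<Rightarrow> 'm" where
  "prod_map C A A' B B' f g =
     pairing C (prodO C A B) A' B'
       (Comp C (prodO C A B) A A' f (proj1 C A B))
       (Comp C (prodO C A B) B B' g (proj2 C A B))"

definition pullback_cone :: "('o, 'm) category \<Rightarrow> 'o \<Rightarrow> 'o \<Rightarrow> 'o \<Rightarrow> 'm \<Rightarrow> 'm \<Rightarrow> 'o \<times> 'm \<times> 'm" where
  "pullback_cone C A B D f g = (SOME t. is_pullback C A B D f g t)"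

definition is_exponential :: "('o, 'm) category \<Rightarrow> 'o \<Rightarrow> 'o \<Rightarrow> 'o \<Rightarrow> 'm \<Rightarrow> bool" where
  "is_exponential C A B Z ev \<longleftrightarrow>
     Z \<in> Ob C \<and> ev \<in> Hom C (prodO C Z A) B \<and>
     (\<forall>X\<in>Ob C. \<forall>f\<in>Hom C (prodO C X A) B.
        \<exists>!g. g \<in> Hom C X Z \<and>
          Comp C (prodO C X A) (prodO C Z A) B ev (prod_map C X Z A A g (Ident C A)) = f)"

definition cartesian_closed :: "('o, 'm) category \<Rightarrow> bool" where
  "cartesian_closed C \<longleftrightarrow>
     has_finite_products C \<and> (\<forall>A\<in>Ob C. \<forall>B\<in>Ob C. \<exists>Z ev. is_exponential C A B Z ev)"

section \<open>Group objects\<close>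

datatype ('o, 'm) grp_obj = GrpObj (gob: 'o) (gmul: 'm) (gone: 'm) (ginv: 'm)

definition is_group_object :: "('o, 'm) category \<Rightarrow> ('o, 'm) grp_obj \<Rightarrow> bool" where
  "is_group_object C \<G> \<longleftrightarrow>
     (let G = gob \<G>; m = gmul \<G>; e = gone \<G>; i = ginv \<G>;
          P = prodO C G G; p = proj1 C G G; q = proj2 C G G;
          Q = prodO C P G; p' = proj1 C P G; z = proj2 C P G;
          x = Comp C Q P G p p'; y = Comp C Q P G q p';
          e' = Comp C G (termO C) G e (to_term C G);
          mult = (\<lambda>X a b. Comp C X P G m (pairing C X G G a b))
      in G \<in> Ob C \<and> m \<in> Hom C P G \<and> e \<in> Hom C (termO C) G \<and> i \<in> Hom C G G \<and>
         mult Q (mult Q x y) z = mult Q x (mult Q y z) \<and>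
         mult G e' (Ident C G) = Ident C G \<and> mult G (Ident C G) e' = Ident C G \<and>
         mult G i (Ident C G) = e' \<and> mult G (Ident C G) i = e')"

definition Grp :: "('o, 'm) category \<Rightarrow> (('o, 'm) grp_obj, 'm) category" where
  "Grp C = \<lparr>
     Ob = {\<G>. is_group_object C \<G>},
     Hom = (\<lambda>\<G> \<H>. {f \<in> Hom C (gob \<G>) (gob \<H>).
        Comp C (prodO C (gob \<G>) (gob \<G>)) (gob \<G>) (gob \<H>) f (gmul \<G>) =
        Comp C (prodO C (gob \<G>) (gob \<G>)) (prodO C (gob \<H>) (gob \<H>)) (gob \<H>) (gmul \<H>)
          (prod_map C (gob \<G>) (gob \<H>) (gob \<G>) (gob \<H>) f f)}),
     Ident = (\<lambda>\<G>. Ident C (gob \<G>)),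
     Comp = (\<lambda>\<G> \<H> \<K>. Comp C (gob \<G>) (gob \<H>) (gob \<K>)) \<rparr>"

section \<open>Points and local algebraic cartesian closedness\<close>

datatype ('o, 'm) point = Point (ptot: 'o) (pproj: 'm) (psect: 'm)

definition Pt :: "('o, 'm) category \<Rightarrow> 'o \<Rightarrow> (('o, 'm) point, 'm) category" where
  "Pt C B = \<lparr>
     Ob = {x. ptot x \<in> Ob C \<and> pproj x \<in> Hom C (ptot x) B \<and> psect x \<in> Hom C B (ptot x) \<and>
              Comp C B (ptot x) B (pproj x) (psect x) = Ident C B},
     Hom = (\<lambda>x y. {f \<in> Hom C (ptot x) (ptot y).
              Comp C (ptot x) (ptot y) B (pproj y) f = pproj x \<and>
              Comp C B (ptot x) (ptot y) f (psect x) = psect y}),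
     Ident = (\<lambda>x. Ident C (ptot x)),
     Comp = (\<lambda>x y z. Comp C (ptot x) (ptot y) (ptot z)) \<rparr>"

text \<open>The functor \<open>\<alpha>\<^sup>*\<close> from points over \<open>B\<close> to points over \<open>E\<close>, for \<open>\<alpha> : E \<rightarrow> B\<close>.
  The section of the pulled back point is induced by the identity of \<open>E\<close> and the composite
  of \<open>\<alpha>\<close> with the given section.\<close>

abbreviation point_pullback ::
  "('o, 'm) category \<Rightarrow> 'o \<Rightarrow> 'o \<Rightarrow> 'm \<Rightarrow> ('o, 'm) point \<Rightarrow> 'o \<times> 'm \<times> 'm" where
  "point_pullback C E B \<alpha> x \<equiv> pullback_cone C E (ptot x) B \<alpha> (pproj x)"

definition reindex_ob ::
  "('o, 'm) category \<Rightarrow> 'o \<Rightarrow> 'o \<Rightarrow> 'm \<Rightarrow> ('o, 'm) point \<Rightarrow> ('o, 'm) point" where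
  "reindex_ob C E B \<alpha> x =
     (case point_pullback C E B \<alpha> x of (P, p, q) \<Rightarrow>
        Point P p (THE s. s \<in> Hom C E P \<and> Comp C E P E p s = Ident C E \<and>
                      Comp C E P (ptot x) q s = Comp C E B (ptot x) (psect x) \<alpha>))"

definition reindex_ar ::
  "('o, 'm) category \<Rightarrow> 'o \<Rightarrow> 'o \<Rightarrow> 'm \<Rightarrow> ('o, 'm) point \<Rightarrow> ('o, 'm) point \<Rightarrow> 'm \<Rightarrow> 'm" where
  "reindex_ar C E B \<alpha> x y f =
     (case point_pullback C E B \<alpha> x of (P, p, q) \<Rightarrow>
      case point_pullback C E B \<alpha> y of (P', p', q') \<Rightarrow>
        (THE h. h \<in> Hom C P P' \<and> Comp C P P' E p' h = p \<and>
           Comp C P P' (ptot y) q' h = Comp C P (ptot x) (ptot y) f q))"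

text \<open>The first conjunct makes \<open>\<alpha>\<^sup>*\<close> well-defined.\<close>

definition LACC :: "('o, 'm) category \<Rightarrow> bool" where
  "LACC C \<longleftrightarrow>
     (\<forall>E\<in>Ob C. \<forall>B\<in>Ob C. \<forall>\<alpha>\<in>Hom C E B. \<forall>x\<in>Ob (Pt C B).
        \<exists>t. is_pullback C E (ptot x) B \<alpha> (pproj x) t) \<and>
     (\<forall>E\<in>Ob C. \<forall>B\<in>Ob C. \<forall>\<alpha>\<in>Hom C E B.
        has_right_adjoint (Pt C B) (Pt C E) (reindex_ob C E B \<alpha>) (reindex_ar C E B \<alpha>))"

section \<open>Size\<close>

text \<open>The type \<open>'u\<close> plays the role of a Grothendieck universe: small means of cardinality strictly
  below that of \<open>'u\<close>, which is required to be regular and a strong limit (inaccessible, with the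
  countable cardinal not excluded). Every small set, of whatever type, is equipollent to a small
  subset of \<open>'u\<close>.\<close>

definition small :: "'u set \<Rightarrow> bool" where
  "small A \<longleftrightarrow> A \<prec> (UNIV :: 'u set)"

definition universe_type :: "'u itself \<Rightarrow> bool" where
  "universe_type (_ :: 'u itself) \<longleftrightarrow>
     infinite (UNIV :: 'u set) \<and>
     (\<forall>A :: 'u set. small A \<longrightarrow> Pow A \<prec> (UNIV :: 'u set)) \<and>
     (\<forall>(I :: 'u set) (F :: 'u \<Rightarrow> 'u set).
        small I \<and> (\<forall>i\<in>I. small (F i)) \<longrightarrow> small (\<Union>i\<in>I. F i))"

definition small_category :: "('u, 'u) category \<Rightarrow> bool" where
  "small_category J \<longleftrightarrow>
     is_category J \<and> small (Ob J) \<and> (\<forall>a\<in>Ob J. \<forall>b\<in>Ob J. small (Hom J a b))"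

section \<open>Convenient categories of topological spaces\<close>

text \<open>The full subcategory of topological spaces on a class \<open>T\<close> of objects. An arrow is a continuous
  map made extensional, so that equality of arrows is equality on the carrier.\<close>

definition Top :: "'u topology set \<Rightarrow> ('u topology, 'u \<Rightarrow> 'u) category" where
  "Top T = \<lparr>
     Ob = T,
     Hom = (\<lambda>X Y. {f \<in> extensional (topspace X). continuous_map X Y f}),
     Ident = (\<lambda>X. restrict id (topspace X)),
     Comp = (\<lambda>X Y Z g f. restrict (g \<circ> f) (topspace X)) \<rparr>"

definition convenient :: "'u topology set \<Rightarrow> bool" where
  "convenient T \<longleftrightarrow>
     (\<forall>X\<in>T. small (topspace X)) \<and>
     (\<exists>X\<in>T. \<exists>x. topspace X = {x}) \<and>
     (\<forall>J :: ('u, 'u) category. small_category J \<longrightarrow> has_limits_of_shape J (Top T)) \<and>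
     cartesian_closed (Top T) \<and>
     (\<forall>X\<in>T. \<forall>S. S \<subseteq> topspace X \<longrightarrow>
        (\<exists>Y\<in>T. topspace Y = S \<and> continuous_map Y X id \<and>
           (\<forall>Z\<in>T. \<forall>f. continuous_map Z X f \<and> f ` topspace Z \<subseteq> S \<longrightarrow> continuous_map Z Y f)))"

definition compact_Hausdorff :: "'u topology \<Rightarrow> bool" where
  "compact_Hausdorff K \<longleftrightarrow> small (topspace K) \<and> compact_space K \<and> Hausdorff_space K"

definition compactly_generated :: "'u topology \<Rightarrow> bool" where
  "compactly_generated X \<longleftrightarrow>
     (\<forall>A. A \<subseteq> topspace X \<and>
        (\<forall>(K :: 'u topology) f. compact_Hausdorff K \<and> continuous_map K X f \<longrightarrow>
           closedin K {k \<in> topspace K. f k \<in> A}) \<longrightarrow> closedin X A)"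

definition weakly_Hausdorff :: "'u topology \<Rightarrow> bool" where
  "weakly_Hausdorff X \<longleftrightarrow>
     (\<forall>(K :: 'u topology) f. compact_Hausdorff K \<and> continuous_map K X f \<longrightarrow>
        closedin X (f ` topspace K))"

definition CGWH :: "'u topology set" where
  "CGWH = {X. small (topspace X) \<and> compactly_generated X \<and> weakly_Hausdorff X}"

end

theory Submission
  imports Defs "HOL-Algebra.Group"
begin

text \<open>Coinduction for group objects is given by a space of equivariant maps, and the point of the hypotheses on
  the category of spaces is that such a space can be formed in it.

  Let \<open>\<alpha> : E \<rightarrow> B\<close>, and let \<open>\<pi> : A \<rightarrow> E\<close> with section \<open>\<sigma>\<close> be a point over \<open>E\<close>. Conjugation by \<open>\<sigma>\<close> makes the kernel of \<open>\<pi>\<close> an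
  \<open>E\<close>-group, and the coinduced \<open>B\<close>-group consists of the continuous maps \<open>\<phi> : B \<rightarrow> ker \<pi>\<close> satisfying
  \<open>\<phi> (\<alpha> e \<cdot> c) = \<sigma> e \<cdot> \<phi> c \<cdot> (\<sigma> e)\<inverse>\<close>, with pointwise multiplication and with \<open>B\<close> acting by \<open>(b \<cdot> \<phi>) c = \<phi> (c \<cdot> b)\<close>. A point is a
  semidirect product, so the total object of the coinduced point is the set of pairs \<open>(\<phi>, b)\<close> with the product
  \<open>(\<phi>, b) \<cdot> (\<phi>', b') = (c \<mapsto> \<phi> c \<cdot> \<phi>' (c \<cdot> b), b \<cdot> b')\<close>. This is a subset of the product of the exponential \<open>A\<^sup>B\<close> with \<open>B\<close>; it
  carries the topology that the class of spaces provides for subsets, and the operations are continuous because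
  maps into it correspond, by cartesian closedness, to maps of two variables into \<open>A\<close>
  (\<open>coinduced_exists\<close>). The counit is \<open>(e, (\<phi>, \<alpha> e)) \<mapsto> \<phi> 1 \<cdot> \<sigma> e\<close>, and the transpose of \<open>h\<close> sends \<open>x\<close> over \<open>b\<close> to the pair of
  \<open>c \<mapsto> h (1, s c \<cdot> x \<cdot> (s (c \<cdot> b))\<inverse>)\<close> and \<open>b\<close>, where \<open>s\<close> is the section of the point that contains \<open>x\<close> (\<open>coind_cofree\<close>).

  Since the one-point space belongs to the class, points of a space are arrows, and the categorical data
  (chosen products, pullbacks, exponentials, group objects) can be described by elements: a product has pairs as
  its points, a group object is a group with continuous operations, and so on. All computations are then
  computations in ordinary groups.

  It remains to see that compactly generated weakly Hausdorff spaces have finite products, subspaces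
  and exponentials. Each is obtained by refining an evident topology to a compactly generated one
  (\<open>k_ification\<close>). The only delicate point is the weak Hausdorff property, and one criterion serves all three cases:
  the refinement of a topology is weakly Hausdorff if points are separated by continuous maps to
  weakly Hausdorff spaces (\<open>weakly_Hausdorff_k_ification\<close>). Coordinates, the inclusion and the evaluations are such maps.\<close>

section \<open>Right adjoints and change of base\<close>

lemma category_ident: "is_category C \<Longrightarrow> a \<in> Ob C \<Longrightarrow> Ident C a \<in> Hom C a a"
  unfolding is_category_def by blast

lemma category_comp:
  "is_category C \<Longrightarrow> a \<in> Ob C \<Longrightarrow> b \<in> Ob C \<Longrightarrow> c \<in> Ob C \<Longrightarrow> f \<in> Hom C a b \<Longrightarrow> g \<in> Hom C b c
    \<Longrightarrow> Comp C a b c g f \<in> Hom C a c"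
  unfolding is_category_def by blast

lemma category_ident_right:
  "is_category C \<Longrightarrow> a \<in> Ob C \<Longrightarrow> b \<in> Ob C \<Longrightarrow> f \<in> Hom C a b \<Longrightarrow> Comp C a a b f (Ident C a) = f"
  unfolding is_category_def by blast

lemma category_ident_left:
  "is_category C \<Longrightarrow> a \<in> Ob C \<Longrightarrow> b \<in> Ob C \<Longrightarrow> f \<in> Hom C a b \<Longrightarrow> Comp C a b b (Ident C b) f = f"
  unfolding is_category_def by blast

lemma category_assoc:
  "is_category C \<Longrightarrow> a \<in> Ob C \<Longrightarrow> b \<in> Ob C \<Longrightarrow> c \<in> Ob C \<Longrightarrow> d \<in> Ob C
    \<Longrightarrow> f \<in> Hom C a b \<Longrightarrow> g \<in> Hom C b c \<Longrightarrow> h \<in> Hom C c d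
    \<Longrightarrow> Comp C a c d h (Comp C a b c g f) = Comp C a b d (Comp C b c d h g) f"
  unfolding is_category_def by blast

lemma functor_ob: "is_functor C D Fo Fm \<Longrightarrow> a \<in> Ob C \<Longrightarrow> Fo a \<in> Ob D"
  unfolding is_functor_def by blast

lemma functor_ar:
  "is_functor C D Fo Fm \<Longrightarrow> a \<in> Ob C \<Longrightarrow> b \<in> Ob C \<Longrightarrow> f \<in> Hom C a b \<Longrightarrow> Fm a b f \<in> Hom D (Fo a) (Fo b)"
  unfolding is_functor_def by blast

lemma functor_ident: "is_functor C D Fo Fm \<Longrightarrow> a \<in> Ob C \<Longrightarrow> Fm a a (Ident C a) = Ident D (Fo a)"
  unfolding is_functor_def by blast

lemma functor_comp:
  "is_functor C D Fo Fm \<Longrightarrow> a \<in> Ob C \<Longrightarrow> b \<in> Ob C \<Longrightarrow> c \<in> Ob C \<Longrightarrow> f \<in> Hom C a b \<Longrightarrow> g \<in> Hom C b c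
    \<Longrightarrow> Fm a c (Comp C a b c g f) = Comp D (Fo a) (Fo b) (Fo c) (Fm b c g) (Fm a b f)"
  unfolding is_functor_def by blast

text \<open>A right adjoint may be given object by object, as universal arrows out of the functor: its action on
  arrows and the naturality of the bijection are forced by uniqueness.\<close>

lemma right_adjoint_if_cofree_objects:
  assumes C: "is_category C" and D: "is_category D" and F: "is_functor C D Fo Fm"
    and cofree: "\<And>b. b \<in> Ob D \<Longrightarrow> \<exists>R\<in>Ob C. \<exists>\<epsilon>\<in>Hom D (Fo R) b. \<forall>a\<in>Ob C. \<forall>h\<in>Hom D (Fo a) b.
      \<exists>!u. u \<in> Hom C a R \<and> Comp D (Fo a) (Fo R) b \<epsilon> (Fm a R u) = h"
  shows "has_right_adjoint C D Fo Fm"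
proof -
  have "\<exists>p. b \<in> Ob D \<longrightarrow> (fst p \<in> Ob C \<and> snd p \<in> Hom D (Fo (fst p)) b \<and>
      (\<forall>a\<in>Ob C. \<forall>h\<in>Hom D (Fo a) b.
        \<exists>!u. u \<in> Hom C a (fst p) \<and> Comp D (Fo a) (Fo (fst p)) b (snd p) (Fm a (fst p) u) = h))" for b
  proof (cases "b \<in> Ob D")
    case True
    from cofree[OF this] obtain R \<epsilon> where "R\<in>Ob C" "\<epsilon>\<in>Hom D (Fo R) b" "\<forall>a\<in>Ob C. \<forall>h\<in>Hom D (Fo a) b.
      \<exists>!u. u \<in> Hom C a R \<and> Comp D (Fo a) (Fo R) b \<epsilon> (Fm a R u) = h" by blast
    then show ?thesis by (intro exI[of _ "(R, \<epsilon>)"]) simp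
  qed simp
  then obtain p where p: "\<And>b. b \<in> Ob D \<longrightarrow> (fst (p b) \<in> Ob C \<and> snd (p b) \<in> Hom D (Fo (fst (p b))) b \<and>
      (\<forall>a\<in>Ob C. \<forall>h\<in>Hom D (Fo a) b.
        \<exists>!u. u \<in> Hom C a (fst (p b)) \<and> Comp D (Fo a) (Fo (fst (p b))) b (snd (p b)) (Fm a (fst (p b)) u) = h))"
    by metis
  define R where "R b = fst (p b)" for b
  define \<epsilon> where "\<epsilon> b = snd (p b)" for b
  have R: "R b \<in> Ob C" and \<epsilon>: "\<epsilon> b \<in> Hom D (Fo (R b)) b" if "b \<in> Ob D" for b
    using p that by (auto simp: R_def \<epsilon>_def)
  have univ: "\<exists>!u. u \<in> Hom C a (R b) \<and> Comp D (Fo a) (Fo (R b)) b (\<epsilon> b) (Fm a (R b) u) = h"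
    if "a \<in> Ob C" "b \<in> Ob D" "h \<in> Hom D (Fo a) b" for a b h
    using p that unfolding R_def \<epsilon>_def by blast
  define \<phi> where "\<phi> a b h =
      (THE u. u \<in> Hom C a (R b) \<and> Comp D (Fo a) (Fo (R b)) b (\<epsilon> b) (Fm a (R b) u) = h)" for a b h
  have \<phi>: "\<phi> a b h \<in> Hom C a (R b)" "Comp D (Fo a) (Fo (R b)) b (\<epsilon> b) (Fm a (R b) (\<phi> a b h)) = h"
    if "a \<in> Ob C" "b \<in> Ob D" "h \<in> Hom D (Fo a) b" for a b h
    using theI'[OF univ[OF that]] unfolding \<phi>_def by auto
  have \<phi>_eq: "\<phi> a b h = u" if "a \<in> Ob C" "b \<in> Ob D" "u \<in> Hom C a (R b)"
     "Comp D (Fo a) (Fo (R b)) b (\<epsilon> b) (Fm a (R b) u) = h" for a b h u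
  proof -
    have "h \<in> Hom D (Fo a) b"
      using that category_comp[OF D functor_ob[OF F] functor_ob[OF F] _ functor_ar[OF F] \<epsilon>] R by blast
    then show ?thesis using univ[OF that(1,2)] \<phi>[OF that(1,2)] that by blast
  qed
  define Gm where "Gm b b' v = \<phi> (R b) b' (Comp D (Fo (R b)) b b' v (\<epsilon> b))" for b b' v
  have Gm: "Gm b b' v \<in> Hom C (R b) (R b')"
     "Comp D (Fo (R b)) (Fo (R b')) b' (\<epsilon> b') (Fm (R b) (R b') (Gm b b' v)) = Comp D (Fo (R b)) b b' v (\<epsilon> b)"
    if "b \<in> Ob D" "b' \<in> Ob D" "v \<in> Hom D b b'" for b b' v
  proof -
    have "Comp D (Fo (R b)) b b' v (\<epsilon> b) \<in> Hom D (Fo (R b)) b'"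
      using that by (intro category_comp[OF D] functor_ob[OF F] R \<epsilon>) auto
    from \<phi>[OF R[OF that(1)] that(2) this] show "Gm b b' v \<in> Hom C (R b) (R b')"
     "Comp D (Fo (R b)) (Fo (R b')) b' (\<epsilon> b') (Fm (R b) (R b') (Gm b b' v)) = Comp D (Fo (R b)) b b' v (\<epsilon> b)"
      unfolding Gm_def by auto
  qed
  \<comment> \<open>Following a transpose by a value of the right adjoint gives the transpose of the composite; naturality
    of the bijection and functoriality of the right adjoint are both instances.\<close>
  have after: "Comp C a (R b) (R b') (Gm b b' v) w = \<phi> a b' (Comp D (Fo a) b b' v h)"
    if a: "a \<in> Ob C" and b: "b \<in> Ob D" and b': "b' \<in> Ob D" and w: "w \<in> Hom C a (R b)"
      and wh: "Comp D (Fo a) (Fo (R b)) b (\<epsilon> b) (Fm a (R b) w) = h"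
      and v: "v \<in> Hom D b b'" for a b b' v w h
  proof (rule sym, rule \<phi>_eq)
    note o = functor_ob[OF F a] functor_ob[OF F R[OF b]] functor_ob[OF F R[OF b']] b b'
    note w' = functor_ar[OF F a R[OF b] w]
    note g' = functor_ar[OF F R[OF b] R[OF b'] Gm(1)[OF b b' v]]
    show "Comp C a (R b) (R b') (Gm b b' v) w \<in> Hom C a (R b')"
      using category_comp[OF C a R[OF b] R[OF b'] w Gm(1)[OF b b' v]] .
    have "Comp D (Fo a) (Fo (R b')) b' (\<epsilon> b') (Fm a (R b') (Comp C a (R b) (R b') (Gm b b' v) w))
      = Comp D (Fo a) (Fo (R b')) b' (\<epsilon> b')
          (Comp D (Fo a) (Fo (R b)) (Fo (R b')) (Fm (R b) (R b') (Gm b b' v)) (Fm a (R b) w))"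
      using functor_comp[OF F a R[OF b] R[OF b'] w Gm(1)[OF b b' v]] by simp
    also have "\<dots> = Comp D (Fo a) (Fo (R b)) b'
        (Comp D (Fo (R b)) (Fo (R b')) b' (\<epsilon> b') (Fm (R b) (R b') (Gm b b' v))) (Fm a (R b) w)"
      using category_assoc[OF D o(1,2,3) b' w' g' \<epsilon>[OF b']] .
    also have "\<dots> = Comp D (Fo a) b b' v (Comp D (Fo a) (Fo (R b)) b (\<epsilon> b) (Fm a (R b) w))"
      using category_assoc[OF D o(1,2) b b' w' \<epsilon>[OF b] v] Gm(2)[OF b b' v] by simp
    finally show "Comp D (Fo a) (Fo (R b')) b' (\<epsilon> b') (Fm a (R b') (Comp C a (R b) (R b') (Gm b b' v) w))
        = Comp D (Fo a) b b' v h" using wh by simp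
  qed (use that in auto)
  have G: "is_functor D C R Gm"
    unfolding is_functor_def
  proof (intro conjI ballI)
    fix b assume b: "b \<in> Ob D"
    show "Gm b b (Ident D b) = Ident C (R b)"
      unfolding Gm_def
    proof (rule \<phi>_eq)
      show "Comp D (Fo (R b)) (Fo (R b)) b (\<epsilon> b) (Fm (R b) (R b) (Ident C (R b))) =
        Comp D (Fo (R b)) b b (Ident D b) (\<epsilon> b)"
        using b by (simp add: functor_ident[OF F R] category_ident_right[OF D] category_ident_left[OF D] functor_ob[OF F R] \<epsilon>)
    qed (use b R category_ident[OF C] in auto)
  next
    fix a b c f g assume *: "a \<in> Ob D" "b \<in> Ob D" "c \<in> Ob D" "f \<in> Hom D a b" "g \<in> Hom D b c"
    have "Comp C (R a) (R b) (R c) (Gm b c g) (Gm a b f)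
        = \<phi> (R a) c (Comp D (Fo (R a)) b c g (Comp D (Fo (R a)) a b f (\<epsilon> a)))"
      using * by (intro after Gm R) auto
    also have "\<dots> = Gm a c (Comp D a b c g f)"
      unfolding Gm_def using category_assoc[OF D functor_ob[OF F R] *(1-3) \<epsilon> *(4,5)] * by simp
    finally show "Gm a c (Comp D a b c g f) = Comp C (R a) (R b) (R c) (Gm b c g) (Gm a b f)" by simp
  qed (use R Gm in auto)
  have bij: "bij_betw (\<phi> a b) (Hom D (Fo a) b) (Hom C a (R b))" if "a \<in> Ob C" "b \<in> Ob D" for a b
  proof (rule bij_betwI[where g="\<lambda>u. Comp D (Fo a) (Fo (R b)) b (\<epsilon> b) (Fm a (R b) u)"])
    show "\<phi> a b \<in> Hom D (Fo a) b \<rightarrow> Hom C a (R b)" using \<phi> that by auto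
    show "(\<lambda>u. Comp D (Fo a) (Fo (R b)) b (\<epsilon> b) (Fm a (R b) u)) \<in> Hom C a (R b) \<rightarrow> Hom D (Fo a) b"
      using that category_comp[OF D functor_ob[OF F] functor_ob[OF F] _ functor_ar[OF F] \<epsilon>] R by blast
  qed (use \<phi> \<phi>_eq that in auto)
  have nat: "\<phi> a' b' (Comp D (Fo a') b b' v (Comp D (Fo a') (Fo a) b h (Fm a' a u))) =
             Comp C a' (R b) (R b') (Gm b b' v) (Comp C a' a (R b) (\<phi> a b h) u)"
    if a: "a \<in> Ob C" and a': "a' \<in> Ob C" and b: "b \<in> Ob D" and b': "b' \<in> Ob D"
      and u: "u \<in> Hom C a' a" and h: "h \<in> Hom D (Fo a) b" and v: "v \<in> Hom D b b'" for a a' b b' u h v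
  proof (rule sym, rule after)
    show "Comp C a' a (R b) (\<phi> a b h) u \<in> Hom C a' (R b)"
      using category_comp[OF C a' a R[OF b] u \<phi>(1)[OF a b h]] .
    show "Comp D (Fo a') (Fo (R b)) b (\<epsilon> b) (Fm a' (R b) (Comp C a' a (R b) (\<phi> a b h) u)) =
        Comp D (Fo a') (Fo a) b h (Fm a' a u)"
      using functor_comp[OF F a' a R[OF b] u \<phi>(1)[OF a b h]]
        category_assoc[OF D functor_ob[OF F a'] functor_ob[OF F a] functor_ob[OF F R[OF b]] b
          functor_ar[OF F a' a u] functor_ar[OF F a R[OF b] \<phi>(1)[OF a b h]] \<epsilon>[OF b]]
        \<phi>(2)[OF a b h] by simp
  qed (use that in auto)
  show ?thesis
    unfolding has_right_adjoint_def
    by (intro conjI F exI[of _ R] exI[of _ Gm] exI[of _ \<phi>] G ballI bij nat) auto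
qed

lemma Pt_simps:
  "x \<in> Ob (Pt C B) \<longleftrightarrow> ptot x \<in> Ob C \<and> pproj x \<in> Hom C (ptot x) B \<and> psect x \<in> Hom C B (ptot x) \<and>
     Comp C B (ptot x) B (pproj x) (psect x) = Ident C B"
  "f \<in> Hom (Pt C B) x y \<longleftrightarrow> f \<in> Hom C (ptot x) (ptot y) \<and>
     Comp C (ptot x) (ptot y) B (pproj y) f = pproj x \<and> Comp C B (ptot x) (ptot y) f (psect x) = psect y"
  "Ident (Pt C B) x = Ident C (ptot x)"
  "Comp (Pt C B) x y z g f = Comp C (ptot x) (ptot y) (ptot z) g f"
  unfolding Pt_def by auto

lemma Pt_category:
  assumes C: "is_category C" and B: "B \<in> Ob C"
  shows "is_category (Pt C B)"
  unfolding is_category_def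
proof (intro conjI ballI)
  fix a b c f g assume a: "a \<in> Ob (Pt C B)" "b \<in> Ob (Pt C B)" "c \<in> Ob (Pt C B)"
    "f \<in> Hom (Pt C B) a b" "g \<in> Hom (Pt C B) b c"
  then show "Comp (Pt C B) a b c g f \<in> Hom (Pt C B) a c"
    using category_comp[OF C] category_assoc[OF C, of "ptot a" "ptot b" "ptot c" B f g "pproj c"]
       category_assoc[OF C, of B "ptot a" "ptot b" "ptot c" "psect a" f g] B
    by (auto simp: Pt_simps)
qed (use category_ident[OF C] category_ident_left[OF C] category_ident_right[OF C]
      category_assoc[OF C] B in \<open>auto simp: Pt_simps\<close>)

lemma pullback_cone_is_pullback:
  "\<exists>t. is_pullback C A B D f g t \<Longrightarrow> is_pullback C A B D f g (pullback_cone C A B D f g)"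
  unfolding pullback_cone_def by (rule someI_ex)

text \<open>What the chosen pullback of a point provides: the data of the pulled back point over \<open>E\<close>, an
  arrow \<open>q\<close> to the original total object, and the universal property.\<close>

lemma reindex_ob_pullback:
  assumes C: "is_category C" and E: "E \<in> Ob C" and B: "B \<in> Ob C" and \<alpha>: "\<alpha> \<in> Hom C E B"
    and x: "x \<in> Ob (Pt C B)"
    and ex: "\<exists>t. is_pullback C E (ptot x) B \<alpha> (pproj x) t"
  obtains P p q s where "point_pullback C E B \<alpha> x = (P, p, q)"
    "is_pullback C E (ptot x) B \<alpha> (pproj x) (P, p, q)"
    "reindex_ob C E B \<alpha> x = Point P p s"
    "s \<in> Hom C E P" "Comp C E P E p s = Ident C E"
    "Comp C E P (ptot x) q s = Comp C E B (ptot x) (psect x) \<alpha>"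
    "Point P p s \<in> Ob (Pt C E)"
proof -
  obtain P p q where t: "point_pullback C E B \<alpha> x = (P, p, q)" by (metis prod_cases3)
  have pb: "is_pullback C E (ptot x) B \<alpha> (pproj x) (P, p, q)"
    using pullback_cone_is_pullback[OF ex] t by simp
  let ?s = "THE s. s \<in> Hom C E P \<and> Comp C E P E p s = Ident C E \<and>
                      Comp C E P (ptot x) q s = Comp C E B (ptot x) (psect x) \<alpha>"
  have x': "ptot x \<in> Ob C" "pproj x \<in> Hom C (ptot x) B" "psect x \<in> Hom C B (ptot x)"
     "Comp C B (ptot x) B (pproj x) (psect x) = Ident C B" using x by (auto simp: Pt_simps)
  have s\<alpha>: "Comp C E B (ptot x) (psect x) \<alpha> \<in> Hom C E (ptot x)"
    using category_comp[OF C E B x'(1) \<alpha> x'(3)] .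
  have "Comp C E E B \<alpha> (Ident C E) = Comp C E (ptot x) B (pproj x) (Comp C E B (ptot x) (psect x) \<alpha>)"
    using category_assoc[OF C E B x'(1) B \<alpha> x'(3,2)] x'(4)
    by (simp add: category_ident_right[OF C E B \<alpha>] category_ident_left[OF C E B \<alpha>])
  then have "\<exists>!s. s \<in> Hom C E P \<and> Comp C E P E p s = Ident C E \<and>
                      Comp C E P (ptot x) q s = Comp C E B (ptot x) (psect x) \<alpha>"
    using pb E category_ident[OF C E] s\<alpha> unfolding is_pullback_def by auto
  from theI'[OF this] have s: "?s \<in> Hom C E P" "Comp C E P E p ?s = Ident C E"
    "Comp C E P (ptot x) q ?s = Comp C E B (ptot x) (psect x) \<alpha>" by auto
  have "reindex_ob C E B \<alpha> x = Point P p ?s" unfolding reindex_ob_def t by simp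
  moreover have "Point P p ?s \<in> Ob (Pt C E)" using s pb by (auto simp: Pt_simps is_pullback_def)
  ultimately show thesis using that[OF t pb _ s] by blast
qed

lemma pullback_arrow_eqI:
  assumes "is_pullback C A B D f g (P, p, q)" "is_category C" "A \<in> Ob C" "B \<in> Ob C" "D \<in> Ob C"
    "f \<in> Hom C A D" "g \<in> Hom C B D" "X \<in> Ob C"
    "h \<in> Hom C X P" "k \<in> Hom C X P" "Comp C X P A p h = Comp C X P A p k" "Comp C X P B q h = Comp C X P B q k"
  shows "h = k"
proof -
  have pq: "P \<in> Ob C" "p \<in> Hom C P A" "q \<in> Hom C P B" "Comp C P A D f p = Comp C P B D g q"
    and u: "\<And>X x y. X\<in>Ob C \<Longrightarrow> x\<in>Hom C X A \<Longrightarrow> y\<in>Hom C X B \<Longrightarrow> Comp C X A D f x = Comp C X B D g y \<Longrightarrow>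
        (\<exists>!h. h \<in> Hom C X P \<and> Comp C X P A p h = x \<and> Comp C X P B q h = y)"
    using assms(1) unfolding is_pullback_def by auto
  have "Comp C X A D f (Comp C X P A p k) = Comp C X B D g (Comp C X P B q k)"
    using category_assoc[OF assms(2,8) pq(1) assms(3,5,10) pq(2) assms(6)]
      category_assoc[OF assms(2,8) pq(1) assms(4,5,10) pq(3) assms(7)] pq(4) by simp
  from u[OF assms(8) _ _ this] category_comp[OF assms(2,8) pq(1)] assms pq
  have "\<exists>!h. h \<in> Hom C X P \<and> Comp C X P A p h = Comp C X P A p k \<and> Comp C X P B q h = Comp C X P B q k"
    by blast
  then show ?thesis using assms(9-12) by blast
qed

text \<open>The pulled back arrow is determined by the square it makes with the projections to the total
  objects; functoriality follows by uniqueness.\<close>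

lemma reindex_ar_char:
  assumes C: "is_category C" and E: "E \<in> Ob C" and B: "B \<in> Ob C" and \<alpha>: "\<alpha> \<in> Hom C E B"
    and x: "x \<in> Ob (Pt C B)" and y: "y \<in> Ob (Pt C B)" and f: "f \<in> Hom (Pt C B) x y"
    and X: "point_pullback C E B \<alpha> x = (P, p, q)" "is_pullback C E (ptot x) B \<alpha> (pproj x) (P, p, q)"
    and Y: "point_pullback C E B \<alpha> y = (P', p', q')" "is_pullback C E (ptot y) B \<alpha> (pproj y) (P', p', q')"
  shows "reindex_ar C E B \<alpha> x y f \<in> Hom C P P'"
    "Comp C P P' E p' (reindex_ar C E B \<alpha> x y f) = p"
    "Comp C P P' (ptot y) q' (reindex_ar C E B \<alpha> x y f) = Comp C P (ptot x) (ptot y) f q"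
proof -
  note pb = X(2)[unfolded is_pullback_def, simplified]
  have "Comp C P E B \<alpha> p = Comp C P (ptot y) B (pproj y) (Comp C P (ptot x) (ptot y) f q)"
    using category_assoc[OF C, of P "ptot x" "ptot y" B q f "pproj y"] pb x y f B by (simp add: Pt_simps)
  moreover have "Comp C P (ptot x) (ptot y) f q \<in> Hom C P (ptot y)"
    using category_comp[OF C, of P "ptot x" "ptot y" q f] pb x y f by (simp add: Pt_simps)
  ultimately have "\<exists>!h. h \<in> Hom C P P' \<and> Comp C P P' E p' h = p \<and>
           Comp C P P' (ptot y) q' h = Comp C P (ptot x) (ptot y) f q"
    using Y(2) pb unfolding is_pullback_def by auto
  from theI'[OF this] show "reindex_ar C E B \<alpha> x y f \<in> Hom C P P'"
    "Comp C P P' E p' (reindex_ar C E B \<alpha> x y f) = p"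
    "Comp C P P' (ptot y) q' (reindex_ar C E B \<alpha> x y f) = Comp C P (ptot x) (ptot y) f q"
    unfolding reindex_ar_def X(1) Y(1) by auto
qed

lemma reindex_functor:
  assumes C: "is_category C" and E: "E \<in> Ob C" and B: "B \<in> Ob C" and \<alpha>: "\<alpha> \<in> Hom C E B"
    and ex: "\<And>x. x \<in> Ob (Pt C B) \<Longrightarrow> \<exists>t. is_pullback C E (ptot x) B \<alpha> (pproj x) t"
  shows "is_functor (Pt C B) (Pt C E) (reindex_ob C E B \<alpha>) (reindex_ar C E B \<alpha>)"
proof -
  let ?r = "reindex_ar C E B \<alpha>"
  show ?thesis
    unfolding is_functor_def
  proof (intro conjI ballI)
    fix x assume x: "x \<in> Ob (Pt C B)"
    from reindex_ob_pullback[OF C E B \<alpha> x ex[OF x]] obtain P p q s where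
      X: "point_pullback C E B \<alpha> x = (P, p, q)" "is_pullback C E (ptot x) B \<alpha> (pproj x) (P, p, q)"
      and r: "reindex_ob C E B \<alpha> x = Point P p s" "Point P p s \<in> Ob (Pt C E)" by metis
    show "reindex_ob C E B \<alpha> x \<in> Ob (Pt C E)" using r by simp
    have i: "Ident (Pt C B) x \<in> Hom (Pt C B) x x" using category_ident[OF Pt_category[OF C B] x] .
    have x': "ptot x \<in> Ob C" "pproj x \<in> Hom C (ptot x) B" using x by (auto simp: Pt_simps)
    have pq: "P \<in> Ob C" "p \<in> Hom C P E" "q \<in> Hom C P (ptot x)" using X(2) unfolding is_pullback_def by auto
    note c = reindex_ar_char[OF C E B \<alpha> x x i X X]
    have "?r x x (Ident (Pt C B) x) = Ident C P"
    proof (rule pullback_arrow_eqI[OF X(2) C E x'(1) B \<alpha> x'(2) pq(1) c(1) category_ident[OF C pq(1)]])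
    qed (use c(2,3) pq x' in \<open>simp_all add: category_ident_right[OF C pq(1) E] category_ident_right[OF C pq(1) x'(1)]
          Pt_simps category_ident_left[OF C]\<close>)
    then show "?r x x (Ident (Pt C B) x) = Ident (Pt C E) (reindex_ob C E B \<alpha> x)"
      using r by (simp add: Pt_simps)
  next
    fix x y f assume x: "x \<in> Ob (Pt C B)" and y: "y \<in> Ob (Pt C B)" and f: "f \<in> Hom (Pt C B) x y"
    from reindex_ob_pullback[OF C E B \<alpha> x ex[OF x]] obtain P p q s where
      X: "point_pullback C E B \<alpha> x = (P, p, q)" "is_pullback C E (ptot x) B \<alpha> (pproj x) (P, p, q)"
      and r: "reindex_ob C E B \<alpha> x = Point P p s" and s: "s \<in> Hom C E P" "Comp C E P E p s = Ident C E"
      "Comp C E P (ptot x) q s = Comp C E B (ptot x) (psect x) \<alpha>" by metis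
    from reindex_ob_pullback[OF C E B \<alpha> y ex[OF y]] obtain P' p' q' s' where
      Y: "point_pullback C E B \<alpha> y = (P', p', q')" "is_pullback C E (ptot y) B \<alpha> (pproj y) (P', p', q')"
      and r': "reindex_ob C E B \<alpha> y = Point P' p' s'" and s': "s' \<in> Hom C E P'" "Comp C E P' E p' s' = Ident C E"
      "Comp C E P' (ptot y) q' s' = Comp C E B (ptot y) (psect y) \<alpha>" by metis
    note c = reindex_ar_char[OF C E B \<alpha> x y f X Y]
    have x': "ptot x \<in> Ob C" "pproj x \<in> Hom C (ptot x) B" "psect x \<in> Hom C B (ptot x)" using x by (auto simp: Pt_simps)
    have y': "ptot y \<in> Ob C" "pproj y \<in> Hom C (ptot y) B" using y by (auto simp: Pt_simps)
    have f': "f \<in> Hom C (ptot x) (ptot y)" "Comp C B (ptot x) (ptot y) f (psect x) = psect y" using f by (auto simp: Pt_simps)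
    have pq: "P \<in> Ob C" "p \<in> Hom C P E" "q \<in> Hom C P (ptot x)" using X(2) unfolding is_pullback_def by auto
    have pq': "P' \<in> Ob C" "p' \<in> Hom C P' E" "q' \<in> Hom C P' (ptot y)" using Y(2) unfolding is_pullback_def by auto
    have "Comp C E P P' (?r x y f) s = s'"
    proof (rule pullback_arrow_eqI[OF Y(2) C E y'(1) B \<alpha> y'(2) E _ s'(1)])
      show "Comp C E P P' (?r x y f) s \<in> Hom C E P'" using category_comp[OF C E pq(1) pq'(1) s(1) c(1)] .
      show "Comp C E P' E p' (Comp C E P P' (?r x y f) s) = Comp C E P' E p' s'"
        using category_assoc[OF C E pq(1) pq'(1) E s(1) c(1) pq'(2)] c(2) s(2) s'(2) by simp
      show "Comp C E P' (ptot y) q' (Comp C E P P' (?r x y f) s) = Comp C E P' (ptot y) q' s'"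
        using category_assoc[OF C E pq(1) pq'(1) y'(1) s(1) c(1) pq'(3)] c(3)
          category_assoc[OF C E pq(1) x'(1) y'(1) s(1) pq(3) f'(1)] s(3) s'(3)
          category_assoc[OF C E B x'(1) y'(1) \<alpha> x'(3) f'(1)] f'(2) by simp
    qed
    then show "?r x y f \<in> Hom (Pt C E) (reindex_ob C E B \<alpha> x) (reindex_ob C E B \<alpha> y)"
      using r r' c by (simp add: Pt_simps)
  next
    fix x y z f g assume x: "x \<in> Ob (Pt C B)" and y: "y \<in> Ob (Pt C B)" and z: "z \<in> Ob (Pt C B)"
      and f: "f \<in> Hom (Pt C B) x y" and g: "g \<in> Hom (Pt C B) y z"
    from reindex_ob_pullback[OF C E B \<alpha> x ex[OF x]] obtain P p q s where
      X: "point_pullback C E B \<alpha> x = (P, p, q)" "is_pullback C E (ptot x) B \<alpha> (pproj x) (P, p, q)"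
      and r: "reindex_ob C E B \<alpha> x = Point P p s" by metis
    from reindex_ob_pullback[OF C E B \<alpha> y ex[OF y]] obtain P' p' q' s' where
      Y: "point_pullback C E B \<alpha> y = (P', p', q')" "is_pullback C E (ptot y) B \<alpha> (pproj y) (P', p', q')"
      and r': "reindex_ob C E B \<alpha> y = Point P' p' s'" by metis
    from reindex_ob_pullback[OF C E B \<alpha> z ex[OF z]] obtain P'' p'' q'' s'' where
      Z: "point_pullback C E B \<alpha> z = (P'', p'', q'')" "is_pullback C E (ptot z) B \<alpha> (pproj z) (P'', p'', q'')"
      and r'': "reindex_ob C E B \<alpha> z = Point P'' p'' s''" by metis
    have gf: "Comp (Pt C B) x y z g f \<in> Hom (Pt C B) x z"
      using category_comp[OF Pt_category[OF C B] x y z f g] .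
    note c = reindex_ar_char[OF C E B \<alpha> x y f X Y] and d = reindex_ar_char[OF C E B \<alpha> y z g Y Z]
      and e = reindex_ar_char[OF C E B \<alpha> x z gf X Z]
    have x': "ptot x \<in> Ob C" using x by (auto simp: Pt_simps)
    have y': "ptot y \<in> Ob C" using y by (auto simp: Pt_simps)
    have z': "ptot z \<in> Ob C" "pproj z \<in> Hom C (ptot z) B" using z by (auto simp: Pt_simps)
    have f': "f \<in> Hom C (ptot x) (ptot y)" using f by (auto simp: Pt_simps)
    have g': "g \<in> Hom C (ptot y) (ptot z)" using g by (auto simp: Pt_simps)
    have pq: "P \<in> Ob C" "p \<in> Hom C P E" "q \<in> Hom C P (ptot x)" using X(2) unfolding is_pullback_def by auto
    have pq': "P' \<in> Ob C" "p' \<in> Hom C P' E" "q' \<in> Hom C P' (ptot y)" using Y(2) unfolding is_pullback_def by auto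
    have pq'': "P'' \<in> Ob C" "p'' \<in> Hom C P'' E" "q'' \<in> Hom C P'' (ptot z)" using Z(2) unfolding is_pullback_def by auto
    have "?r x z (Comp (Pt C B) x y z g f) = Comp C P P' P'' (?r y z g) (?r x y f)"
    proof (rule pullback_arrow_eqI[OF Z(2) C E z'(1) B \<alpha> z'(2) pq(1) e(1)])
      show "Comp C P P' P'' (?r y z g) (?r x y f) \<in> Hom C P P''"
        using category_comp[OF C pq(1) pq'(1) pq''(1) c(1) d(1)] .
      show "Comp C P P'' E p'' (?r x z (Comp (Pt C B) x y z g f)) =
          Comp C P P'' E p'' (Comp C P P' P'' (?r y z g) (?r x y f))"
        using category_assoc[OF C pq(1) pq'(1) pq''(1) E c(1) d(1) pq''(2)] c(2) d(2) e(2) by simp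
      show "Comp C P P'' (ptot z) q'' (?r x z (Comp (Pt C B) x y z g f)) =
          Comp C P P'' (ptot z) q'' (Comp C P P' P'' (?r y z g) (?r x y f))"
        using category_assoc[OF C pq(1) pq'(1) pq''(1) z'(1) c(1) d(1) pq''(3)] c(3) d(3) e(3)
          category_assoc[OF C pq(1) pq'(1) y' z'(1) c(1) pq'(3) g']
          category_assoc[OF C pq(1) x' y' z'(1) pq(3) f' g'] by (simp add: Pt_simps)
    qed
    then show "?r x z (Comp (Pt C B) x y z g f) =
      Comp (Pt C E) (reindex_ob C E B \<alpha> x) (reindex_ob C E B \<alpha> y) (reindex_ob C E B \<alpha> z) (?r y z g) (?r x y f)"
      using r r' r'' by (simp add: Pt_simps)
  qed
qed

section \<open>Products of spaces, elementwise\<close>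

lemma ex1_eqI: "\<exists>!x. P x \<Longrightarrow> P a \<Longrightarrow> P b \<Longrightarrow> a = b"
  by blast

lemma Ob_Top [simp]: "Ob (Top T) = T"
  by (simp add: Top_def)

lemma Hom_Top: "f \<in> Hom (Top T) X Y \<longleftrightarrow> f \<in> extensional (topspace X) \<and> continuous_map X Y f"
  by (simp add: Top_def)

lemma Ident_Top: "Ident (Top T) X = restrict id (topspace X)"
  by (simp add: Top_def)

lemma Comp_Top: "Comp (Top T) X Y Z g f = restrict (g \<circ> f) (topspace X)"
  by (simp add: Top_def)

lemma continuous_map_in: "continuous_map X Y f \<Longrightarrow> x \<in> topspace X \<Longrightarrow> f x \<in> topspace Y"
  by (auto simp: continuous_map_def)

lemma Hom_Top_in: "f \<in> Hom (Top T) X Y \<Longrightarrow> x \<in> topspace X \<Longrightarrow> f x \<in> topspace Y"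
  by (auto simp: Hom_Top continuous_map_def)

lemma restrict_Hom_Top: "continuous_map X Y f \<Longrightarrow> restrict f (topspace X) \<in> Hom (Top T) X Y"
  unfolding Hom_Top by (rule conjI, simp, erule continuous_map_eq) simp

lemma restrict_eq_iff: "restrict f A = restrict g A \<longleftrightarrow> (\<forall>x\<in>A. f x = g x)"
  by (metis restrict_apply' restrict_ext)

lemma Hom_Top_eqI:
  "f \<in> Hom (Top T) X Y \<Longrightarrow> g \<in> Hom (Top T) X Z \<Longrightarrow> (\<And>x. x \<in> topspace X \<Longrightarrow> f x = g x) \<Longrightarrow> f = g"
  unfolding Hom_Top by (metis extensionalityI)

lemma Top_category: "is_category (Top T)"
  unfolding is_category_def
proof (intro conjI ballI)
  fix a b c f g assume "f \<in> Hom (Top T) a b" "g \<in> Hom (Top T) b c"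
  then show "Comp (Top T) a b c g f \<in> Hom (Top T) a c"
    unfolding Comp_Top by (intro restrict_Hom_Top continuous_map_compose[of a b f c g]) (auto simp: Hom_Top)
next
  fix a b f assume f: "f \<in> Hom (Top T) a b"
  show "Comp (Top T) a a b f (Ident (Top T) a) = f"
    using f by (intro extensionalityI[of _ "topspace a"]) (auto simp: Comp_Top Hom_Top Ident_Top)
  show "Comp (Top T) a b b (Ident (Top T) b) f = f"
    using f by (intro extensionalityI[of _ "topspace a"]) (auto simp: Comp_Top Hom_Top Ident_Top continuous_map_def)
next
  fix a assume "a \<in> Ob (Top T)"
  show "Ident (Top T) a \<in> Hom (Top T) a a"
    unfolding Ident_Top by (rule restrict_Hom_Top) simp
qed (auto simp: Comp_Top Hom_Top continuous_map_in restrict_eq_iff)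

lemma continuous_map_singleton:
  assumes "topspace X = {x}" and "y \<in> topspace Y"
  shows "continuous_map X Y (\<lambda>_. y)"
  using assms by simp

text \<open>A one-point space in the class makes the points of a space the same as the arrows from that
  space, so that the underlying set functor preserves whatever limits exist. Equations between arrows
  built from the chosen products can then be checked on elements, writing \<open>pr A B a b\<close> for the point of
  the chosen product with given coordinates.\<close>

locale space_class =
  fixes T :: "'u topology set"
  assumes one_point: "\<exists>X\<in>T. \<exists>x. topspace X = {x}"
    and products: "has_finite_products (Top T)"
begin

definition pr :: "'u topology \<Rightarrow> 'u topology \<Rightarrow> 'u \<Rightarrow> 'u \<Rightarrow> 'u" where
  "pr A B a b = (THE w. w \<in> topspace (prodO (Top T) A B) \<and> proj1 (Top T) A B w = a \<and> proj2 (Top T) A B w = b)"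

abbreviation pO where "pO \<equiv> prodO (Top T)"
abbreviation p1 where "p1 \<equiv> proj1 (Top T)"
abbreviation p2 where "p2 \<equiv> proj2 (Top T)"

lemma prod_is_product:
  assumes "A \<in> T" "B \<in> T"
  shows "is_product (Top T) A B (pO A B, p1 A B, p2 A B)"
proof -
  have "\<exists>t. is_product (Top T) A B t" using products assms by (auto simp: has_finite_products_def)
  from someI_ex[OF this] show ?thesis by (simp add: prodO_def proj1_def proj2_def prod_cone_def)
qed

lemma pO_in: "A \<in> T \<Longrightarrow> B \<in> T \<Longrightarrow> pO A B \<in> T"
  and p1_Hom: "A \<in> T \<Longrightarrow> B \<in> T \<Longrightarrow> p1 A B \<in> Hom (Top T) (pO A B) A"
  and p2_Hom: "A \<in> T \<Longrightarrow> B \<in> T \<Longrightarrow> p2 A B \<in> Hom (Top T) (pO A B) B"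
  using prod_is_product[of A B] by (auto simp: is_product_def)

lemma p1_continuous: "A \<in> T \<Longrightarrow> B \<in> T \<Longrightarrow> continuous_map (pO A B) A (p1 A B)"
  and p2_continuous: "A \<in> T \<Longrightarrow> B \<in> T \<Longrightarrow> continuous_map (pO A B) B (p2 A B)"
  using p1_Hom[of A B] p2_Hom[of A B] by (auto simp: Hom_Top)

lemma p1_in: "A \<in> T \<Longrightarrow> B \<in> T \<Longrightarrow> w \<in> topspace (pO A B) \<Longrightarrow> p1 A B w \<in> topspace A"
  and p2_in: "A \<in> T \<Longrightarrow> B \<in> T \<Longrightarrow> w \<in> topspace (pO A B) \<Longrightarrow> p2 A B w \<in> topspace B"
  using p1_continuous[of A B] p2_continuous[of A B] by (auto simp: continuous_map_def)

lemma product_universal: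
  assumes "A \<in> T" "B \<in> T" "X \<in> T" "continuous_map X A f" "continuous_map X B g"
  shows "\<exists>!h. h \<in> Hom (Top T) X (pO A B) \<and>
     (\<forall>x\<in>topspace X. p1 A B (h x) = f x \<and> p2 A B (h x) = g x)"
proof -
  have "\<exists>!h. h \<in> Hom (Top T) X (pO A B) \<and>
     Comp (Top T) X (pO A B) A (p1 A B) h = restrict f (topspace X) \<and>
     Comp (Top T) X (pO A B) B (p2 A B) h = restrict g (topspace X)"
    using prod_is_product[OF assms(1,2)] assms(3) restrict_Hom_Top[OF assms(4)] restrict_Hom_Top[OF assms(5)]
    unfolding is_product_def by simp
  then show ?thesis unfolding Comp_Top restrict_eq_iff by (auto simp: ball_conj_distrib)
qed

lemma product_point:
  assumes A: "A \<in> T" and B: "B \<in> T" and a: "a \<in> topspace A" and b: "b \<in> topspace B"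
  shows "\<exists>!w. w \<in> topspace (pO A B) \<and> p1 A B w = a \<and> p2 A B w = b"
proof -
  obtain X x where X: "X \<in> T" "topspace X = {x}" using one_point by blast
  have ex1: "\<exists>!h. h \<in> Hom (Top T) X (pO A B) \<and> (p1 A B (h x) = a \<and> p2 A B (h x) = b)"
    using product_universal[OF A B X(1) continuous_map_singleton[OF X(2) a] continuous_map_singleton[OF X(2) b]]
    by (simp add: X(2))
  then obtain h where h: "h \<in> Hom (Top T) X (pO A B)" "p1 A B (h x) = a" "p2 A B (h x) = b"
    by (elim ex1E conjE)
  have u: "k = h" if "k \<in> Hom (Top T) X (pO A B)" "p1 A B (k x) = a" "p2 A B (k x) = b" for k
    by (rule ex1_eqI[OF ex1]) (simp_all add: h that)
  show ?thesis
  proof (intro ex1I conjI)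
    show "h x \<in> topspace (pO A B)" using Hom_Top_in[OF h(1)] X by simp
    show "p1 A B (h x) = a" "p2 A B (h x) = b" by (fact h)+
    fix w assume w: "w \<in> topspace (pO A B) \<and> p1 A B w = a \<and> p2 A B w = b"
    have "restrict (\<lambda>_. w) (topspace X) = h"
    proof (rule u)
      show "restrict (\<lambda>_. w) (topspace X) \<in> Hom (Top T) X (pO A B)"
        using w by (intro restrict_Hom_Top continuous_map_singleton[OF X(2)]) simp
    qed (use w X(2) in simp_all)
    from fun_cong[OF this, of x] show "w = h x" using X(2) by simp
  qed
qed

lemma pr:
  assumes "A \<in> T" "B \<in> T" "a \<in> topspace A" "b \<in> topspace B"
  shows pr_in: "pr A B a b \<in> topspace (pO A B)" and p1_pr: "p1 A B (pr A B a b) = a" and p2_pr: "p2 A B (pr A B a b) = b"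
  using theI'[OF product_point[OF assms]] unfolding pr_def by auto

lemma pr_eqI:
  assumes "A \<in> T" "B \<in> T" "w \<in> topspace (pO A B)" "p1 A B w = a" "p2 A B w = b"
  shows "pr A B a b = w"
proof (rule ex1_eqI[OF product_point[OF assms(1,2) p1_in[OF assms(1-3)] p2_in[OF assms(1-3)]]])
qed (use pr[OF assms(1,2) p1_in[OF assms(1-3)] p2_in[OF assms(1-3)]] assms in simp_all)

lemma pr_surj: "A \<in> T \<Longrightarrow> B \<in> T \<Longrightarrow> w \<in> topspace (pO A B) \<Longrightarrow> pr A B (p1 A B w) (p2 A B w) = w"
  by (rule pr_eqI) auto

lemma pO_eqI:
  "A \<in> T \<Longrightarrow> B \<in> T \<Longrightarrow> w \<in> topspace (pO A B) \<Longrightarrow> w' \<in> topspace (pO A B) \<Longrightarrow>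
    p1 A B w = p1 A B w' \<Longrightarrow> p2 A B w = p2 A B w' \<Longrightarrow> w = w'"
  by (metis pr_surj)

lemma pr_continuous:
  assumes "A \<in> T" "B \<in> T" "X \<in> T" "continuous_map X A f" "continuous_map X B g"
  shows "continuous_map X (pO A B) (\<lambda>x. pr A B (f x) (g x))"
proof -
  obtain h where h: "h \<in> Hom (Top T) X (pO A B)"
     "\<forall>x\<in>topspace X. p1 A B (h x) = f x \<and> p2 A B (h x) = g x"
    using product_universal[OF assms] by (elim ex1E conjE)
  have "h x = pr A B (f x) (g x)" if "x \<in> topspace X" for x
    using pr_eqI[OF assms(1,2) Hom_Top_in[OF h(1) that]] h(2) that by simp
  moreover have "continuous_map X (pO A B) h" using h(1) by (simp add: Hom_Top)
  ultimately show ?thesis by (rule continuous_map_eq[rotated])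
qed

lemma pairing_eq:
  assumes "A \<in> T" "B \<in> T" "X \<in> T" "f \<in> Hom (Top T) X A" "g \<in> Hom (Top T) X B"
  shows "pairing (Top T) X A B f g = restrict (\<lambda>x. pr A B (f x) (g x)) (topspace X)" (is "_ = ?h")
  unfolding pairing_def
proof (rule the_equality)
  have fg: "continuous_map X A f" "continuous_map X B g" using assms by (auto simp: Hom_Top)
  have h: "?h \<in> Hom (Top T) X (pO A B)"
    using restrict_Hom_Top[OF pr_continuous[OF assms(1-3) fg]] .
  show "?h \<in> Hom (Top T) X (pO A B) \<and>
    Comp (Top T) X (pO A B) A (p1 A B) ?h = f \<and> Comp (Top T) X (pO A B) B (p2 A B) ?h = g"
    using h assms fg
    by (auto intro!: extensionalityI[of _ "topspace X"] simp: Comp_Top Hom_Top p1_pr p2_pr continuous_map_in)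
  fix k assume k: "k \<in> Hom (Top T) X (pO A B) \<and>
    Comp (Top T) X (pO A B) A (p1 A B) k = f \<and> Comp (Top T) X (pO A B) B (p2 A B) k = g"
  show "k = ?h"
  proof (rule Hom_Top_eqI[OF _ h])
    fix x assume x: "x \<in> topspace X"
    have "p1 A B (k x) = f x" "p2 A B (k x) = g x" using k x unfolding Comp_Top by auto
    then show "k x = ?h x" using pr_eqI[OF assms(1,2) Hom_Top_in[of k T X]] k x by auto
  qed (use k in auto)
qed

lemma prod_map_eq:
  assumes "A \<in> T" "A' \<in> T" "B \<in> T" "B' \<in> T" "f \<in> Hom (Top T) A A'" "g \<in> Hom (Top T) B B'"
  shows "prod_map (Top T) A A' B B' f g =
    restrict (\<lambda>w. pr A' B' (f (p1 A B w)) (g (p2 A B w))) (topspace (pO A B))"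
proof -
  have "Comp (Top T) (pO A B) A A' f (p1 A B) \<in> Hom (Top T) (pO A B) A'"
    "Comp (Top T) (pO A B) B B' g (p2 A B) \<in> Hom (Top T) (pO A B) B'"
    using assms by (auto intro!: category_comp[OF Top_category] pO_in p1_Hom p2_Hom)
  then show ?thesis
    unfolding prod_map_def using pairing_eq[OF assms(2,4) pO_in[OF assms(1,3)]]
    by (simp add: Comp_Top cong: restrict_cong)
qed

definition pt :: 'u where "pt = (SOME x. x \<in> topspace (termO (Top T)))"

lemma termO: shows termO_in: "termO (Top T) \<in> T" and termO_topspace: "topspace (termO (Top T)) = {pt}"
proof -
  have "\<exists>Z. is_terminal (Top T) Z" using products by (simp add: has_finite_products_def)
  from someI_ex[OF this] have t: "is_terminal (Top T) (termO (Top T))" unfolding termO_def .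
  then show in_T: "termO (Top T) \<in> T" by (simp add: is_terminal_def)
  obtain X x where X: "X \<in> T" "topspace X = {x}" using one_point by blast
  have ex1: "\<exists>!h. h \<in> Hom (Top T) X (termO (Top T))" using t X(1) by (simp add: is_terminal_def)
  then obtain h where h: "h \<in> Hom (Top T) X (termO (Top T))" by (elim ex1E)
  have u: "k = h" if "k \<in> Hom (Top T) X (termO (Top T))" for k
    by (rule ex1_eqI[OF ex1]) (simp_all add: h that)
  have "y = h x" if "y \<in> topspace (termO (Top T))" for y
  proof -
    have "restrict (\<lambda>_. y) (topspace X) = h"
      using that by (intro u restrict_Hom_Top continuous_map_singleton[OF X(2)])
    from fun_cong[OF this, of x] show "y = h x" using X(2) by simp
  qed
  moreover have "h x \<in> topspace (termO (Top T))" using Hom_Top_in[OF h] X by simp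
  ultimately have *: "topspace (termO (Top T)) = {h x}" by blast
  then have "pt = h x" unfolding pt_def by (simp add: *)
  then show "topspace (termO (Top T)) = {pt}" using * by simp
qed

lemma to_term_eq:
  assumes "X \<in> T"
  shows "to_term (Top T) X = restrict (\<lambda>_. pt) (topspace X)"
  unfolding to_term_def
proof (rule the_equality)
  show r: "restrict (\<lambda>_. pt) (topspace X) \<in> Hom (Top T) X (termO (Top T))"
    by (rule restrict_Hom_Top) (simp add: termO_topspace)
  fix h assume h: "h \<in> Hom (Top T) X (termO (Top T))"
  show "h = restrict (\<lambda>_. pt) (topspace X)"
    using Hom_Top_in[OF h] by (intro Hom_Top_eqI[OF h r]) (simp add: termO_topspace)
qed

section \<open>Group objects, elementwise\<close>

definition gmult :: "('u topology, 'u \<Rightarrow> 'u) grp_obj \<Rightarrow> 'u \<Rightarrow> 'u \<Rightarrow> 'u" where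
  "gmult G a b = gmul G (pr (gob G) (gob G) a b)"

definition grp :: "('u topology, 'u \<Rightarrow> 'u) grp_obj \<Rightarrow> 'u monoid" where
  "grp G = \<lparr>carrier = topspace (gob G), mult = gmult G, one = gone G pt\<rparr>"

lemma grp_simps [simp]:
  "carrier (grp G) = topspace (gob G)" "mult (grp G) = gmult G" "one (grp G) = gone G pt"
  by (simp_all add: grp_def)

text \<open>The group laws are equations between arrows out of \<open>(G \<times> G) \<times> G\<close> and \<open>G\<close>; evaluated at points they become the laws of
  an abstract group, for which the algebra library can be used. The inverse arrow is pinned down by one of its two
  laws.\<close>

lemma is_group_object_iff:
  "is_group_object (Top T) G \<longleftrightarrow>
     gob G \<in> T \<and> gmul G \<in> Hom (Top T) (pO (gob G) (gob G)) (gob G) \<and>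
     gone G \<in> Hom (Top T) (termO (Top T)) (gob G) \<and> ginv G \<in> Hom (Top T) (gob G) (gob G) \<and>
     group (grp G) \<and> (\<forall>a\<in>topspace (gob G). gmult G (ginv G a) a = gone G pt)"
    (is "?l = ?r")
proof -
  let ?X = "gob G" let ?P = "pO ?X ?X" let ?Q = "pO ?P ?X"
  let ?x = "Comp (Top T) ?Q ?P ?X (p1 ?X ?X) (p1 ?P ?X)"
  let ?y = "Comp (Top T) ?Q ?P ?X (p2 ?X ?X) (p1 ?P ?X)"
  let ?z = "p2 ?P ?X"
  let ?e = "Comp (Top T) ?X (termO (Top T)) ?X (gone G) (to_term (Top T) ?X)"
  let ?mult = "\<lambda>Y a b. Comp (Top T) Y ?P ?X (gmul G) (pairing (Top T) Y ?X ?X a b)"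
  let ?base = "?X \<in> T \<and> gmul G \<in> Hom (Top T) ?P ?X \<and>
     gone G \<in> Hom (Top T) (termO (Top T)) ?X \<and> ginv G \<in> Hom (Top T) ?X ?X"
  have l: "?l \<longleftrightarrow> ?base \<and>
         ?mult ?Q (?mult ?Q ?x ?y) ?z = ?mult ?Q ?x (?mult ?Q ?y ?z) \<and>
         ?mult ?X ?e (Ident (Top T) ?X) = Ident (Top T) ?X \<and> ?mult ?X (Ident (Top T) ?X) ?e = Ident (Top T) ?X \<and>
         ?mult ?X (ginv G) (Ident (Top T) ?X) = ?e \<and> ?mult ?X (Ident (Top T) ?X) (ginv G) = ?e"
    unfolding is_group_object_def Let_def by auto
  show ?thesis
  proof (cases ?base)
    case True
    then have X: "?X \<in> T" and m: "gmul G \<in> Hom (Top T) ?P ?X"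
      and e: "gone G \<in> Hom (Top T) (termO (Top T)) ?X" and i: "ginv G \<in> Hom (Top T) ?X ?X" by auto
    note P = pO_in[OF X X] note Q = pO_in[OF P X]
    have mult: "?mult Y a b = restrict (\<lambda>w. gmult G (a w) (b w)) (topspace Y)" "?mult Y a b \<in> Hom (Top T) Y ?X"
      if "Y \<in> T" "a \<in> Hom (Top T) Y ?X" "b \<in> Hom (Top T) Y ?X" for Y a b
    proof -
      have pp: "pairing (Top T) Y ?X ?X a b = restrict (\<lambda>w. pr ?X ?X (a w) (b w)) (topspace Y)"
        using pairing_eq[OF X X that] .
      have c: "continuous_map Y ?P (\<lambda>w. pr ?X ?X (a w) (b w))"
        using pr_continuous[OF X X that(1)] that(2,3) by (simp add: Hom_Top)
      show "?mult Y a b \<in> Hom (Top T) Y ?X"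
        unfolding pp using that by (intro category_comp[OF Top_category _ _ _ restrict_Hom_Top[OF c] m]) (auto simp: X P)
      show "?mult Y a b = restrict (\<lambda>w. gmult G (a w) (b w)) (topspace Y)"
        unfolding pp by (auto simp: gmult_def Comp_Top)
    qed
    have cx: "?x \<in> Hom (Top T) ?Q ?X" "?y \<in> Hom (Top T) ?Q ?X" "?z \<in> Hom (Top T) ?Q ?X"
      using X P Q by (auto intro!: category_comp[OF Top_category] p1_Hom p2_Hom)
    have ce: "?e \<in> Hom (Top T) ?X ?X"
      using X e termO_in restrict_Hom_Top[of ?X "termO (Top T)" "\<lambda>_. pt" T]
      by (intro category_comp[OF Top_category]) (auto simp: to_term_eq termO_topspace)
    have ci: "Ident (Top T) ?X \<in> Hom (Top T) ?X ?X" using X category_ident[OF Top_category] by auto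
    have ev: "?e = restrict (\<lambda>_. gone G pt) (topspace ?X)" using X by (auto simp: Comp_Top to_term_eq)
    have closed: "gmult G a b \<in> topspace ?X" if "a \<in> topspace ?X" "b \<in> topspace ?X" for a b
      using Hom_Top_in[OF m pr_in[OF X X that]] unfolding gmult_def .
    have one: "gone G pt \<in> topspace ?X" using Hom_Top_in[OF e] by (simp add: termO_topspace)
    have inv: "ginv G a \<in> topspace ?X" if "a \<in> topspace ?X" for a using Hom_Top_in[OF i that] .
    have assoc: "?mult ?Q (?mult ?Q ?x ?y) ?z = ?mult ?Q ?x (?mult ?Q ?y ?z) \<longleftrightarrow>
      (\<forall>a\<in>topspace ?X. \<forall>b\<in>topspace ?X. \<forall>c\<in>topspace ?X. gmult G (gmult G a b) c = gmult G a (gmult G b c))"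
      (is "?L \<longleftrightarrow> ?R")
    proof -
      have "?L \<longleftrightarrow> (\<forall>w\<in>topspace ?Q. gmult G (gmult G (?x w) (?y w)) (?z w) = gmult G (?x w) (gmult G (?y w) (?z w)))"
        using mult(1)[OF Q mult(2)[OF Q cx(1,2)] cx(3)] mult(1)[OF Q cx(1,2)]
          mult(1)[OF Q cx(1) mult(2)[OF Q cx(2,3)]] mult(1)[OF Q cx(2,3)]
        by (simp add: restrict_eq_iff)
      also have "\<dots> \<longleftrightarrow> ?R"
      proof safe
        fix a b c assume H: "\<forall>w\<in>topspace ?Q. gmult G (gmult G (?x w) (?y w)) (?z w) = gmult G (?x w) (gmult G (?y w) (?z w))"
          and abc: "a \<in> topspace ?X" "b \<in> topspace ?X" "c \<in> topspace ?X"
        show "gmult G (gmult G a b) c = gmult G a (gmult G b c)"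
          using bspec[OF H pr_in[OF P X pr_in[OF X X abc(1,2)] abc(3)]] abc
          by (simp add: Comp_Top pr_in p1_pr p2_pr P X)
      next
        fix w assume R: ?R and w: "w \<in> topspace ?Q"
        show "gmult G (gmult G (?x w) (?y w)) (?z w) = gmult G (?x w) (gmult G (?y w) (?z w))"
          using R Hom_Top_in[OF cx(1) w] Hom_Top_in[OF cx(2) w] Hom_Top_in[OF cx(3) w] by blast
      qed
      finally show ?thesis .
    qed
    have u1: "?mult ?X ?e (Ident (Top T) ?X) = Ident (Top T) ?X \<longleftrightarrow> (\<forall>a\<in>topspace ?X. gmult G (gone G pt) a = a)"
      using mult(1)[OF X ce ci] ev by (auto simp: Ident_Top restrict_eq_iff)
    have u2: "?mult ?X (Ident (Top T) ?X) ?e = Ident (Top T) ?X \<longleftrightarrow> (\<forall>a\<in>topspace ?X. gmult G a (gone G pt) = a)"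
      using mult(1)[OF X ci ce] ev by (auto simp: Ident_Top restrict_eq_iff)
    have i1: "?mult ?X (ginv G) (Ident (Top T) ?X) = ?e \<longleftrightarrow> (\<forall>a\<in>topspace ?X. gmult G (ginv G a) a = gone G pt)"
      using mult(1)[OF X i ci] ev by (auto simp: Ident_Top restrict_eq_iff)
    have i2: "?mult ?X (Ident (Top T) ?X) (ginv G) = ?e \<longleftrightarrow> (\<forall>a\<in>topspace ?X. gmult G a (ginv G a) = gone G pt)"
      using mult(1)[OF X ci i] ev by (auto simp: Ident_Top restrict_eq_iff)
    let ?laws = "(\<forall>a\<in>topspace ?X. \<forall>b\<in>topspace ?X. \<forall>c\<in>topspace ?X. gmult G (gmult G a b) c = gmult G a (gmult G b c)) \<and>
      (\<forall>a\<in>topspace ?X. gmult G (gone G pt) a = a) \<and> (\<forall>a\<in>topspace ?X. gmult G a (gone G pt) = a) \<and>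
      (\<forall>a\<in>topspace ?X. gmult G (ginv G a) a = gone G pt) \<and> (\<forall>a\<in>topspace ?X. gmult G a (ginv G a) = gone G pt)"
    have "?laws \<longleftrightarrow> group (grp G) \<and> (\<forall>a\<in>topspace ?X. gmult G (ginv G a) a = gone G pt)"
    proof
      assume laws: ?laws
      have "group (grp G)"
      proof (rule groupI)
        fix x assume "x \<in> carrier (grp G)"
        then show "\<exists>y\<in>carrier (grp G). y \<otimes>\<^bsub>grp G\<^esub> x = \<one>\<^bsub>grp G\<^esub>"
          using laws inv by (intro bexI[of _ "ginv G x"]) auto
      qed (use laws closed one in auto)
      then show "group (grp G) \<and> (\<forall>a\<in>topspace ?X. gmult G (ginv G a) a = gone G pt)" using laws by blast
    next
      assume H: "group (grp G) \<and> (\<forall>a\<in>topspace ?X. gmult G (ginv G a) a = gone G pt)"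
      then interpret group "grp G" by simp
      show ?laws
        using m_assoc l_one r_one inv_comm[of "ginv G _"] inv H by simp
    qed
    then show ?thesis unfolding l assoc u1 u2 i1 i2 using True by simp
  next
    case False
    then show ?thesis unfolding l by auto
  qed
qed

lemma group_object:
  assumes "is_group_object (Top T) G"
  shows group_object_in: "gob G \<in> T" and group_object_group: "group (grp G)"
    and mult_continuous: "continuous_map (pO (gob G) (gob G)) (gob G) (gmul G)"
    and inv_continuous: "continuous_map (gob G) (gob G) (\<lambda>a. inv\<^bsub>grp G\<^esub> a)"
proof -
  show "gob G \<in> T" and g: "group (grp G)" "continuous_map (pO (gob G) (gob G)) (gob G) (gmul G)"
    using assms unfolding is_group_object_iff Hom_Top by auto
  interpret group "grp G" by (fact g)
  have i: "ginv G \<in> Hom (Top T) (gob G) (gob G)" using assms unfolding is_group_object_iff by auto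
  have "ginv G a = inv\<^bsub>grp G\<^esub> a" if "a \<in> topspace (gob G)" for a
    using assms that inv_equality[of "ginv G a" a] Hom_Top_in[OF i that] unfolding is_group_object_iff by simp
  moreover have "continuous_map (gob G) (gob G) (ginv G)" using i by (simp add: Hom_Top)
  ultimately show "continuous_map (gob G) (gob G) (\<lambda>a. inv\<^bsub>grp G\<^esub> a)" by (rule continuous_map_eq[rotated])
qed

lemma continuous_mult:
  assumes G: "is_group_object (Top T) G" and "X \<in> T" "continuous_map X (gob G) f" "continuous_map X (gob G) g"
  shows "continuous_map X (gob G) (\<lambda>x. f x \<otimes>\<^bsub>grp G\<^esub> g x)"
  using continuous_map_compose[OF pr_continuous[OF group_object_in[OF G] group_object_in[OF G] assms(2-4)] mult_continuous[OF G]]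
  by (simp add: gmult_def comp_def)

lemma continuous_inv:
  assumes G: "is_group_object (Top T) G" and "continuous_map X (gob G) f"
  shows "continuous_map X (gob G) (\<lambda>x. inv\<^bsub>grp G\<^esub> f x)"
  using continuous_map_compose[OF assms(2) inv_continuous[OF G]] by (simp add: comp_def)

text \<open>The structure arrows are restricted to their domains because arrows are extensional functions.\<close>

definition group_object_of :: "'u topology \<Rightarrow> 'u monoid \<Rightarrow> ('u topology, 'u \<Rightarrow> 'u) grp_obj" where
  "group_object_of X M = GrpObj X (restrict (\<lambda>w. p1 X X w \<otimes>\<^bsub>M\<^esub> p2 X X w) (topspace (pO X X)))
     (restrict (\<lambda>_. \<one>\<^bsub>M\<^esub>) (topspace (termO (Top T)))) (restrict (\<lambda>a. inv\<^bsub>M\<^esub> a) (topspace X))"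

lemma group_object_of:
  assumes X: "X \<in> T" and M: "group M" and car: "carrier M = topspace X"
    and m: "continuous_map (pO X X) X (\<lambda>w. p1 X X w \<otimes>\<^bsub>M\<^esub> p2 X X w)"
    and i: "continuous_map X X (\<lambda>a. inv\<^bsub>M\<^esub> a)"
  shows "is_group_object (Top T) (group_object_of X M)"
    and "gob (group_object_of X M) = X"
    and "\<And>a b. a \<in> topspace X \<Longrightarrow> b \<in> topspace X \<Longrightarrow> a \<otimes>\<^bsub>grp (group_object_of X M)\<^esub> b = a \<otimes>\<^bsub>M\<^esub> b"
    and "\<one>\<^bsub>grp (group_object_of X M)\<^esub> = \<one>\<^bsub>M\<^esub>"
proof -
  let ?G = "group_object_of X M"
  show ob: "gob ?G = X" by (simp add: group_object_of_def)
  have mult: "a \<otimes>\<^bsub>grp ?G\<^esub> b = a \<otimes>\<^bsub>M\<^esub> b" if "a \<in> topspace X" "b \<in> topspace X" for a b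
    using that X by (simp add: group_object_of_def gmult_def pr_in p1_pr p2_pr)
  show one: "\<one>\<^bsub>grp ?G\<^esub> = \<one>\<^bsub>M\<^esub>" by (simp add: group_object_of_def termO_topspace)
  interpret M: group M by (fact M)
  note mult' = mult[simplified] and one' = one[simplified]
  have "group (grp ?G)"
  proof (rule groupI)
    fix x assume "x \<in> carrier (grp ?G)"
    then show "\<exists>y\<in>carrier (grp ?G). y \<otimes>\<^bsub>grp ?G\<^esub> x = \<one>\<^bsub>grp ?G\<^esub>"
      using car ob M.inv_closed M.l_inv by (intro bexI[of _ "inv\<^bsub>M\<^esub> x"]) (auto simp: mult' one')
  qed (use ob car M.m_closed M.m_assoc M.one_closed in \<open>auto simp: mult' one'\<close>)
  moreover have "gmult ?G (ginv ?G a) a = gone ?G pt" if "a \<in> topspace X" for a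
    using mult'[OF _ that, of "inv\<^bsub>M\<^esub> a"] that car M.inv_closed[of a] one by (simp add: group_object_of_def)
  moreover have "continuous_map (termO (Top T)) X (\<lambda>_. \<one>\<^bsub>M\<^esub>)"
    using continuous_map_singleton[OF termO_topspace] M.one_closed car by simp
  ultimately show "is_group_object (Top T) ?G"
    unfolding is_group_object_iff ob using X m i by (auto simp: group_object_of_def restrict_Hom_Top)
  show "a \<otimes>\<^bsub>grp ?G\<^esub> b = a \<otimes>\<^bsub>M\<^esub> b" if "a \<in> topspace X" "b \<in> topspace X" for a b
    by (rule mult[OF that])
qed

lemma Ob_Grp: "G \<in> Ob (Grp (Top T)) \<longleftrightarrow> is_group_object (Top T) G"
  by (simp add: Grp_def)

lemma Ident_Grp: "Ident (Grp (Top T)) G = restrict id (topspace (gob G))"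
  by (simp add: Grp_def Ident_Top)

lemma Comp_Grp: "Comp (Grp (Top T)) G H K g f = restrict (g \<circ> f) (topspace (gob G))"
  by (simp add: Grp_def Comp_Top)

lemma Hom_Grp:
  assumes G: "is_group_object (Top T) G" and H: "is_group_object (Top T) H"
  shows "f \<in> Hom (Grp (Top T)) G H \<longleftrightarrow> f \<in> Hom (Top T) (gob G) (gob H) \<and> f \<in> hom (grp G) (grp H)"
proof -
  note X = group_object_in[OF G] and Y = group_object_in[OF H]
  have "(Comp (Top T) (pO (gob G) (gob G)) (gob G) (gob H) f (gmul G) =
        Comp (Top T) (pO (gob G) (gob G)) (pO (gob H) (gob H)) (gob H) (gmul H)
          (prod_map (Top T) (gob G) (gob H) (gob G) (gob H) f f)) \<longleftrightarrow> f \<in> hom (grp G) (grp H)" (is "?l \<longleftrightarrow> _")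
    if f: "f \<in> Hom (Top T) (gob G) (gob H)"
  proof -
    have "?l \<longleftrightarrow> (\<forall>w\<in>topspace (pO (gob G) (gob G)). f (gmul G w) = gmult H (f (p1 (gob G) (gob G) w)) (f (p2 (gob G) (gob G) w)))"
      by (simp add: prod_map_eq[OF X Y X Y f f] Comp_Top restrict_eq_iff gmult_def)
    also have "\<dots> \<longleftrightarrow> (\<forall>a\<in>topspace (gob G). \<forall>b\<in>topspace (gob G). f (gmult G a b) = gmult H (f a) (f b))"
    proof safe
      fix a b assume *: "\<forall>w\<in>topspace (pO (gob G) (gob G)). f (gmul G w) = gmult H (f (p1 (gob G) (gob G) w)) (f (p2 (gob G) (gob G) w))"
         and ab: "a \<in> topspace (gob G)" "b \<in> topspace (gob G)"
      from bspec[OF * pr_in[OF X X ab]] show "f (gmult G a b) = gmult H (f a) (f b)"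
        using ab X by (simp add: p1_pr p2_pr gmult_def)
    next
      fix w assume *: "\<forall>a\<in>topspace (gob G). \<forall>b\<in>topspace (gob G). f (gmult G a b) = gmult H (f a) (f b)"
         and w: "w \<in> topspace (pO (gob G) (gob G))"
      show "f (gmul G w) = gmult H (f (p1 (gob G) (gob G) w)) (f (p2 (gob G) (gob G) w))"
        using *[rule_format, OF p1_in[OF X X w] p2_in[OF X X w]] by (simp add: gmult_def pr_surj X w)
    qed
    also have "\<dots> \<longleftrightarrow> f \<in> hom (grp G) (grp H)"
      using Hom_Top_in[OF f] by (auto simp: hom_def)
    finally show ?thesis .
  qed
  then show ?thesis by (auto simp: Grp_def)
qed

lemma Grp_category: "is_category (Grp (Top T))"
  unfolding is_category_def
proof (intro conjI ballI, goal_cases)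
  case (1 G)
  then show ?case using category_ident[OF Top_category, of "gob G" T] group_object_group[of G]
    by (auto simp: Ob_Grp Hom_Grp Ident_Grp Ident_Top group_object_in hom_def group.is_monoid monoid.m_closed
        dest: monoid.m_closed[OF group.is_monoid])
next
  case (2 G H K f g)
  then have o: "is_group_object (Top T) G" "is_group_object (Top T) H" "is_group_object (Top T) K" by (auto simp: Ob_Grp)
  then have f: "f \<in> Hom (Top T) (gob G) (gob H)" "f \<in> hom (grp G) (grp H)" and g: "g \<in> Hom (Top T) (gob H) (gob K)" "g \<in> hom (grp H) (grp K)"
    using 2 by (auto simp: Hom_Grp)
  interpret G: group "grp G" by (rule group_object_group[OF o(1)])
  have "Comp (Top T) (gob G) (gob H) (gob K) g f \<in> Hom (Top T) (gob G) (gob K)"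
    using o by (intro category_comp[OF Top_category _ _ _ f(1) g(1)]) (auto simp: group_object_in)
  then show ?case using f(2) g(2) G.m_closed by (auto simp: Hom_Grp o Comp_Grp Comp_Top hom_def Pi_iff)
next
  case (3 G H f)
  then show ?case by (auto simp: Ob_Grp Hom_Grp Comp_Grp Ident_Grp Hom_Top intro!: extensionalityI[of _ "topspace (gob G)"])
next
  case (4 G H f)
  then show ?case by (auto simp: Ob_Grp Hom_Grp Comp_Grp Ident_Grp Hom_Top continuous_map_in intro!: extensionalityI[of _ "topspace (gob G)"])
next
  case (5 G H K L f g h)
  then show ?case by (auto simp: Ob_Grp Hom_Grp Comp_Grp Hom_Top continuous_map_in restrict_eq_iff)
qed

declare grp_simps(2,3) [simp del]

end

section \<open>Pullbacks of group objects\<close>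

lemma continuous_map_comp:
  "continuous_map X Y f \<Longrightarrow> continuous_map Y Z g \<Longrightarrow> continuous_map X Z (\<lambda>x. g (f x))"
  using continuous_map_compose[of X Y f Z g] by (simp add: comp_def)

lemma (in group) inv_cancel:
  assumes "x \<in> carrier G" "y \<in> carrier G"
  shows "inv x \<otimes> (x \<otimes> y) = y" "x \<otimes> (inv x \<otimes> y) = y"
  using assms by (simp_all add: m_assoc[symmetric])

text \<open>The part of the notion of a convenient category on which coinduction rests, with exponentials
  expressed through the values \<open>ap z a\<close> of their elements. In this form it can be checked directly for a given class of spaces.\<close>

locale convenient_class = space_class T for T :: "'u topology set" +
  assumes subspaces: "X \<in> T \<Longrightarrow> S \<subseteq> topspace X \<Longrightarrow>
      \<exists>Y\<in>T. topspace Y = S \<and> continuous_map Y X id \<and>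
        (\<forall>Z\<in>T. \<forall>f. continuous_map Z X f \<and> f ` topspace Z \<subseteq> S \<longrightarrow> continuous_map Z Y f)"
    and exponentials: "A \<in> T \<Longrightarrow> D \<in> T \<Longrightarrow>
      \<exists>Z\<in>T. \<exists>ap. continuous_map (pO Z A) D (\<lambda>w. ap (p1 Z A w) (p2 Z A w)) \<and>
        (\<forall>z\<in>topspace Z. \<forall>z'\<in>topspace Z. (\<forall>a\<in>topspace A. ap z a = ap z' a) \<longrightarrow> z = z') \<and>
        (\<forall>X\<in>T. \<forall>f. continuous_map (pO X A) D (\<lambda>w. f (p1 X A w) (p2 X A w)) \<longrightarrow>
           (\<exists>g. continuous_map X Z g \<and> (\<forall>x\<in>topspace X. \<forall>a\<in>topspace A. ap (g x) a = f x a)))"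
begin

lemma Grp_Hom:
  assumes "is_group_object (Top T) G" "is_group_object (Top T) H" "f \<in> Hom (Grp (Top T)) G H"
  shows Grp_Hom_Top: "f \<in> Hom (Top T) (gob G) (gob H)"
    and Grp_Hom_continuous: "continuous_map (gob G) (gob H) f"
    and Grp_Hom_in: "x \<in> topspace (gob G) \<Longrightarrow> f x \<in> topspace (gob H)"
    and Grp_Hom_mult: "x \<in> topspace (gob G) \<Longrightarrow> x' \<in> topspace (gob G) \<Longrightarrow>
      f (x \<otimes>\<^bsub>grp G\<^esub> x') = f x \<otimes>\<^bsub>grp H\<^esub> f x'"
    and Grp_Hom_one: "f \<one>\<^bsub>grp G\<^esub> = \<one>\<^bsub>grp H\<^esub>"
    and Grp_Hom_inv: "x \<in> topspace (gob G) \<Longrightarrow> f (inv\<^bsub>grp G\<^esub> x) = inv\<^bsub>grp H\<^esub> f x"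
proof -
  have h: "f \<in> hom (grp G) (grp H)"
    using assms(3) unfolding Hom_Grp[OF assms(1,2)] by auto
  show a: "f \<in> Hom (Top T) (gob G) (gob H)"
    using assms(3) unfolding Hom_Grp[OF assms(1,2)] by auto
  then show "continuous_map (gob G) (gob H) f" by (simp add: Hom_Top)
  show "x \<in> topspace (gob G) \<Longrightarrow> f x \<in> topspace (gob H)" using Hom_Top_in[OF a] .
  interpret group_hom "grp G" "grp H" f
    using h group_object_group assms by (auto simp: group_hom_def group_hom_axioms_def)
  show "x \<in> topspace (gob G) \<Longrightarrow> x' \<in> topspace (gob G) \<Longrightarrow>
      f (x \<otimes>\<^bsub>grp G\<^esub> x') = f x \<otimes>\<^bsub>grp H\<^esub> f x'" using hom_mult by simp
  show "f \<one>\<^bsub>grp G\<^esub> = \<one>\<^bsub>grp H\<^esub>" by (rule hom_one)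
  show "x \<in> topspace (gob G) \<Longrightarrow> f (inv\<^bsub>grp G\<^esub> x) = inv\<^bsub>grp H\<^esub> f x" using hom_inv by simp
qed

lemma restrict_Hom_Grp:
  assumes "is_group_object (Top T) G" "is_group_object (Top T) H"
    and "continuous_map (gob G) (gob H) f"
    and "\<And>x x'. x \<in> topspace (gob G) \<Longrightarrow> x' \<in> topspace (gob G) \<Longrightarrow>
      f (x \<otimes>\<^bsub>grp G\<^esub> x') = f x \<otimes>\<^bsub>grp H\<^esub> f x'"
  shows "restrict f (topspace (gob G)) \<in> Hom (Grp (Top T)) G H"
proof -
  interpret group "grp G" using group_object_group[OF assms(1)] .
  show ?thesis
    unfolding Hom_Grp[OF assms(1,2)]
    using restrict_Hom_Top[OF assms(3), of T] assms(4) continuous_map_in[OF assms(3)] m_closed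
    by (simp add: hom_def Pi_iff)
qed

text \<open>The pullback is the subgroup of the product cut out by the equation, with the topology that
  the class provides for subsets.\<close>

lemma group_pullback_construction:
  assumes E: "is_group_object (Top T) E" and A: "is_group_object (Top T) A" and B: "is_group_object (Top T) B"
    and \<alpha>: "\<alpha> \<in> Hom (Grp (Top T)) E B" and \<pi>: "\<pi> \<in> Hom (Grp (Top T)) A B"
  defines "S \<equiv> {w \<in> topspace (pO (gob E) (gob A)). \<alpha> (p1 (gob E) (gob A) w) = \<pi> (p2 (gob E) (gob A) w)}"
  obtains P where "topspace (gob P) = S"
    "is_pullback (Grp (Top T)) E A B \<alpha> \<pi> (P, restrict (p1 (gob E) (gob A)) S, restrict (p2 (gob E) (gob A)) S)"
    "\<forall>Z\<in>T. \<forall>f. continuous_map Z (pO (gob E) (gob A)) f \<longrightarrow> f ` topspace Z \<subseteq> S \<longrightarrow> continuous_map Z (gob P) f"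
proof -
  let ?E = "gob E" and ?A = "gob A" let ?P = "pO ?E ?A"
  let ?p = "p1 ?E ?A" and ?q = "p2 ?E ?A" and ?pr = "pr ?E ?A"
  note TE = group_object_in[OF E] and TA = group_object_in[OF A]
  note TP = pO_in[OF TE TA]
  interpret E: group "grp E" by (rule group_object_group[OF E])
  interpret A: group "grp A" by (rule group_object_group[OF A])
  interpret B: group "grp B" by (rule group_object_group[OF B])
  note Ec = E.m_closed[simplified] E.one_closed[simplified] E.inv_closed[simplified]
  note Ac = A.m_closed[simplified] A.one_closed[simplified] A.inv_closed[simplified]
  note pq = p1_in[OF TE TA] p2_in[OF TE TA] pr_in[OF TE TA] p1_pr[OF TE TA] p2_pr[OF TE TA]
  note \<alpha>h = Grp_Hom_mult[OF E B \<alpha>] Grp_Hom_one[OF E B \<alpha>] Grp_Hom_inv[OF E B \<alpha>]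
  note \<pi>h = Grp_Hom_mult[OF A B \<pi>] Grp_Hom_one[OF A B \<pi>] Grp_Hom_inv[OF A B \<pi>]
  have "S \<subseteq> topspace ?P" by (auto simp: S_def)
  from subspaces[OF TP this] obtain Y where Y: "Y \<in> T" "topspace Y = S" "continuous_map Y ?P id"
     and Yin: "\<And>Z f. Z \<in> T \<Longrightarrow> continuous_map Z ?P f \<Longrightarrow> f ` topspace Z \<subseteq> S \<Longrightarrow> continuous_map Z Y f" by blast
  have cp: "continuous_map Y ?E ?p" and cq: "continuous_map Y ?A ?q"
    using continuous_map_comp[OF Y(3) p1_continuous[OF TE TA]] continuous_map_comp[OF Y(3) p2_continuous[OF TE TA]] by auto
  define M where "M = \<lparr>carrier = S, mult = (\<lambda>v w. ?pr (?p v \<otimes>\<^bsub>grp E\<^esub> ?p w) (?q v \<otimes>\<^bsub>grp A\<^esub> ?q w)),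
     one = ?pr \<one>\<^bsub>grp E\<^esub> \<one>\<^bsub>grp A\<^esub>\<rparr>"
  have Sin: "w \<in> topspace ?P" "?p w \<in> topspace ?E" "?q w \<in> topspace ?A" "\<alpha> (?p w) = \<pi> (?q w)" if "w \<in> S" for w
    using that pq unfolding S_def by auto
  have inv_S: "?pr (inv\<^bsub>grp E\<^esub> ?p w) (inv\<^bsub>grp A\<^esub> ?q w) \<in> S" if "w \<in> S" for w
    using Sin[OF that] Ec Ac pq unfolding S_def by (simp add: \<alpha>h \<pi>h)
  have mult_S: "?pr (?p v \<otimes>\<^bsub>grp E\<^esub> ?p w) (?q v \<otimes>\<^bsub>grp A\<^esub> ?q w) \<in> S" if "v \<in> S" "w \<in> S" for v w
    using Sin[OF that(1)] Sin[OF that(2)] Ec Ac pq unfolding S_def by (simp add: \<alpha>h \<pi>h)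
  have one_S: "?pr \<one>\<^bsub>grp E\<^esub> \<one>\<^bsub>grp A\<^esub> \<in> S"
    using Ec Ac pq unfolding S_def by (simp add: \<alpha>h \<pi>h)
  have linv: "?pr (inv\<^bsub>grp E\<^esub> ?p w) (inv\<^bsub>grp A\<^esub> ?q w) \<otimes>\<^bsub>M\<^esub> w = \<one>\<^bsub>M\<^esub>" if "w \<in> S" for w
    using Sin[OF that] Ec Ac by (simp add: M_def pq)
  have M: "group M"
  proof (rule groupI)
    fix x y z assume "x \<in> carrier M" "y \<in> carrier M" "z \<in> carrier M"
    then show "x \<otimes>\<^bsub>M\<^esub> y \<otimes>\<^bsub>M\<^esub> z = x \<otimes>\<^bsub>M\<^esub> (y \<otimes>\<^bsub>M\<^esub> z)"
      using Sin[of x] Sin[of y] Sin[of z] Ec Ac E.m_assoc A.m_assoc by (simp add: M_def pq)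
  next
    fix x assume "x \<in> carrier M"
    then have x: "x \<in> S" by (simp add: M_def)
    then show "\<one>\<^bsub>M\<^esub> \<otimes>\<^bsub>M\<^esub> x = x"
      using Sin[of x] Ec Ac by (simp add: M_def pq pr_surj[OF TE TA])
    show "\<exists>y\<in>carrier M. y \<otimes>\<^bsub>M\<^esub> x = \<one>\<^bsub>M\<^esub>"
      using linv[OF x] inv_S[OF x] by (intro bexI) (auto simp: M_def)
  qed (use mult_S one_S in \<open>auto simp: M_def\<close>)
  interpret M: group M by (fact M)
  have car: "carrier M = topspace Y" by (simp add: M_def Y)
  have inv_M: "inv\<^bsub>M\<^esub> w = ?pr (inv\<^bsub>grp E\<^esub> ?p w) (inv\<^bsub>grp A\<^esub> ?q w)" if "w \<in> S" for w
    using that linv inv_S by (intro M.inv_equality) (auto simp: M_def)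
  note c1 = p1_continuous[OF Y(1,1)] and c2 = p2_continuous[OF Y(1,1)]
  have cm: "continuous_map (pO Y Y) Y (\<lambda>w. p1 Y Y w \<otimes>\<^bsub>M\<^esub> p2 Y Y w)"
  proof (rule Yin[OF pO_in[OF Y(1,1)]])
    show "continuous_map (pO Y Y) ?P (\<lambda>w. p1 Y Y w \<otimes>\<^bsub>M\<^esub> p2 Y Y w)"
      unfolding M_def
      by (simp, intro pr_continuous[OF TE TA pO_in[OF Y(1,1)]] continuous_mult[OF E pO_in[OF Y(1,1)]]
          continuous_mult[OF A pO_in[OF Y(1,1)]] continuous_map_comp[OF c1 cp] continuous_map_comp[OF c2 cp]
          continuous_map_comp[OF c1 cq] continuous_map_comp[OF c2 cq])
    show "(\<lambda>w. p1 Y Y w \<otimes>\<^bsub>M\<^esub> p2 Y Y w) ` topspace (pO Y Y) \<subseteq> S"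
      using M.m_closed p1_in[OF Y(1,1)] p2_in[OF Y(1,1)] unfolding car Y(2) by blast
  qed
  have ci: "continuous_map Y Y (\<lambda>w. inv\<^bsub>M\<^esub> w)"
  proof (rule continuous_map_eq)
    show "continuous_map Y Y (\<lambda>w. ?pr (inv\<^bsub>grp E\<^esub> ?p w) (inv\<^bsub>grp A\<^esub> ?q w))"
      using inv_S by (intro Yin[OF Y(1)] pr_continuous[OF TE TA Y(1)] continuous_inv[OF E cp] continuous_inv[OF A cq])
        (auto simp: Y(2))
  qed (simp add: inv_M Y(2))
  let ?G = "group_object_of Y M"
  note G = group_object_of[OF Y(1) M car cm ci]
  let ?p' = "restrict ?p S" and ?q' = "restrict ?q S"
  have Gm: "?p (v \<otimes>\<^bsub>grp ?G\<^esub> w) = ?p v \<otimes>\<^bsub>grp E\<^esub> ?p w" "?q (v \<otimes>\<^bsub>grp ?G\<^esub> w) = ?q v \<otimes>\<^bsub>grp A\<^esub> ?q w"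
    if "v \<in> S" "w \<in> S" for v w
    using G(3)[of v w] that Y(2) Sin[OF that(1)] Sin[OF that(2)] Ec Ac by (simp_all add: M_def pq)
  have p': "?p' \<in> Hom (Grp (Top T)) ?G E" and q': "?q' \<in> Hom (Grp (Top T)) ?G A"
    using restrict_Hom_Grp[OF G(1) E, of ?p] restrict_Hom_Grp[OF G(1) A, of ?q] cp cq Gm
    by (simp_all add: G(2) Y(2))
  have "is_pullback (Grp (Top T)) E A B \<alpha> \<pi> (?G, ?p', ?q')"
    unfolding is_pullback_def prod.case
  proof (intro conjI ballI impI)
    show "?G \<in> Ob (Grp (Top T))" using G(1) by (simp add: Ob_Grp)
    show "Comp (Grp (Top T)) ?G E B \<alpha> ?p' = Comp (Grp (Top T)) ?G A B \<pi> ?q'"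
      by (simp add: Comp_Grp G(2) Y(2) restrict_eq_iff S_def)
    fix X f g assume X: "X \<in> Ob (Grp (Top T))" and f: "f \<in> Hom (Grp (Top T)) X E" and g: "g \<in> Hom (Grp (Top T)) X A"
      and eq: "Comp (Grp (Top T)) X E B \<alpha> f = Comp (Grp (Top T)) X A B \<pi> g"
    have X': "is_group_object (Top T) X" using X by (simp add: Ob_Grp)
    have eq': "\<alpha> (f x) = \<pi> (g x)" if "x \<in> topspace (gob X)" for x
      using eq that by (simp add: Comp_Grp restrict_eq_iff)
    note fin = Grp_Hom_in[OF X' E f] and gin = Grp_Hom_in[OF X' A g]
    let ?h = "\<lambda>x. ?pr (f x) (g x)"
    interpret X: group "grp X" by (rule group_object_group[OF X'])
    have hS: "?h x \<in> S" if "x \<in> topspace (gob X)" for x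
      using fin[OF that] gin[OF that] eq'[OF that] by (simp add: S_def pq)
    have ch: "continuous_map (gob X) Y ?h"
      using hS by (intro Yin[OF group_object_in[OF X']] pr_continuous[OF TE TA group_object_in[OF X']]
          Grp_Hom_continuous[OF X' E f] Grp_Hom_continuous[OF X' A g]) auto
    have h: "restrict ?h (topspace (gob X)) \<in> Hom (Grp (Top T)) X ?G"
    proof (rule restrict_Hom_Grp[OF X' G(1)])
      fix x x' assume x: "x \<in> topspace (gob X)" "x' \<in> topspace (gob X)"
      show "?h (x \<otimes>\<^bsub>grp X\<^esub> x') = ?h x \<otimes>\<^bsub>grp ?G\<^esub> ?h x'"
        using G(3)[of "?h x" "?h x'"] Y(2) hS[OF x(1)] hS[OF x(2)] x fin gin
        by (simp add: Grp_Hom_mult[OF X' E f] Grp_Hom_mult[OF X' A g] M_def pq)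
    qed (use ch G(2) in simp)
    show "\<exists>!h. h \<in> Hom (Grp (Top T)) X ?G \<and> Comp (Grp (Top T)) X ?G E ?p' h = f \<and> Comp (Grp (Top T)) X ?G A ?q' h = g"
    proof (rule ex1I[of _ "restrict ?h (topspace (gob X))"], intro conjI)
      show "Comp (Grp (Top T)) X ?G E ?p' (restrict ?h (topspace (gob X))) = f"
        using Grp_Hom_Top[OF X' E f] hS fin gin
        by (intro extensionalityI[of _ "topspace (gob X)"]) (auto simp: Comp_Grp Hom_Top pq)
      show "Comp (Grp (Top T)) X ?G A ?q' (restrict ?h (topspace (gob X))) = g"
        using Grp_Hom_Top[OF X' A g] hS fin gin
        by (intro extensionalityI[of _ "topspace (gob X)"]) (auto simp: Comp_Grp Hom_Top pq)
      fix k assume k: "k \<in> Hom (Grp (Top T)) X ?G \<and> Comp (Grp (Top T)) X ?G E ?p' k = f \<and> Comp (Grp (Top T)) X ?G A ?q' k = g"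
      have k': "k \<in> Hom (Grp (Top T)) X ?G" using k by simp
      show "k = restrict ?h (topspace (gob X))"
      proof (rule Hom_Top_eqI[OF Grp_Hom_Top[OF X' G(1) k'] Grp_Hom_Top[OF X' G(1) h]])
        fix x assume x: "x \<in> topspace (gob X)"
        have kS: "k x \<in> S" using Grp_Hom_in[OF X' G(1) k' x] G(2) Y(2) by simp
        have "f x = ?p (k x)" "g x = ?q (k x)"
          using k kS x by (auto simp: Comp_Grp)
        then show "k x = restrict ?h (topspace (gob X)) x"
          using pr_surj[OF TE TA] Sin(1)[OF kS] x by simp
      qed
    qed (use h in simp)
  qed (use p' q' in auto)
  then show thesis using that[of ?G] Yin G(2) Y(2) by simp
qed

lemma group_pullback_exists:
  assumes "E \<in> Ob (Grp (Top T))" "B \<in> Ob (Grp (Top T))" "\<alpha> \<in> Hom (Grp (Top T)) E B" "x \<in> Ob (Pt (Grp (Top T)) B)"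
  shows "\<exists>t. is_pullback (Grp (Top T)) E (ptot x) B \<alpha> (pproj x) t"
proof (rule group_pullback_construction[of E "ptot x" B \<alpha> "pproj x"])
qed (use assms in \<open>auto simp: Pt_simps Ob_Grp\<close>)

text \<open>Any pullback of group objects is isomorphic to the constructed one, hence has the expected
  elements, and continuous maps into it are pairs of continuous maps.\<close>

lemma group_pullback_elements:
  assumes E: "is_group_object (Top T) E" and A: "is_group_object (Top T) A" and B: "is_group_object (Top T) B"
    and \<alpha>: "\<alpha> \<in> Hom (Grp (Top T)) E B" and \<pi>: "\<pi> \<in> Hom (Grp (Top T)) A B"
    and pb: "is_pullback (Grp (Top T)) E A B \<alpha> \<pi> (P, p, q)"
  obtains v where
    "\<forall>w\<in>topspace (gob P). v (p w) (q w) = w"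
    "\<forall>e\<in>topspace (gob E). \<forall>a\<in>topspace (gob A). \<alpha> e = \<pi> a \<longrightarrow>
       v e a \<in> topspace (gob P) \<and> p (v e a) = e \<and> q (v e a) = a"
    "\<forall>Z\<in>T. \<forall>f g. continuous_map Z (gob E) f \<longrightarrow> continuous_map Z (gob A) g \<longrightarrow>
       (\<forall>z\<in>topspace Z. \<alpha> (f z) = \<pi> (g z)) \<longrightarrow> continuous_map Z (gob P) (\<lambda>z. v (f z) (g z))"
proof -
  let ?E = "gob E" and ?A = "gob A" and ?C = "Grp (Top T)"
  let ?S = "{w \<in> topspace (pO ?E ?A). \<alpha> (p1 ?E ?A w) = \<pi> (p2 ?E ?A w)}"
  note TE = group_object_in[OF E] and TA = group_object_in[OF A]
  obtain Q where Q: "topspace (gob Q) = ?S"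
    "is_pullback ?C E A B \<alpha> \<pi> (Q, restrict (p1 ?E ?A) ?S, restrict (p2 ?E ?A) ?S)"
    "\<forall>Z\<in>T. \<forall>f. continuous_map Z (pO ?E ?A) f \<longrightarrow> f ` topspace Z \<subseteq> ?S \<longrightarrow> continuous_map Z (gob Q) f"
    by (rule group_pullback_construction[OF E A B \<alpha> \<pi>]) (rule that)
  note pb' = pb[unfolded is_pullback_def prod.case] and Q' = Q(2)[unfolded is_pullback_def prod.case]
  have Pg: "is_group_object (Top T) P" and Qg: "is_group_object (Top T) Q" using pb' Q' by (auto simp: Ob_Grp)
  have p: "p \<in> Hom ?C P E" and q: "q \<in> Hom ?C P A" using pb' by auto
  have "\<exists>!k. k \<in> Hom ?C Q P \<and> Comp ?C Q P E p k = restrict (p1 ?E ?A) ?S \<and> Comp ?C Q P A q k = restrict (p2 ?E ?A) ?S"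
    using pb' Q' by simp
  then obtain k where k: "k \<in> Hom ?C Q P" "Comp ?C Q P E p k = restrict (p1 ?E ?A) ?S" "Comp ?C Q P A q k = restrict (p2 ?E ?A) ?S"
    by (elim ex1E conjE)
  have "\<exists>!u. u \<in> Hom ?C P Q \<and> Comp ?C P Q E (restrict (p1 ?E ?A) ?S) u = p \<and> Comp ?C P Q A (restrict (p2 ?E ?A) ?S) u = q"
    using pb' Q' by simp
  then obtain u where u: "u \<in> Hom ?C P Q" "Comp ?C P Q E (restrict (p1 ?E ?A) ?S) u = p" "Comp ?C P Q A (restrict (p2 ?E ?A) ?S) u = q"
    by (elim ex1E conjE)
  have uS: "u w \<in> ?S" if "w \<in> topspace (gob P)" for w using Grp_Hom_in[OF Pg Qg u(1) that] Q(1) by simp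
  have up: "p1 ?E ?A (u w) = p w" "p2 ?E ?A (u w) = q w" if "w \<in> topspace (gob P)" for w
    using fun_cong[OF u(2), of w] fun_cong[OF u(3), of w] that uS[OF that] by (auto simp: Comp_Grp)
  have kp: "p (k w) = p1 ?E ?A w" "q (k w) = p2 ?E ?A w" if "w \<in> ?S" for w
    using fun_cong[OF k(2), of w] fun_cong[OF k(3), of w] that Q(1) by (auto simp: Comp_Grp)
  have ku: "Comp ?C P Q P k u = Ident ?C P"
  proof (rule pullback_arrow_eqI[OF pb Grp_category])
    show "Comp ?C P Q P k u \<in> Hom ?C P P" "Ident ?C P \<in> Hom ?C P P"
      using category_comp[OF Grp_category _ _ _ u(1) k(1)] category_ident[OF Grp_category] Pg Qg by (auto simp: Ob_Grp)
    show "Comp ?C P P E p (Comp ?C P Q P k u) = Comp ?C P P E p (Ident ?C P)"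
      "Comp ?C P P A q (Comp ?C P Q P k u) = Comp ?C P P A q (Ident ?C P)"
      unfolding Comp_Grp Ident_Grp restrict_eq_iff using uS up kp by simp_all
  qed (use E A B \<alpha> \<pi> Pg in \<open>auto simp: Ob_Grp\<close>)
  let ?v = "\<lambda>e a. k (pr ?E ?A e a)"
  have prS: "pr ?E ?A e a \<in> ?S" if "e \<in> topspace ?E" "a \<in> topspace ?A" "\<alpha> e = \<pi> a" for e a
    using that by (simp add: pr_in[OF TE TA] p1_pr[OF TE TA] p2_pr[OF TE TA])
  show thesis
  proof (rule that[of ?v], goal_cases)
    case 1
    have "?v (p w) (q w) = w" if w: "w \<in> topspace (gob P)" for w
    proof -
      have "?v (p w) (q w) = k (u w)"
        using uS[OF w] up[OF w] pr_surj[OF TE TA, of "u w"] by simp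
      also have "\<dots> = w" using fun_cong[OF ku, of w] w by (simp add: Comp_Grp Ident_Grp)
      finally show ?thesis .
    qed
    then show ?case by blast
  next
    case 2
    have "?v e a \<in> topspace (gob P) \<and> p (?v e a) = e \<and> q (?v e a) = a"
      if ea: "e \<in> topspace ?E" "a \<in> topspace ?A" "\<alpha> e = \<pi> a" for e a
      using kp[OF prS[OF ea]] Grp_Hom_in[OF Qg Pg k(1), of "pr ?E ?A e a"] prS[OF ea] Q(1) ea
      by (simp add: p1_pr[OF TE TA] p2_pr[OF TE TA])
    then show ?case by blast
  next
    case 3
    have "continuous_map Z (gob P) (\<lambda>z. ?v (f z) (g z))"
      if Z: "Z \<in> T" "continuous_map Z ?E f" "continuous_map Z ?A g" "\<forall>z\<in>topspace Z. \<alpha> (f z) = \<pi> (g z)" for Z f g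
    proof -
      have "continuous_map Z (gob Q) (\<lambda>z. pr ?E ?A (f z) (g z))"
        using prS continuous_map_in[OF Z(2)] continuous_map_in[OF Z(3)] Z(4)
        by (intro Q(3)[rule_format, OF Z(1)] pr_continuous[OF TE TA Z(1-3)]) auto
      from continuous_map_comp[OF this Grp_Hom_continuous[OF Qg Pg k(1)]] show ?thesis .
    qed
    then show ?case by blast
  qed
qed

end

section \<open>Exponentials, elementwise\<close>

text \<open>Two elements of an exponential with the same values are equal because the corresponding arrows from the
  one-point space have the same transpose.\<close>

lemma (in space_class) exponential_elements:
  assumes A: "A \<in> T" and D: "D \<in> T" and ex: "is_exponential (Top T) A D Z ev"
  shows "\<exists>ap. continuous_map (pO Z A) D (\<lambda>w. ap (p1 Z A w) (p2 Z A w)) \<and>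
        (\<forall>z\<in>topspace Z. \<forall>z'\<in>topspace Z. (\<forall>a\<in>topspace A. ap z a = ap z' a) \<longrightarrow> z = z') \<and>
        (\<forall>X\<in>T. \<forall>f. continuous_map (pO X A) D (\<lambda>w. f (p1 X A w) (p2 X A w)) \<longrightarrow>
           (\<exists>g. continuous_map X Z g \<and> (\<forall>x\<in>topspace X. \<forall>a\<in>topspace A. ap (g x) a = f x a)))"
proof -
  let ?ap = "\<lambda>z a. ev (pr Z A z a)"
  let ?tr = "\<lambda>X g. Comp (Top T) (pO X A) (pO Z A) D ev (prod_map (Top T) X Z A A g (Ident (Top T) A))"
  have Z: "Z \<in> T" and ev: "ev \<in> Hom (Top T) (pO Z A) D"
    and univ: "\<And>X f. X \<in> T \<Longrightarrow> f \<in> Hom (Top T) (pO X A) D \<Longrightarrow> \<exists>!g. g \<in> Hom (Top T) X Z \<and> ?tr X g = f"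
    using ex unfolding is_exponential_def by auto
  have tr: "?tr X g = restrict (\<lambda>w. ?ap (g (p1 X A w)) (p2 X A w)) (topspace (pO X A))"
    if "X \<in> T" "g \<in> Hom (Top T) X Z" for X g
    using prod_map_eq[OF that(1) Z A A that(2) category_ident[OF Top_category, of A]] A p2_in[OF that(1) A]
    by (simp add: Comp_Top Ident_Top restrict_eq_iff)
  have 1: "continuous_map (pO Z A) D (\<lambda>w. ?ap (p1 Z A w) (p2 Z A w))"
  proof (rule continuous_map_eq)
    show "continuous_map (pO Z A) D ev" using ev by (simp add: Hom_Top)
  qed (simp add: pr_surj[OF Z A])
  have 2: "z = z'" if z: "z \<in> topspace Z" "z' \<in> topspace Z" and eq: "\<forall>a\<in>topspace A. ?ap z a = ?ap z' a" for z z'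
  proof -
    obtain X x where X: "X \<in> T" "topspace X = {x}" using one_point by blast
    let ?c = "\<lambda>z. restrict (\<lambda>_. z) (topspace X)"
    have c: "?c y \<in> Hom (Top T) X Z" if "y \<in> topspace Z" for y
      using that by (intro restrict_Hom_Top continuous_map_singleton[OF X(2)])
    have "?tr X (?c z) = ?tr X (?c z')"
      unfolding tr[OF X(1) c[OF z(1)]] tr[OF X(1) c[OF z(2)]] restrict_eq_iff
      using eq p1_in[OF X(1) A] p2_in[OF X(1) A] by simp
    moreover have "?tr X (?c z') \<in> Hom (Top T) (pO X A) D"
      unfolding tr[OF X(1) c[OF z(2)]]
    proof (rule restrict_Hom_Top, rule continuous_map_comp[of _ "pO Z A" _ _ ev])
      show "continuous_map (pO X A) (pO Z A) (\<lambda>w. pr Z A (?c z' (p1 X A w)) (p2 X A w))"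
        using c[OF z(2)] unfolding Hom_Top
        by (intro pr_continuous[OF Z A pO_in[OF X(1) A]] continuous_map_comp[OF p1_continuous[OF X(1) A]]
            p2_continuous[OF X(1) A]) (rule conjunct2)
      show "continuous_map (pO Z A) D ev" using ev by (simp add: Hom_Top)
    qed
    ultimately have "?c z = ?c z'"
      using ex1_eqI[OF univ[OF X(1)], of "?tr X (?c z')" "?c z" "?c z'"] c z by simp
    from fun_cong[OF this, of x] show ?thesis using X(2) by simp
  qed
  have 3: "\<exists>g. continuous_map X Z g \<and> (\<forall>x\<in>topspace X. \<forall>a\<in>topspace A. ?ap (g x) a = f x a)"
    if X: "X \<in> T" and f: "continuous_map (pO X A) D (\<lambda>w. f (p1 X A w) (p2 X A w))" for X f
  proof -
    from univ[OF X restrict_Hom_Top[OF f]] obtain g where g: "g \<in> Hom (Top T) X Z"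
      "?tr X g = restrict (\<lambda>w. f (p1 X A w) (p2 X A w)) (topspace (pO X A))" by (elim ex1E conjE)
    have "?ap (g x) a = f x a" if "x \<in> topspace X" "a \<in> topspace A" for x a
      using g(2)[unfolded tr[OF X g(1)] restrict_eq_iff, rule_format, OF pr_in[OF X A that]]
      by (simp add: p1_pr[OF X A that] p2_pr[OF X A that])
    then show ?thesis using g(1) by (auto simp: Hom_Top)
  qed
  show ?thesis
    by (rule exI[of _ ?ap]) (use 1 2 3 in auto)
qed

lemma convenient_class_if_convenient:
  assumes "convenient T"
  shows "convenient_class T"
proof -
  have cc: "cartesian_closed (Top T)" using assms by (simp add: convenient_def)
  interpret space_class T
    using assms cc by unfold_locales (auto simp: convenient_def cartesian_closed_def)
  show ?thesis
  proof
    fix A D assume *: "A \<in> T" "D \<in> T"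
    then obtain Z ev where ex: "is_exponential (Top T) A D Z ev" using cc unfolding cartesian_closed_def Ob_Top by blast
    then have "Z \<in> T" by (simp add: is_exponential_def)
    then show "\<exists>Z\<in>T. \<exists>ap. continuous_map (pO Z A) D (\<lambda>w. ap (p1 Z A w) (p2 Z A w)) \<and>
        (\<forall>z\<in>topspace Z. \<forall>z'\<in>topspace Z. (\<forall>a\<in>topspace A. ap z a = ap z' a) \<longrightarrow> z = z') \<and>
        (\<forall>X\<in>T. \<forall>f. continuous_map (pO X A) D (\<lambda>w. f (p1 X A w) (p2 X A w)) \<longrightarrow>
           (\<exists>g. continuous_map X Z g \<and> (\<forall>x\<in>topspace X. \<forall>a\<in>topspace A. ap (g x) a = f x a)))"
      using exponential_elements[OF * ex] by (rule bexI[rotated])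
  next
    fix X S assume "X \<in> T" "S \<subseteq> topspace X"
    then show "\<exists>Y\<in>T. topspace Y = S \<and> continuous_map Y X id \<and>
        (\<forall>Z\<in>T. \<forall>f. continuous_map Z X f \<and> f ` topspace Z \<subseteq> S \<longrightarrow> continuous_map Z Y f)"
      using assms unfolding convenient_def by auto
  qed
qed

section \<open>Coinduced points\<close>

text \<open>The coinduced point, described by its elements rather than by its construction. An element \<open>w\<close> of \<open>R\<close>
  stands for a pair consisting of an equivariant map \<open>F w\<close> from \<open>B\<close> to the kernel of the projection of \<open>y\<close>, and of an element \<open>\<beta> w\<close> of \<open>B\<close>.
  The last three assumptions determine the topology: the coordinates are continuous, jointly in the
  argument of \<open>F w\<close>, and a continuous map into \<open>R\<close> can be prescribed by a map of two variables and a map to \<open>B\<close>.\<close>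

locale coinduced = convenient_class T for T :: "'u topology set" +
  fixes E B \<alpha> y R and F :: "'u \<Rightarrow> 'u \<Rightarrow> 'u" and \<beta> :: "'u \<Rightarrow> 'u"
  assumes E: "is_group_object (Top T) E" and B: "is_group_object (Top T) B"
    and \<alpha>: "\<alpha> \<in> Hom (Grp (Top T)) E B" and y: "y \<in> Ob (Pt (Grp (Top T)) E)"
    and R: "is_group_object (Top T) R"
    and F_in: "w \<in> topspace (gob R) \<Longrightarrow> c \<in> topspace (gob B) \<Longrightarrow> F w c \<in> topspace (gob (ptot y))"
    and F_kernel: "w \<in> topspace (gob R) \<Longrightarrow> c \<in> topspace (gob B) \<Longrightarrow> pproj y (F w c) = \<one>\<^bsub>grp E\<^esub>"
    and F_equivariant: "w \<in> topspace (gob R) \<Longrightarrow> c \<in> topspace (gob B) \<Longrightarrow> e \<in> topspace (gob E) \<Longrightarrow>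
      F w (\<alpha> e \<otimes>\<^bsub>grp B\<^esub> c) = psect y e \<otimes>\<^bsub>grp (ptot y)\<^esub> F w c \<otimes>\<^bsub>grp (ptot y)\<^esub> inv\<^bsub>grp (ptot y)\<^esub> psect y e"
    and coinduced_eqI: "w \<in> topspace (gob R) \<Longrightarrow> w' \<in> topspace (gob R) \<Longrightarrow> \<beta> w = \<beta> w' \<Longrightarrow>
      (\<And>c. c \<in> topspace (gob B) \<Longrightarrow> F w c = F w' c) \<Longrightarrow> w = w'"
    and F_mult: "w \<in> topspace (gob R) \<Longrightarrow> w' \<in> topspace (gob R) \<Longrightarrow> c \<in> topspace (gob B) \<Longrightarrow>
      F (w \<otimes>\<^bsub>grp R\<^esub> w') c = F w c \<otimes>\<^bsub>grp (ptot y)\<^esub> F w' (c \<otimes>\<^bsub>grp B\<^esub> \<beta> w)"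
    and \<beta>_mult: "w \<in> topspace (gob R) \<Longrightarrow> w' \<in> topspace (gob R) \<Longrightarrow> \<beta> (w \<otimes>\<^bsub>grp R\<^esub> w') = \<beta> w \<otimes>\<^bsub>grp B\<^esub> \<beta> w'"
    and \<beta>_continuous: "continuous_map (gob R) (gob B) \<beta>"
    and F_continuous: "X \<in> T \<Longrightarrow> continuous_map X (gob R) f \<Longrightarrow> continuous_map X (gob B) g \<Longrightarrow>
      continuous_map X (gob (ptot y)) (\<lambda>x. F (f x) (g x))"
    and coinduced_map: "X \<in> T \<Longrightarrow>
      continuous_map (pO X (gob B)) (gob (ptot y)) (\<lambda>w. G (p1 X (gob B) w) (p2 X (gob B) w)) \<Longrightarrow>
      continuous_map X (gob B) b \<Longrightarrow>
      (\<And>x c. x \<in> topspace X \<Longrightarrow> c \<in> topspace (gob B) \<Longrightarrow> pproj y (G x c) = \<one>\<^bsub>grp E\<^esub>) \<Longrightarrow>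
      (\<And>x c e. x \<in> topspace X \<Longrightarrow> c \<in> topspace (gob B) \<Longrightarrow> e \<in> topspace (gob E) \<Longrightarrow>
         G x (\<alpha> e \<otimes>\<^bsub>grp B\<^esub> c) = psect y e \<otimes>\<^bsub>grp (ptot y)\<^esub> G x c \<otimes>\<^bsub>grp (ptot y)\<^esub> inv\<^bsub>grp (ptot y)\<^esub> psect y e) \<Longrightarrow>
      \<exists>g. continuous_map X (gob R) g \<and>
        (\<forall>x\<in>topspace X. \<beta> (g x) = b x \<and> (\<forall>c\<in>topspace (gob B). F (g x) c = G x c))"

text \<open>\<open>R\<close> is the subspace of the product of the exponential with \<open>B\<close> that is cut out by the two conditions on
  \<open>F w\<close>. Its multiplication, inverse and unit are all continuous for the same reason: each is prescribed by a
  continuous function of two variables, to be shown equivariant with values in the kernel.\<close>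

lemma (in convenient_class) coinduced_exists:
  assumes E: "is_group_object (Top T) E" and B: "is_group_object (Top T) B"
    and \<alpha>: "\<alpha> \<in> Hom (Grp (Top T)) E B" and y: "y \<in> Ob (Pt (Grp (Top T)) E)"
  shows "\<exists>R F \<beta>. coinduced T E B \<alpha> y R F \<beta>"
proof -
  let ?A = "ptot y" and ?\<pi> = "pproj y" and ?\<sigma> = "psect y"
  have A: "is_group_object (Top T) ?A" and \<pi>: "?\<pi> \<in> Hom (Grp (Top T)) ?A E" and \<sigma>: "?\<sigma> \<in> Hom (Grp (Top T)) E ?A"
    using y by (auto simp: Pt_simps Ob_Grp)
  interpret E: group "grp E" by (rule group_object_group[OF E])
  interpret A: group "grp ?A" by (rule group_object_group[OF A])
  interpret B: group "grp B" by (rule group_object_group[OF B])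
  note TE = group_object_in[OF E] and TA = group_object_in[OF A] and TB = group_object_in[OF B]
  let ?tA = "topspace (gob ?A)" and ?tB = "topspace (gob B)" and ?tE = "topspace (gob E)"
  note Ac = A.m_closed[simplified] A.one_closed[simplified] A.inv_closed[simplified]
  note Bc = B.m_closed[simplified] B.one_closed[simplified] B.inv_closed[simplified]
  note Ec = E.m_closed[simplified] E.one_closed[simplified] E.inv_closed[simplified]
  note Aa = A.m_assoc[simplified] and Ba = B.m_assoc[simplified]
  note \<pi>h = Grp_Hom_mult[OF A E \<pi>] Grp_Hom_one[OF A E \<pi>] Grp_Hom_inv[OF A E \<pi>]
  note \<sigma>in = Grp_Hom_in[OF E A \<sigma>] and \<alpha>in = Grp_Hom_in[OF E B \<alpha>]
  let ?conj = "\<lambda>e a. ?\<sigma> e \<otimes>\<^bsub>grp ?A\<^esub> a \<otimes>\<^bsub>grp ?A\<^esub> inv\<^bsub>grp ?A\<^esub> ?\<sigma> e"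
  from exponentials[OF TB TA] obtain Z ap where Z: "Z \<in> T"
    and ap: "continuous_map (pO Z (gob B)) (gob ?A) (\<lambda>w. ap (p1 Z (gob B) w) (p2 Z (gob B) w))"
    and ap_eq: "\<forall>z\<in>topspace Z. \<forall>z'\<in>topspace Z. (\<forall>a\<in>?tB. ap z a = ap z' a) \<longrightarrow> z = z'"
    and curry: "\<forall>X\<in>T. \<forall>f. continuous_map (pO X (gob B)) (gob ?A) (\<lambda>w. f (p1 X (gob B) w) (p2 X (gob B) w)) \<longrightarrow>
           (\<exists>g. continuous_map X Z g \<and> (\<forall>x\<in>topspace X. \<forall>a\<in>?tB. ap (g x) a = f x a))" by blast
  let ?P = "pO Z (gob B)"
  note TP = pO_in[OF Z TB]
  define F where "F w c = ap (p1 Z (gob B) w) c" for w c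
  define \<beta> where "\<beta> = p2 Z (gob B)"
  define S where "S = {w \<in> topspace ?P. \<forall>c\<in>?tB. ?\<pi> (F w c) = \<one>\<^bsub>grp E\<^esub> \<and>
      (\<forall>e\<in>?tE. F w (\<alpha> e \<otimes>\<^bsub>grp B\<^esub> c) = ?conj e (F w c))}"
  have "S \<subseteq> topspace ?P" by (auto simp: S_def)
  from subspaces[OF TP this] obtain Y where Y: "Y \<in> T" "topspace Y = S" "continuous_map Y ?P id"
     and Yin: "\<And>Z' f. Z' \<in> T \<Longrightarrow> continuous_map Z' ?P f \<Longrightarrow> f ` topspace Z' \<subseteq> S \<Longrightarrow> continuous_map Z' Y f" by blast
  have SP: "w \<in> topspace ?P" if "w \<in> S" for w using that by (simp add: S_def)
  have apc: "continuous_map X (gob ?A) (\<lambda>x. ap (f x) (g x))"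
    if "X \<in> T" "continuous_map X Z f" "continuous_map X (gob B) g" for X f g
  proof (rule continuous_map_eq)
    show "continuous_map X (gob ?A) (\<lambda>x. ap (p1 Z (gob B) (pr Z (gob B) (f x) (g x))) (p2 Z (gob B) (pr Z (gob B) (f x) (g x))))"
      using continuous_map_comp[OF pr_continuous[OF Z TB that] ap] .
  qed (use continuous_map_in[OF that(2)] continuous_map_in[OF that(3)] in \<open>simp add: p1_pr[OF Z TB] p2_pr[OF Z TB]\<close>)
  have Fc: "continuous_map X (gob ?A) (\<lambda>x. F (f x) (g x))"
    if "X \<in> T" "continuous_map X Y f" "continuous_map X (gob B) g" for X f g
    unfolding F_def using continuous_map_comp[OF continuous_map_comp[OF that(2) Y(3)] p1_continuous[OF Z TB]]
    by (intro apc that) simp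
  have \<beta>c: "continuous_map Y (gob B) \<beta>"
    unfolding \<beta>_def using continuous_map_comp[OF Y(3) p2_continuous[OF Z TB]] by simp
  have \<beta>in: "\<beta> w \<in> ?tB" if "w \<in> S" for w using continuous_map_in[OF \<beta>c] that Y(2) by simp
  have Fin: "F w c \<in> ?tA" if "w \<in> S" "c \<in> ?tB" for w c
  proof -
    have "p1 Z (gob B) w \<in> topspace Z" using p1_in[OF Z TB SP[OF that(1)]] .
    from continuous_map_in[OF ap pr_in[OF Z TB this that(2)]] this that(2) show ?thesis
      by (simp add: F_def p1_pr[OF Z TB] p2_pr[OF Z TB])
  qed
  have S_ker: "?\<pi> (F w c) = \<one>\<^bsub>grp E\<^esub>" if "w \<in> S" "c \<in> ?tB" for w c using that by (simp add: S_def)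
  have S_equiv: "F w (\<alpha> e \<otimes>\<^bsub>grp B\<^esub> c) = ?conj e (F w c)" if "w \<in> S" "c \<in> ?tB" "e \<in> ?tE" for w c e
    using that by (simp add: S_def)
  have eqI: "w = w'" if "w \<in> S" "w' \<in> S" "\<beta> w = \<beta> w'" "\<And>c. c \<in> ?tB \<Longrightarrow> F w c = F w' c" for w w'
  proof (rule pO_eqI[OF Z TB SP[OF that(1)] SP[OF that(2)]])
    show "p1 Z (gob B) w = p1 Z (gob B) w'"
      using ap_eq p1_in[OF Z TB SP] that unfolding F_def by blast
  qed (use that(3) in \<open>simp add: \<beta>_def\<close>)
  have construct: "\<exists>g. continuous_map X Y g \<and> (\<forall>x\<in>topspace X. \<beta> (g x) = b x \<and> (\<forall>c\<in>?tB. F (g x) c = G x c))"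
    if X: "X \<in> T" and G: "continuous_map (pO X (gob B)) (gob ?A) (\<lambda>w. G (p1 X (gob B) w) (p2 X (gob B) w))"
      and b: "continuous_map X (gob B) b"
      and ker: "\<And>x c. x \<in> topspace X \<Longrightarrow> c \<in> ?tB \<Longrightarrow> ?\<pi> (G x c) = \<one>\<^bsub>grp E\<^esub>"
      and equiv: "\<And>x c e. x \<in> topspace X \<Longrightarrow> c \<in> ?tB \<Longrightarrow> e \<in> ?tE \<Longrightarrow> G x (\<alpha> e \<otimes>\<^bsub>grp B\<^esub> c) = ?conj e (G x c)"
    for X G b
  proof -
    from curry X G obtain g where g: "continuous_map X Z g" "\<And>x a. x \<in> topspace X \<Longrightarrow> a \<in> ?tB \<Longrightarrow> ap (g x) a = G x a" by blast
    let ?g = "\<lambda>x. pr Z (gob B) (g x) (b x)"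
    note gb = continuous_map_in[OF g(1)] continuous_map_in[OF b]
    have F: "F (?g x) c = G x c" if "x \<in> topspace X" "c \<in> ?tB" for x c
      using gb that g(2) by (simp add: F_def p1_pr[OF Z TB])
    have \<beta>: "\<beta> (?g x) = b x" if "x \<in> topspace X" for x using gb that by (simp add: \<beta>_def p2_pr[OF Z TB])
    have "?g x \<in> S" if "x \<in> topspace X" for x
      using that gb ker equiv Bc \<alpha>in by (simp add: S_def F pr_in[OF Z TB])
    then have "continuous_map X Y ?g" by (intro Yin X pr_continuous[OF Z TB X g(1) b]) auto
    then show ?thesis using F \<beta> by blast
  qed
  have F_on: "continuous_map (pO X (gob B)) (gob ?A) (\<lambda>w. F (f (p1 X (gob B) w)) (k w))"
    if "X \<in> T" "continuous_map X Y f" "continuous_map (pO X (gob B)) (gob B) k" for X f k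
    using that by (intro Fc pO_in TB continuous_map_comp[OF p1_continuous[OF that(1) TB]])
  \<comment> \<open>The operations of the semidirect product of the group of equivariant maps with \<open>B\<close>, which acts by
    right translation of the argument.\<close>
  have "\<exists>g. continuous_map (pO Y Y) Y g \<and> (\<forall>x\<in>topspace (pO Y Y). \<beta> (g x) = \<beta> (p1 Y Y x) \<otimes>\<^bsub>grp B\<^esub> \<beta> (p2 Y Y x) \<and>
      (\<forall>c\<in>?tB. F (g x) c = F (p1 Y Y x) c \<otimes>\<^bsub>grp ?A\<^esub> F (p2 Y Y x) (c \<otimes>\<^bsub>grp B\<^esub> \<beta> (p1 Y Y x))))"
  proof (rule construct)
    show TYY: "pO Y Y \<in> T" using Y pO_in by blast
    note c1 = p1_continuous[OF Y(1,1)] and c2 = p2_continuous[OF Y(1,1)]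
    note TYYB = pO_in[OF TYY TB] and d1 = p1_continuous[OF TYY TB] and d2 = p2_continuous[OF TYY TB]
    show "continuous_map (pO Y Y) (gob B) (\<lambda>x. \<beta> (p1 Y Y x) \<otimes>\<^bsub>grp B\<^esub> \<beta> (p2 Y Y x))"
      by (intro continuous_mult[OF B TYY] continuous_map_comp[OF c1 \<beta>c] continuous_map_comp[OF c2 \<beta>c])
    show "continuous_map (pO (pO Y Y) (gob B)) (gob ?A) (\<lambda>w. F (p1 Y Y (p1 (pO Y Y) (gob B) w)) (p2 (pO Y Y) (gob B) w) \<otimes>\<^bsub>grp ?A\<^esub>
       F (p2 Y Y (p1 (pO Y Y) (gob B) w)) (p2 (pO Y Y) (gob B) w \<otimes>\<^bsub>grp B\<^esub> \<beta> (p1 Y Y (p1 (pO Y Y) (gob B) w))))"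
      by (intro continuous_mult[OF A TYYB] continuous_mult[OF B TYYB] F_on[OF TYY] c1 c2 d2 continuous_map_comp[OF continuous_map_comp[OF d1 c1] \<beta>c])
  next
    fix x c assume x: "x \<in> topspace (pO Y Y)" and c: "c \<in> ?tB"
    have xS: "p1 Y Y x \<in> S" "p2 Y Y x \<in> S" using p1_in[OF Y(1,1) x] p2_in[OF Y(1,1) x] Y(2) by auto
    note Fs = Fin[OF xS(1)] Fin[OF xS(2)] \<beta>in[OF xS(1)]
    show "?\<pi> (F (p1 Y Y x) c \<otimes>\<^bsub>grp ?A\<^esub> F (p2 Y Y x) (c \<otimes>\<^bsub>grp B\<^esub> \<beta> (p1 Y Y x))) = \<one>\<^bsub>grp E\<^esub>"
      using c xS Fs Bc Ec S_ker by (simp add: \<pi>h)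
    fix e assume e: "e \<in> ?tE"
    show "F (p1 Y Y x) (\<alpha> e \<otimes>\<^bsub>grp B\<^esub> c) \<otimes>\<^bsub>grp ?A\<^esub> F (p2 Y Y x) (\<alpha> e \<otimes>\<^bsub>grp B\<^esub> c \<otimes>\<^bsub>grp B\<^esub> \<beta> (p1 Y Y x)) =
      ?conj e (F (p1 Y Y x) c \<otimes>\<^bsub>grp ?A\<^esub> F (p2 Y Y x) (c \<otimes>\<^bsub>grp B\<^esub> \<beta> (p1 Y Y x)))"
      using c e xS Fs Bc Ac \<sigma>in[OF e] \<alpha>in[OF e] S_equiv by (simp add: Ba Aa A.inv_cancel)
  qed
  then obtain \<mu> where \<mu>: "continuous_map (pO Y Y) Y \<mu>"
    "\<And>x. x \<in> topspace (pO Y Y) \<Longrightarrow> \<beta> (\<mu> x) = \<beta> (p1 Y Y x) \<otimes>\<^bsub>grp B\<^esub> \<beta> (p2 Y Y x)"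
    "\<And>x c. x \<in> topspace (pO Y Y) \<Longrightarrow> c \<in> ?tB \<Longrightarrow> F (\<mu> x) c = F (p1 Y Y x) c \<otimes>\<^bsub>grp ?A\<^esub> F (p2 Y Y x) (c \<otimes>\<^bsub>grp B\<^esub> \<beta> (p1 Y Y x))"
    by blast
  have "\<exists>g. continuous_map Y Y g \<and> (\<forall>x\<in>topspace Y. \<beta> (g x) = inv\<^bsub>grp B\<^esub> \<beta> x \<and>
      (\<forall>c\<in>?tB. F (g x) c = inv\<^bsub>grp ?A\<^esub> F x (c \<otimes>\<^bsub>grp B\<^esub> inv\<^bsub>grp B\<^esub> \<beta> x)))"
  proof (rule construct[OF Y(1)])
    note TYB = pO_in[OF Y(1) TB] and d1 = p1_continuous[OF Y(1) TB] and d2 = p2_continuous[OF Y(1) TB]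
    show "continuous_map Y (gob B) (\<lambda>x. inv\<^bsub>grp B\<^esub> \<beta> x)" by (rule continuous_inv[OF B \<beta>c])
    show "continuous_map (pO Y (gob B)) (gob ?A) (\<lambda>w. inv\<^bsub>grp ?A\<^esub> F (p1 Y (gob B) w) (p2 Y (gob B) w \<otimes>\<^bsub>grp B\<^esub> inv\<^bsub>grp B\<^esub> \<beta> (p1 Y (gob B) w)))"
      by (intro continuous_inv[OF A] continuous_mult[OF B TYB] Fc[OF TYB] d1 d2 continuous_inv[OF B] continuous_map_comp[OF d1 \<beta>c])
  next
    fix x c assume x: "x \<in> topspace Y" and c: "c \<in> ?tB"
    have xS: "x \<in> S" using x Y(2) by simp
    note Fs = Fin[OF xS] \<beta>in[OF xS]
    show "?\<pi> (inv\<^bsub>grp ?A\<^esub> F x (c \<otimes>\<^bsub>grp B\<^esub> inv\<^bsub>grp B\<^esub> \<beta> x)) = \<one>\<^bsub>grp E\<^esub>"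
      using c xS Fs Bc S_ker by (simp add: \<pi>h)
    fix e assume e: "e \<in> ?tE"
    show "inv\<^bsub>grp ?A\<^esub> F x (\<alpha> e \<otimes>\<^bsub>grp B\<^esub> c \<otimes>\<^bsub>grp B\<^esub> inv\<^bsub>grp B\<^esub> \<beta> x) =
      ?conj e (inv\<^bsub>grp ?A\<^esub> F x (c \<otimes>\<^bsub>grp B\<^esub> inv\<^bsub>grp B\<^esub> \<beta> x))"
      using c e xS Fs Bc Ac \<sigma>in[OF e] \<alpha>in[OF e] S_equiv by (simp add: Ba Aa A.inv_mult_group)
  qed
  then obtain \<iota> where \<iota>: "continuous_map Y Y \<iota>"
    "\<And>x. x \<in> S \<Longrightarrow> \<beta> (\<iota> x) = inv\<^bsub>grp B\<^esub> \<beta> x"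
    "\<And>x c. x \<in> S \<Longrightarrow> c \<in> ?tB \<Longrightarrow> F (\<iota> x) c = inv\<^bsub>grp ?A\<^esub> F x (c \<otimes>\<^bsub>grp B\<^esub> inv\<^bsub>grp B\<^esub> \<beta> x)"
    using Y(2) by blast
  have "\<exists>g. continuous_map (termO (Top T)) Y g \<and> (\<forall>x\<in>topspace (termO (Top T)). \<beta> (g x) = \<one>\<^bsub>grp B\<^esub> \<and>
      (\<forall>c\<in>?tB. F (g x) c = \<one>\<^bsub>grp ?A\<^esub>))"
    using Ac Bc \<sigma>in by (intro construct[OF termO_in]) (simp_all add: \<pi>h A.r_inv[simplified])
  then obtain o' where o': "continuous_map (termO (Top T)) Y o'" "\<beta> (o' pt) = \<one>\<^bsub>grp B\<^esub>"
    "\<forall>c\<in>?tB. F (o' pt) c = \<one>\<^bsub>grp ?A\<^esub>"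
    by (auto simp: termO_topspace)
  define o1 where "o1 = o' pt"
  have o1: "o1 \<in> S" "\<beta> o1 = \<one>\<^bsub>grp B\<^esub>" "\<And>c. c \<in> ?tB \<Longrightarrow> F o1 c = \<one>\<^bsub>grp ?A\<^esub>"
    using o' continuous_map_in[OF o'(1), of pt] by (simp_all add: o1_def termO_topspace Y(2))
  define M where "M = \<lparr>carrier = S, mult = (\<lambda>v w. \<mu> (pr Y Y v w)), one = o1\<rparr>"
  have M_in: "v \<otimes>\<^bsub>M\<^esub> w \<in> S" and M_\<beta>: "\<beta> (v \<otimes>\<^bsub>M\<^esub> w) = \<beta> v \<otimes>\<^bsub>grp B\<^esub> \<beta> w"
    and M_F: "\<And>c. c \<in> ?tB \<Longrightarrow> F (v \<otimes>\<^bsub>M\<^esub> w) c = F v c \<otimes>\<^bsub>grp ?A\<^esub> F w (c \<otimes>\<^bsub>grp B\<^esub> \<beta> v)"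
    if "v \<in> S" "w \<in> S" for v w
  proof -
    have "pr Y Y v w \<in> topspace (pO Y Y)" using that Y by (intro pr_in) auto
    with continuous_map_in[OF \<mu>(1) this] \<mu>(2,3)[OF this] that
    show "v \<otimes>\<^bsub>M\<^esub> w \<in> S" "\<beta> (v \<otimes>\<^bsub>M\<^esub> w) = \<beta> v \<otimes>\<^bsub>grp B\<^esub> \<beta> w"
      "\<And>c. c \<in> ?tB \<Longrightarrow> F (v \<otimes>\<^bsub>M\<^esub> w) c = F v c \<otimes>\<^bsub>grp ?A\<^esub> F w (c \<otimes>\<^bsub>grp B\<^esub> \<beta> v)"
      by (simp_all add: M_def Y(2) p1_pr[OF Y(1,1)] p2_pr[OF Y(1,1)])
  qed
  have \<iota>in: "\<iota> v \<in> S" if "v \<in> S" for v using continuous_map_in[OF \<iota>(1), of v] that Y(2) by simp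
  have one: "\<one>\<^bsub>M\<^esub> = o1" by (simp add: M_def)
  have \<iota>l: "\<iota> v \<otimes>\<^bsub>M\<^esub> v = \<one>\<^bsub>M\<^esub>" if v: "v \<in> S" for v
    unfolding one
    by (rule eqI) (use \<iota>in[OF v] v o1 Bc \<beta>in[OF v] Fin[OF v] B.l_inv[simplified] A.l_inv[simplified]
      in \<open>simp_all add: M_in M_\<beta> M_F \<iota>(2,3)\<close>)
  have M: "group M"
  proof (rule groupI)
    fix u v w assume "u \<in> carrier M" "v \<in> carrier M" "w \<in> carrier M"
    then have uvw: "u \<in> S" "v \<in> S" "w \<in> S" by (simp_all add: M_def)
    show "u \<otimes>\<^bsub>M\<^esub> v \<otimes>\<^bsub>M\<^esub> w = u \<otimes>\<^bsub>M\<^esub> (v \<otimes>\<^bsub>M\<^esub> w)"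
      by (rule eqI) (use uvw Bc Ac \<beta>in Fin in \<open>simp_all add: M_in M_\<beta> M_F Ba Aa\<close>)
  next
    fix v assume "v \<in> carrier M"
    then have v: "v \<in> S" by (simp add: M_def)
    show "\<one>\<^bsub>M\<^esub> \<otimes>\<^bsub>M\<^esub> v = v"
      unfolding one by (rule eqI) (use v o1 \<beta>in[OF v] Fin[OF v] B.l_one[simplified] B.r_one[simplified] A.l_one[simplified] in \<open>simp_all add: M_in M_\<beta> M_F\<close>)
    show "\<exists>u\<in>carrier M. u \<otimes>\<^bsub>M\<^esub> v = \<one>\<^bsub>M\<^esub>"
      using \<iota>l[OF v] \<iota>in[OF v] by (intro bexI[of _ "\<iota> v"]) (simp_all add: M_def)
  qed (use o1 M_in in \<open>simp_all add: M_def\<close>)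
  interpret M: group M by (fact M)
  have car: "carrier M = topspace Y" by (simp add: M_def Y)
  have cm: "continuous_map (pO Y Y) Y (\<lambda>w. p1 Y Y w \<otimes>\<^bsub>M\<^esub> p2 Y Y w)"
    by (rule continuous_map_eq[OF \<mu>(1)]) (simp add: M_def pr_surj[OF Y(1,1)])
  have ci: "continuous_map Y Y (\<lambda>w. inv\<^bsub>M\<^esub> w)"
    using \<iota>l \<iota>in by (intro continuous_map_eq[OF \<iota>(1)] M.inv_equality[symmetric]) (simp_all add: car Y(2))
  note G = group_object_of[OF Y(1) M car cm ci]
  have "coinduced T E B \<alpha> y (group_object_of Y M) F \<beta>"
    by unfold_locales
      (use E B \<alpha> y G(1) Fin S_ker S_equiv eqI M_F M_\<beta> \<beta>c Fc construct in \<open>simp_all add: G(2,3) Y(2)\<close>)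
  then show ?thesis by blast
qed

context coinduced
begin

abbreviation "A \<equiv> ptot y"
abbreviation "\<pi> \<equiv> pproj y"
abbreviation "\<sigma> \<equiv> psect y"
abbreviation "\<C> \<equiv> Grp (Top T)"

lemma A: "is_group_object (Top T) A" and \<pi>: "\<pi> \<in> Hom \<C> A E" and \<sigma>: "\<sigma> \<in> Hom \<C> E A"
  and \<pi>_\<sigma>: "e \<in> topspace (gob E) \<Longrightarrow> \<pi> (\<sigma> e) = e"
proof -
  show "is_group_object (Top T) A" and "\<pi> \<in> Hom \<C> A E" and "\<sigma> \<in> Hom \<C> E A"
    using y by (auto simp: Pt_simps Ob_Grp)
  have "Comp \<C> E A E \<pi> \<sigma> = Ident \<C> E" using y by (auto simp: Pt_simps)
  from fun_cong[OF this, of e] show "e \<in> topspace (gob E) \<Longrightarrow> \<pi> (\<sigma> e) = e" by (simp add: Comp_Grp Ident_Grp)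
qed

sublocale E: group "grp E" by (rule group_object_group[OF E])
sublocale A: group "grp A" by (rule group_object_group[OF A])
sublocale B: group "grp B" by (rule group_object_group[OF B])
sublocale R: group "grp R" by (rule group_object_group[OF R])

lemmas closed =
  A.m_closed[simplified] A.one_closed[simplified] A.inv_closed[simplified]
  B.m_closed[simplified] B.one_closed[simplified] B.inv_closed[simplified]
  E.m_closed[simplified] E.one_closed[simplified] E.inv_closed[simplified]
  R.m_closed[simplified] R.one_closed[simplified]

lemmas \<beta>_in = continuous_map_in[OF \<beta>_continuous]

lemma \<beta>_Hom: "restrict \<beta> (topspace (gob R)) \<in> Hom \<C> R B"
  using \<beta>_mult by (intro restrict_Hom_Grp[OF R B \<beta>_continuous])

text \<open>The section of the semidirect product. An element is determined by its coordinates, so naming those of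
  the value at \<open>b\<close> suffices.\<close>

definition sec :: "'u \<Rightarrow> 'u" where
  "sec b = (THE w. w \<in> topspace (gob R) \<and> \<beta> w = b \<and> (\<forall>c\<in>topspace (gob B). F w c = \<one>\<^bsub>grp A\<^esub>))"

lemma sec:
  shows sec_continuous: "continuous_map (gob B) (gob R) sec"
    and sec_in: "b \<in> topspace (gob B) \<Longrightarrow> sec b \<in> topspace (gob R)"
    and \<beta>_sec: "b \<in> topspace (gob B) \<Longrightarrow> \<beta> (sec b) = b"
    and F_sec: "b \<in> topspace (gob B) \<Longrightarrow> c \<in> topspace (gob B) \<Longrightarrow> F (sec b) c = \<one>\<^bsub>grp A\<^esub>"
proof -
  have "\<exists>g. continuous_map (gob B) (gob R) g \<and>
        (\<forall>x\<in>topspace (gob B). \<beta> (g x) = x \<and> (\<forall>c\<in>topspace (gob B). F (g x) c = \<one>\<^bsub>grp A\<^esub>))"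
    using closed Grp_Hom_in[OF E A \<sigma>]
    by (intro coinduced_map group_object_in[OF B]) (simp_all add: Grp_Hom_one[OF A E \<pi>] A.r_inv[simplified])
  then obtain g where g: "continuous_map (gob B) (gob R) g" "\<And>x. x \<in> topspace (gob B) \<Longrightarrow> \<beta> (g x) = x"
     "\<And>x c. x \<in> topspace (gob B) \<Longrightarrow> c \<in> topspace (gob B) \<Longrightarrow> F (g x) c = \<one>\<^bsub>grp A\<^esub>" by blast
  have eq: "sec b = g b" if "b \<in> topspace (gob B)" for b
    unfolding sec_def
  proof (rule the_equality)
    fix w assume w: "w \<in> topspace (gob R) \<and> \<beta> w = b \<and> (\<forall>c\<in>topspace (gob B). F w c = \<one>\<^bsub>grp A\<^esub>)"
    show "w = g b" by (rule coinduced_eqI) (use w g that continuous_map_in[OF g(1)] in simp_all)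
  qed (use g that continuous_map_in[OF g(1)] in simp)
  show "continuous_map (gob B) (gob R) sec" by (rule continuous_map_eq[OF g(1)]) (simp add: eq)
  show "b \<in> topspace (gob B) \<Longrightarrow> sec b \<in> topspace (gob R)" "b \<in> topspace (gob B) \<Longrightarrow> \<beta> (sec b) = b"
    "b \<in> topspace (gob B) \<Longrightarrow> c \<in> topspace (gob B) \<Longrightarrow> F (sec b) c = \<one>\<^bsub>grp A\<^esub>"
    using eq g continuous_map_in[OF g(1)] by simp_all
qed

lemma sec_Hom: "restrict sec (topspace (gob B)) \<in> Hom \<C> B R"
proof (rule restrict_Hom_Grp[OF B R sec_continuous])
  fix b b' assume b: "b \<in> topspace (gob B)" "b' \<in> topspace (gob B)"
  show "sec (b \<otimes>\<^bsub>grp B\<^esub> b') = sec b \<otimes>\<^bsub>grp R\<^esub> sec b'"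
    by (rule coinduced_eqI) (use b closed in \<open>simp_all add: sec_in \<beta>_sec F_sec \<beta>_mult F_mult A.l_one[simplified]\<close>)
qed

definition coind :: "(('u topology, 'u \<Rightarrow> 'u) grp_obj, 'u \<Rightarrow> 'u) point" where
  "coind = Point R (restrict \<beta> (topspace (gob R))) (restrict sec (topspace (gob B)))"

lemma coind_point: "coind \<in> Ob (Pt \<C> B)"
  using R \<beta>_Hom sec_Hom sec_in \<beta>_sec
  by (simp add: coind_def Pt_simps Ob_Grp Comp_Grp Ident_Grp restrict_eq_iff)

lemma coind_simps: "ptot coind = R" "pproj coind = restrict \<beta> (topspace (gob R))"
  "psect coind = restrict sec (topspace (gob B))"
  by (simp_all add: coind_def)

text \<open>The pulled back point by its elements: \<open>v\<close> recovers an element from its two coordinates, and does so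
  continuously for maps out of any space of the class.\<close>

lemma pulled_back_point:
  assumes x: "x \<in> Ob (Pt \<C> B)"
  obtains P p q s v where "point_pullback \<C> E B \<alpha> x = (P, p, q)"
    "is_pullback \<C> E (ptot x) B \<alpha> (pproj x) (P, p, q)"
    "reindex_ob \<C> E B \<alpha> x = Point P p s" "Point P p s \<in> Ob (Pt \<C> E)"
    "is_group_object (Top T) P" "p \<in> Hom \<C> P E" "q \<in> Hom \<C> P (ptot x)" "s \<in> Hom \<C> E P"
    "\<forall>e\<in>topspace (gob E). p (s e) = e \<and> q (s e) = psect x (\<alpha> e)"
    "\<forall>w\<in>topspace (gob P). \<alpha> (p w) = pproj x (q w) \<and> v (p w) (q w) = w"
    "\<forall>e\<in>topspace (gob E). \<forall>a\<in>topspace (gob (ptot x)). \<alpha> e = pproj x a \<longrightarrow>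
       v e a \<in> topspace (gob P) \<and> p (v e a) = e \<and> q (v e a) = a"
    "\<forall>Z\<in>T. \<forall>f g. continuous_map Z (gob E) f \<longrightarrow> continuous_map Z (gob (ptot x)) g \<longrightarrow>
       (\<forall>z\<in>topspace Z. \<alpha> (f z) = pproj x (g z)) \<longrightarrow> continuous_map Z (gob P) (\<lambda>z. v (f z) (g z))"
proof -
  have ob: "E \<in> Ob \<C>" "B \<in> Ob \<C>" using E B by (simp_all add: Ob_Grp)
  obtain P p q s where P: "point_pullback \<C> E B \<alpha> x = (P, p, q)"
    "is_pullback \<C> E (ptot x) B \<alpha> (pproj x) (P, p, q)"
    "reindex_ob \<C> E B \<alpha> x = Point P p s"
    "s \<in> Hom \<C> E P" "Comp \<C> E P E p s = Ident \<C> E"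
    "Comp \<C> E P (ptot x) q s = Comp \<C> E B (ptot x) (psect x) \<alpha>"
    "Point P p s \<in> Ob (Pt \<C> E)"
    by (rule reindex_ob_pullback[OF Grp_category ob \<alpha> x group_pullback_exists[OF ob \<alpha> x]]) (rule that)
  have X: "is_group_object (Top T) (ptot x)" "pproj x \<in> Hom \<C> (ptot x) B" using x by (simp_all add: Pt_simps Ob_Grp)
  have Pg: "is_group_object (Top T) P" and pq: "p \<in> Hom \<C> P E" "q \<in> Hom \<C> P (ptot x)"
    and sq: "Comp \<C> P E B \<alpha> p = Comp \<C> P (ptot x) B (pproj x) q"
    using P(2) unfolding is_pullback_def by (simp_all add: Ob_Grp)
  obtain v where v: "\<forall>w\<in>topspace (gob P). v (p w) (q w) = w"
    "\<forall>e\<in>topspace (gob E). \<forall>a\<in>topspace (gob (ptot x)). \<alpha> e = pproj x a \<longrightarrow>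
       v e a \<in> topspace (gob P) \<and> p (v e a) = e \<and> q (v e a) = a"
    "\<forall>Z\<in>T. \<forall>f g. continuous_map Z (gob E) f \<longrightarrow> continuous_map Z (gob (ptot x)) g \<longrightarrow>
       (\<forall>z\<in>topspace Z. \<alpha> (f z) = pproj x (g z)) \<longrightarrow> continuous_map Z (gob P) (\<lambda>z. v (f z) (g z))"
    by (rule group_pullback_elements[OF E X(1) B \<alpha> X(2) P(2)]) (rule that)
  have "p (s e) = e \<and> q (s e) = psect x (\<alpha> e)" if "e \<in> topspace (gob E)" for e
    using fun_cong[OF P(5), of e] fun_cong[OF P(6), of e] that by (simp add: Comp_Grp Ident_Grp)
  moreover have "\<alpha> (p w) = pproj x (q w)" if "w \<in> topspace (gob P)" for w
    using fun_cong[OF sq, of w] that by (simp add: Comp_Grp)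
  ultimately show thesis
    using v by (intro that[OF P(1-3,7) Pg pq P(4) _ _ v(2,3)]) simp_all
qed

text \<open>The counit evaluates the equivariant map at the unit of \<open>B\<close>; it is a homomorphism because of
  equivariance.\<close>

lemma counit:
  assumes r: "reindex_ob \<C> E B \<alpha> coind = Point P p s"
    and P: "is_group_object (Top T) P" and p: "p \<in> Hom \<C> P E" and q: "q \<in> Hom \<C> P R" and s: "s \<in> Hom \<C> E P"
    and sq: "\<forall>w\<in>topspace (gob P). \<alpha> (p w) = \<beta> (q w)"
    and ps: "\<forall>e\<in>topspace (gob E). p (s e) = e \<and> q (s e) = sec (\<alpha> e)"
  shows "restrict (\<lambda>w. F (q w) \<one>\<^bsub>grp B\<^esub> \<otimes>\<^bsub>grp A\<^esub> \<sigma> (p w)) (topspace (gob P))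
    \<in> Hom (Pt \<C> E) (reindex_ob \<C> E B \<alpha> coind) y" (is "restrict ?\<epsilon> _ \<in> _")
proof -
  note TP = group_object_in[OF P]
  interpret P: group "grp P" by (rule group_object_group[OF P])
  note \<sigma>in = Grp_Hom_in[OF E A \<sigma>] and \<alpha>in = Grp_Hom_in[OF E B \<alpha>]
    and pin = Grp_Hom_in[OF P E p] and qin = Grp_Hom_in[OF P R q] and sin = Grp_Hom_in[OF E P s]
  have \<epsilon>in: "?\<epsilon> w \<in> topspace (gob A)" if "w \<in> topspace (gob P)" for w
    using that closed pin qin \<sigma>in F_in by simp
  have hom: "restrict ?\<epsilon> (topspace (gob P)) \<in> Hom \<C> P A"
  proof (rule restrict_Hom_Grp[OF P A])
    show "continuous_map (gob P) (gob A) ?\<epsilon>"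
      using closed
      by (intro continuous_mult[OF A TP] F_continuous[OF TP] Grp_Hom_continuous[OF P R q]
          continuous_map_comp[OF Grp_Hom_continuous[OF P E p] Grp_Hom_continuous[OF E A \<sigma>]]) simp
    fix w w' assume w: "w \<in> topspace (gob P)" "w' \<in> topspace (gob P)"
    have "F (q w') (\<one>\<^bsub>grp B\<^esub> \<otimes>\<^bsub>grp B\<^esub> \<beta> (q w)) = F (q w') (\<alpha> (p w) \<otimes>\<^bsub>grp B\<^esub> \<one>\<^bsub>grp B\<^esub>)"
      using sq w qin pin \<alpha>in \<beta>_in by (metis B.l_one B.r_one grp_simps(1))
    also have "\<dots> = \<sigma> (p w) \<otimes>\<^bsub>grp A\<^esub> F (q w') \<one>\<^bsub>grp B\<^esub> \<otimes>\<^bsub>grp A\<^esub> inv\<^bsub>grp A\<^esub> \<sigma> (p w)"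
      using w qin pin closed by (intro F_equivariant)
    finally show "?\<epsilon> (w \<otimes>\<^bsub>grp P\<^esub> w') = ?\<epsilon> w \<otimes>\<^bsub>grp A\<^esub> ?\<epsilon> w'"
      using w qin pin closed \<sigma>in F_in
      by (simp add: Grp_Hom_mult[OF P E p] Grp_Hom_mult[OF P R q] Grp_Hom_mult[OF E A \<sigma>] F_mult
          A.m_assoc[simplified] A.inv_cancel)
  qed
  have "Comp \<C> P A E \<pi> (restrict ?\<epsilon> (topspace (gob P))) = p"
  proof (rule extensionalityI[of _ "topspace (gob P)"])
    fix w assume w: "w \<in> topspace (gob P)"
    then show "Comp \<C> P A E \<pi> (restrict ?\<epsilon> (topspace (gob P))) w = p w"
      using qin pin closed \<sigma>in F_in by (simp add: Comp_Grp Grp_Hom_mult[OF A E \<pi>] F_kernel \<pi>_\<sigma> E.l_one[simplified])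
  qed (use Grp_Hom_Top[OF P E p] in \<open>simp_all add: Comp_Grp Hom_Top\<close>)
  moreover have "Comp \<C> E P A (restrict ?\<epsilon> (topspace (gob P))) s = \<sigma>"
  proof (rule extensionalityI[of _ "topspace (gob E)"])
    fix e assume e: "e \<in> topspace (gob E)"
    then show "Comp \<C> E P A (restrict ?\<epsilon> (topspace (gob P))) s e = \<sigma> e"
      using sin closed \<sigma>in \<alpha>in ps by (simp add: Comp_Grp F_sec A.l_one[simplified])
  qed (use Grp_Hom_Top[OF E A \<sigma>] in \<open>simp_all add: Comp_Grp Hom_Top\<close>)
  ultimately show ?thesis using hom by (simp add: r Pt_simps)
qed

end

context coinduced
begin

text \<open>The transpose of \<open>h\<close> sends \<open>x\<close> over \<open>b\<close> to the map \<open>c \<mapsto> h (1, s c \<cdot> x \<cdot> s (c \<cdot> b)\<inverse>)\<close>: the element fed to \<open>h\<close> lies in the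
  kernel of the projection, and if \<open>x = n \<cdot> s b\<close> it is the conjugate of \<open>n\<close> by \<open>s c\<close>. Any transpose must have these
  values, because conjugating by the section at \<open>c\<close> and evaluating at the unit amounts to evaluating at \<open>c\<close>.\<close>

lemma coind_cofree:
  "\<exists>\<epsilon>\<in>Hom (Pt \<C> E) (reindex_ob \<C> E B \<alpha> coind) y. \<forall>x\<in>Ob (Pt \<C> B). \<forall>h\<in>Hom (Pt \<C> E) (reindex_ob \<C> E B \<alpha> x) y.
    \<exists>!u. u \<in> Hom (Pt \<C> B) x coind \<and>
      Comp (Pt \<C> E) (reindex_ob \<C> E B \<alpha> x) (reindex_ob \<C> E B \<alpha> coind) y \<epsilon> (reindex_ar \<C> E B \<alpha> x coind u) = h"
proof -
  let ?tE = "topspace (gob E)" and ?tA = "topspace (gob A)" and ?tB = "topspace (gob B)" and ?tR = "topspace (gob R)"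
  have ob: "E \<in> Ob \<C>" "B \<in> Ob \<C>" using E B by (simp_all add: Ob_Grp)
  note \<sigma>in = Grp_Hom_in[OF E A \<sigma>] and \<alpha>in = Grp_Hom_in[OF E B \<alpha>]
  obtain P p q s v where P: "point_pullback \<C> E B \<alpha> coind = (P, p, q)"
    "is_pullback \<C> E (ptot coind) B \<alpha> (pproj coind) (P, p, q)"
    "reindex_ob \<C> E B \<alpha> coind = Point P p s" "Point P p s \<in> Ob (Pt \<C> E)"
    "is_group_object (Top T) P" "p \<in> Hom \<C> P E" "q \<in> Hom \<C> P (ptot coind)" "s \<in> Hom \<C> E P"
    "\<forall>e\<in>topspace (gob E). p (s e) = e \<and> q (s e) = psect coind (\<alpha> e)"
    "\<forall>w\<in>topspace (gob P). \<alpha> (p w) = pproj coind (q w) \<and> v (p w) (q w) = w"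
    "\<forall>e\<in>topspace (gob E). \<forall>a\<in>topspace (gob (ptot coind)). \<alpha> e = pproj coind a \<longrightarrow>
       v e a \<in> topspace (gob P) \<and> p (v e a) = e \<and> q (v e a) = a"
    "\<forall>Z\<in>T. \<forall>f g. continuous_map Z (gob E) f \<longrightarrow> continuous_map Z (gob (ptot coind)) g \<longrightarrow>
       (\<forall>z\<in>topspace Z. \<alpha> (f z) = pproj coind (g z)) \<longrightarrow> continuous_map Z (gob P) (\<lambda>z. v (f z) (g z))"
    by (rule pulled_back_point[OF coind_point]) (rule that)
  have qR: "q \<in> Hom \<C> P R" using P(7) by (simp add: coind_simps)
  note qin = Grp_Hom_in[OF P(5) R qR] and pin = Grp_Hom_in[OF P(5) E P(6)]
  define \<epsilon> where "\<epsilon> = restrict (\<lambda>w. F (q w) \<one>\<^bsub>grp B\<^esub> \<otimes>\<^bsub>grp A\<^esub> \<sigma> (p w)) (topspace (gob P))"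
  have \<epsilon>: "\<epsilon> \<in> Hom (Pt \<C> E) (reindex_ob \<C> E B \<alpha> coind) y"
    unfolding \<epsilon>_def
    by (rule counit[OF P(3,5,6) qR P(8)]) (use P(9,10) qin \<alpha>in in \<open>simp_all add: coind_simps\<close>)
  have F_one: "F (w \<otimes>\<^bsub>grp R\<^esub> sec b) \<one>\<^bsub>grp B\<^esub> = F w \<one>\<^bsub>grp B\<^esub>" if "w \<in> ?tR" "b \<in> ?tB" for w b
    using that closed \<beta>_in F_in by (simp add: F_mult F_sec sec_in A.r_one[simplified])
  have F_shift: "F (sec c \<otimes>\<^bsub>grp R\<^esub> w) \<one>\<^bsub>grp B\<^esub> = F w c" if "w \<in> ?tR" "c \<in> ?tB" for w c
    using that closed F_in by (simp add: F_mult F_sec sec_in \<beta>_sec A.l_one[simplified] B.l_one[simplified])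
  show ?thesis
  proof (rule bexI[OF _ \<epsilon>], intro ballI)
    fix x h assume x: "x \<in> Ob (Pt \<C> B)" and h: "h \<in> Hom (Pt \<C> E) (reindex_ob \<C> E B \<alpha> x) y"
    let ?X = "ptot x" and ?px = "pproj x" and ?sx = "psect x"
    let ?tX = "topspace (gob ?X)"
    have X: "is_group_object (Top T) ?X" and px: "?px \<in> Hom \<C> ?X B" and sx: "?sx \<in> Hom \<C> B ?X"
      and ps: "Comp \<C> B ?X B ?px ?sx = Ident \<C> B" using x by (simp_all add: Pt_simps Ob_Grp)
    interpret X: group "grp ?X" by (rule group_object_group[OF X])
    note TX = group_object_in[OF X] and TB = group_object_in[OF B]
    note Xc = X.m_closed[simplified] X.one_closed[simplified] X.inv_closed[simplified]
    note pxin = Grp_Hom_in[OF X B px] and sxin = Grp_Hom_in[OF B X sx]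
    note pxh = Grp_Hom_mult[OF X B px] Grp_Hom_inv[OF X B px]
    note sxh = Grp_Hom_mult[OF B X sx] Grp_Hom_one[OF B X sx]
    have px_sx: "?px (?sx b) = b" if "b \<in> ?tB" for b using fun_cong[OF ps, of b] that by (simp add: Comp_Grp Ident_Grp)
    obtain P' p' q' s' v' where P': "point_pullback \<C> E B \<alpha> x = (P', p', q')"
      "is_pullback \<C> E ?X B \<alpha> ?px (P', p', q')"
      "reindex_ob \<C> E B \<alpha> x = Point P' p' s'" "Point P' p' s' \<in> Ob (Pt \<C> E)"
      "is_group_object (Top T) P'" "p' \<in> Hom \<C> P' E" "q' \<in> Hom \<C> P' ?X" "s' \<in> Hom \<C> E P'"
      "\<forall>e\<in>topspace (gob E). p' (s' e) = e \<and> q' (s' e) = ?sx (\<alpha> e)"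
      "\<forall>w\<in>topspace (gob P'). \<alpha> (p' w) = ?px (q' w) \<and> v' (p' w) (q' w) = w"
      "\<forall>e\<in>topspace (gob E). \<forall>a\<in>?tX. \<alpha> e = ?px a \<longrightarrow>
         v' e a \<in> topspace (gob P') \<and> p' (v' e a) = e \<and> q' (v' e a) = a"
      "\<forall>Z\<in>T. \<forall>f g. continuous_map Z (gob E) f \<longrightarrow> continuous_map Z (gob ?X) g \<longrightarrow>
         (\<forall>z\<in>topspace Z. \<alpha> (f z) = ?px (g z)) \<longrightarrow> continuous_map Z (gob P') (\<lambda>z. v' (f z) (g z))"
      by (rule pulled_back_point[OF x]) (rule that)
    interpret P': group "grp P'" by (rule group_object_group[OF P'(5)])
    note p'in = Grp_Hom_in[OF P'(5) E P'(6)] and q'in = Grp_Hom_in[OF P'(5) X P'(7)]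
    have hA: "h \<in> Hom \<C> P' A" and \<pi>h: "Comp \<C> P' A E \<pi> h = p'" and hs: "Comp \<C> E P' A h s' = \<sigma>"
      using h unfolding P'(3) by (simp_all add: Pt_simps)
    note hin = Grp_Hom_in[OF P'(5) A hA] and hmult = Grp_Hom_mult[OF P'(5) A hA]
    have v': "v' e a \<in> topspace (gob P')" "p' (v' e a) = e" "q' (v' e a) = a"
      if "e \<in> ?tE" "a \<in> ?tX" "\<alpha> e = ?px a" for e a using P'(11) that by auto
    have v'_mult: "v' e a \<otimes>\<^bsub>grp P'\<^esub> v' e' a' = v' (e \<otimes>\<^bsub>grp E\<^esub> e') (a \<otimes>\<^bsub>grp ?X\<^esub> a')"
      if "e \<in> ?tE" "a \<in> ?tX" "\<alpha> e = ?px a" "e' \<in> ?tE" "a' \<in> ?tX" "\<alpha> e' = ?px a'" for e a e' a'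
    proof -
      let ?w = "v' e a \<otimes>\<^bsub>grp P'\<^esub> v' e' a'"
      have w: "?w \<in> topspace (gob P')" using v'[OF that(1-3)] v'[OF that(4-6)] P'.m_closed by simp
      have "p' ?w = e \<otimes>\<^bsub>grp E\<^esub> e'" "q' ?w = a \<otimes>\<^bsub>grp ?X\<^esub> a'"
        using v'[OF that(1-3)] v'[OF that(4-6)]
        by (simp_all add: Grp_Hom_mult[OF P'(5) E P'(6)] Grp_Hom_mult[OF P'(5) X P'(7)])
      then show ?thesis using P'(10) w by force
    qed
    have hs': "h (v' e (?sx (\<alpha> e))) = \<sigma> e" if e: "e \<in> ?tE" for e
    proof -
      have "v' e (?sx (\<alpha> e)) = s' e" using P'(9,10) Grp_Hom_in[OF E P'(5,8)] e by metis
      then show ?thesis using fun_cong[OF hs, of e] e by (simp add: Comp_Grp)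
    qed
    define n where "n a c = ?sx c \<otimes>\<^bsub>grp ?X\<^esub> a \<otimes>\<^bsub>grp ?X\<^esub> inv\<^bsub>grp ?X\<^esub> ?sx (c \<otimes>\<^bsub>grp B\<^esub> ?px a)" for a c
    have n_in: "n a c \<in> ?tX" and n_ker: "?px (n a c) = \<one>\<^bsub>grp B\<^esub>" if "a \<in> ?tX" "c \<in> ?tB" for a c
      using that closed Xc pxin sxin by (simp_all add: n_def pxh px_sx B.r_inv[simplified])
    have n_sx: "n a c \<otimes>\<^bsub>grp ?X\<^esub> ?sx (c \<otimes>\<^bsub>grp B\<^esub> ?px a) = ?sx c \<otimes>\<^bsub>grp ?X\<^esub> a" if "a \<in> ?tX" "c \<in> ?tB" for a c
      using that closed Xc pxin sxin by (simp add: n_def X.m_assoc[simplified] X.l_inv[simplified] X.r_one[simplified])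
    have \<alpha>1: "\<alpha> \<one>\<^bsub>grp E\<^esub> = \<one>\<^bsub>grp B\<^esub>" by (rule Grp_Hom_one[OF E B \<alpha>])
    have v'n: "v' \<one>\<^bsub>grp E\<^esub> (n a c) \<in> topspace (gob P')" "p' (v' \<one>\<^bsub>grp E\<^esub> (n a c)) = \<one>\<^bsub>grp E\<^esub>"
      "q' (v' \<one>\<^bsub>grp E\<^esub> (n a c)) = n a c" if "a \<in> ?tX" "c \<in> ?tB" for a c
      using v'[OF closed(8) n_in[OF that]] n_ker[OF that] \<alpha>1 by simp_all
    define G where "G a c = h (v' \<one>\<^bsub>grp E\<^esub> (n a c))" for a c
    have G_in: "G a c \<in> ?tA" if "a \<in> ?tX" "c \<in> ?tB" for a c using hin v'n that by (simp add: G_def)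
    have "\<exists>g. continuous_map (gob ?X) (gob R) g \<and>
        (\<forall>a\<in>?tX. \<beta> (g a) = ?px a \<and> (\<forall>c\<in>?tB. F (g a) c = G a c))"
    proof (rule coinduced_map[OF TX])
      let ?Q = "pO (gob ?X) (gob B)"
      note TQ = pO_in[OF TX TB] and d1 = p1_continuous[OF TX TB] and d2 = p2_continuous[OF TX TB]
      note cs = Grp_Hom_continuous[OF B X sx] and cp = Grp_Hom_continuous[OF X B px]
      have "continuous_map ?Q (gob ?X) (\<lambda>w. n (p1 (gob ?X) (gob B) w) (p2 (gob ?X) (gob B) w))"
        unfolding n_def
        by (intro continuous_mult[OF X TQ] continuous_inv[OF X] d1 continuous_map_comp[OF d2 cs] continuous_map_comp[OF _ cs]
            continuous_mult[OF B TQ] d2 continuous_map_comp[OF d1 cp])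
      moreover have "continuous_map ?Q (gob E) (\<lambda>w. \<one>\<^bsub>grp E\<^esub>)" using closed by simp
      ultimately have "continuous_map ?Q (gob P') (\<lambda>w. v' \<one>\<^bsub>grp E\<^esub> (n (p1 (gob ?X) (gob B) w) (p2 (gob ?X) (gob B) w)))"
        using P'(12) TQ n_ker p1_in[OF TX TB] p2_in[OF TX TB] \<alpha>1 by simp
      from continuous_map_comp[OF this Grp_Hom_continuous[OF P'(5) A hA]]
      show "continuous_map ?Q (gob A) (\<lambda>w. G (p1 (gob ?X) (gob B) w) (p2 (gob ?X) (gob B) w))" unfolding G_def .
      show "continuous_map (gob ?X) (gob B) ?px" by (rule cp)
    next
      fix a c assume ac: "a \<in> ?tX" "c \<in> ?tB"
      show "\<pi> (G a c) = \<one>\<^bsub>grp E\<^esub>"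
        using fun_cong[OF \<pi>h, of "v' \<one>\<^bsub>grp E\<^esub> (n a c)"] v'n[OF ac] by (simp add: G_def Comp_Grp)
      fix e assume e: "e \<in> ?tE"
      note ec = closed(4)[OF \<alpha>in[OF e] ac(2)]
      have "n a (\<alpha> e \<otimes>\<^bsub>grp B\<^esub> c) \<otimes>\<^bsub>grp ?X\<^esub> ?sx (\<alpha> e) = ?sx (\<alpha> e) \<otimes>\<^bsub>grp ?X\<^esub> n a c"
        using ac e closed Xc pxin sxin \<alpha>in
        by (simp add: n_def sxh X.m_assoc[simplified] B.m_assoc[simplified] X.inv_mult_group X.l_inv[simplified] X.r_one[simplified])
      then have "v' \<one>\<^bsub>grp E\<^esub> (n a (\<alpha> e \<otimes>\<^bsub>grp B\<^esub> c)) \<otimes>\<^bsub>grp P'\<^esub> v' e (?sx (\<alpha> e)) = v' e (?sx (\<alpha> e)) \<otimes>\<^bsub>grp P'\<^esub> v' \<one>\<^bsub>grp E\<^esub> (n a c)"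
        using ac ec e closed sxin \<alpha>in n_in n_ker px_sx \<alpha>1
        by (simp add: v'_mult E.l_one[simplified] E.r_one[simplified])
      then have "G a (\<alpha> e \<otimes>\<^bsub>grp B\<^esub> c) \<otimes>\<^bsub>grp A\<^esub> \<sigma> e = \<sigma> e \<otimes>\<^bsub>grp A\<^esub> G a c"
        using ac ec e v'n v'(1)[OF e sxin[OF \<alpha>in[OF e]]] px_sx \<alpha>in unfolding G_def
        by (simp add: hs'[OF e, symmetric] hmult[symmetric])
      then have "G a (\<alpha> e \<otimes>\<^bsub>grp B\<^esub> c) \<otimes>\<^bsub>grp A\<^esub> \<sigma> e \<otimes>\<^bsub>grp A\<^esub> inv\<^bsub>grp A\<^esub> \<sigma> e = \<sigma> e \<otimes>\<^bsub>grp A\<^esub> G a c \<otimes>\<^bsub>grp A\<^esub> inv\<^bsub>grp A\<^esub> \<sigma> e"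
        by simp
      then show "G a (\<alpha> e \<otimes>\<^bsub>grp B\<^esub> c) = \<sigma> e \<otimes>\<^bsub>grp A\<^esub> G a c \<otimes>\<^bsub>grp A\<^esub> inv\<^bsub>grp A\<^esub> \<sigma> e"
        using ac ec e closed G_in \<sigma>in by (simp add: A.m_assoc[simplified] A.r_inv[simplified] A.r_one[simplified])
    qed
    then obtain g where g: "continuous_map (gob ?X) (gob R) g" and \<beta>g: "\<And>a. a \<in> ?tX \<Longrightarrow> \<beta> (g a) = ?px a"
      and Fg: "\<And>a c. a \<in> ?tX \<Longrightarrow> c \<in> ?tB \<Longrightarrow> F (g a) c = G a c" by blast
    note gin = continuous_map_in[OF g]
    let ?u = "restrict g ?tX"
    have G_mult: "G (a \<otimes>\<^bsub>grp ?X\<^esub> a') c = G a c \<otimes>\<^bsub>grp A\<^esub> G a' (c \<otimes>\<^bsub>grp B\<^esub> ?px a)"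
      if a: "a \<in> ?tX" "a' \<in> ?tX" and c: "c \<in> ?tB" for a a' c
    proof -
      note cb = closed(4)[OF c pxin[OF a(1)]]
      have "n (a \<otimes>\<^bsub>grp ?X\<^esub> a') c = n a c \<otimes>\<^bsub>grp ?X\<^esub> n a' (c \<otimes>\<^bsub>grp B\<^esub> ?px a)"
        using a c cb closed Xc pxin sxin
        by (simp add: n_def pxh X.m_assoc[simplified] B.m_assoc[simplified] X.inv_cancel)
      then have "v' \<one>\<^bsub>grp E\<^esub> (n (a \<otimes>\<^bsub>grp ?X\<^esub> a') c) = v' \<one>\<^bsub>grp E\<^esub> (n a c) \<otimes>\<^bsub>grp P'\<^esub> v' \<one>\<^bsub>grp E\<^esub> (n a' (c \<otimes>\<^bsub>grp B\<^esub> ?px a))"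
        using a c cb closed n_in n_ker \<alpha>1 by (simp add: v'_mult E.l_one[simplified])
      then show ?thesis using v'n a c cb by (simp add: G_def hmult)
    qed
    have G_sx: "G (?sx b) c = \<one>\<^bsub>grp A\<^esub>" if "b \<in> ?tB" "c \<in> ?tB" for b c
    proof -
      have "n (?sx b) c = \<one>\<^bsub>grp ?X\<^esub>"
        using that closed sxin Xc by (simp add: n_def px_sx sxh X.r_inv[simplified])
      moreover have "v' \<one>\<^bsub>grp E\<^esub> \<one>\<^bsub>grp ?X\<^esub> = \<one>\<^bsub>grp P'\<^esub>"
        using P'(10) P'.one_closed Grp_Hom_one[OF P'(5) E P'(6)] Grp_Hom_one[OF P'(5) X P'(7)] by force
      ultimately show ?thesis using Grp_Hom_one[OF P'(5) A hA] by (simp add: G_def)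
    qed
    have uR: "?u \<in> Hom \<C> ?X R"
    proof (rule restrict_Hom_Grp[OF X R g])
      fix a a' assume a: "a \<in> ?tX" "a' \<in> ?tX"
      show "g (a \<otimes>\<^bsub>grp ?X\<^esub> a') = g a \<otimes>\<^bsub>grp R\<^esub> g a'"
        by (rule coinduced_eqI) (use a closed Xc gin pxin in \<open>simp_all add: \<beta>_mult F_mult \<beta>g Fg G_mult pxh\<close>)
    qed
    have g_sx: "g (?sx b) = sec b" if b: "b \<in> ?tB" for b
      by (rule coinduced_eqI) (use b sxin gin sec_in in \<open>simp_all add: \<beta>g Fg \<beta>_sec F_sec G_sx px_sx\<close>)
    have u: "?u \<in> Hom (Pt \<C> B) x coind"
    proof -
      have "Comp \<C> ?X R B (restrict \<beta> ?tR) ?u = ?px"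
        using Grp_Hom_Top[OF X B px] gin by (intro extensionalityI[of _ ?tX]) (simp_all add: Comp_Grp Hom_Top \<beta>g)
      moreover have "Comp \<C> B ?X R ?u ?sx = restrict sec ?tB"
        using sxin g_sx by (simp add: Comp_Grp restrict_eq_iff)
      ultimately show ?thesis using uR by (simp add: Pt_simps coind_simps)
    qed
    \<comment> \<open>Evaluation of the composite of the counit with a pulled back arrow.\<close>
    have eval: "Comp (Pt \<C> E) (reindex_ob \<C> E B \<alpha> x) (reindex_ob \<C> E B \<alpha> coind) y \<epsilon> (reindex_ar \<C> E B \<alpha> x coind k) =
        restrict (\<lambda>w. F (k (q' w)) \<one>\<^bsub>grp B\<^esub> \<otimes>\<^bsub>grp A\<^esub> \<sigma> (p' w)) (topspace (gob P'))"
      if k: "k \<in> Hom (Pt \<C> B) x coind" for k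
    proof -
      note r = reindex_ar_char[OF Grp_category ob \<alpha> x coind_point k P'(1,2) P(1,2)]
      let ?r = "reindex_ar \<C> E B \<alpha> x coind k"
      have "?r w \<in> topspace (gob P)" "p (?r w) = p' w" "q (?r w) = k (q' w)" if "w \<in> topspace (gob P')" for w
        using Grp_Hom_in[OF P'(5) P(5) r(1) that] fun_cong[OF r(2), of w] fun_cong[OF r(3), of w] that
        by (simp_all add: Comp_Grp)
      then show ?thesis
        by (simp add: Pt_simps P(3) P'(3) Comp_Grp restrict_eq_iff \<epsilon>_def)
    qed
    show "\<exists>!u. u \<in> Hom (Pt \<C> B) x coind \<and>
      Comp (Pt \<C> E) (reindex_ob \<C> E B \<alpha> x) (reindex_ob \<C> E B \<alpha> coind) y \<epsilon> (reindex_ar \<C> E B \<alpha> x coind u) = h"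
    proof (rule ex1I[of _ ?u], intro conjI)
      show "?u \<in> Hom (Pt \<C> B) x coind" by (rule u)
      have "F (g (q' w)) \<one>\<^bsub>grp B\<^esub> \<otimes>\<^bsub>grp A\<^esub> \<sigma> (p' w) = h w" if w: "w \<in> topspace (gob P')" for w
      proof -
        note pq = p'in[OF w] q'in[OF w]
        have sq: "\<alpha> (p' w) = ?px (q' w)" using P'(10) w by blast
        have "n (q' w) \<one>\<^bsub>grp B\<^esub> \<otimes>\<^bsub>grp ?X\<^esub> ?sx (\<alpha> (p' w)) = q' w"
          using n_sx[OF pq(2) closed(5)] pq pxin by (simp add: sq sxh B.l_one[simplified] X.l_one[simplified])
        then have "v' \<one>\<^bsub>grp E\<^esub> (n (q' w) \<one>\<^bsub>grp B\<^esub>) \<otimes>\<^bsub>grp P'\<^esub> v' (p' w) (?sx (\<alpha> (p' w))) = w"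
          using pq closed n_in n_ker \<alpha>1 sxin pxin \<alpha>in px_sx P'(10) w by (simp add: v'_mult E.l_one[simplified])
        then have "h w = h (v' \<one>\<^bsub>grp E\<^esub> (n (q' w) \<one>\<^bsub>grp B\<^esub>)) \<otimes>\<^bsub>grp A\<^esub> h (v' (p' w) (?sx (\<alpha> (p' w))))"
          using hmult[OF v'n(1)[OF pq(2) closed(5)] v'(1)[OF pq(1) sxin[OF \<alpha>in[OF pq(1)]]]] px_sx \<alpha>in pq
          by simp
        then show ?thesis using pq closed by (simp add: Fg G_def hs')
      qed
      then show "Comp (Pt \<C> E) (reindex_ob \<C> E B \<alpha> x) (reindex_ob \<C> E B \<alpha> coind) y \<epsilon> (reindex_ar \<C> E B \<alpha> x coind ?u) = h"
        unfolding eval[OF u] using Grp_Hom_Top[OF P'(5) A hA] q'in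
        by (intro extensionalityI[of _ "topspace (gob P')"]) (simp_all add: Hom_Top)
    next
      fix k assume "k \<in> Hom (Pt \<C> B) x coind \<and>
        Comp (Pt \<C> E) (reindex_ob \<C> E B \<alpha> x) (reindex_ob \<C> E B \<alpha> coind) y \<epsilon> (reindex_ar \<C> E B \<alpha> x coind k) = h"
      then have k: "k \<in> Hom (Pt \<C> B) x coind"
        and kh: "restrict (\<lambda>w. F (k (q' w)) \<one>\<^bsub>grp B\<^esub> \<otimes>\<^bsub>grp A\<^esub> \<sigma> (p' w)) (topspace (gob P')) = h"
        using eval by auto
      have kR: "k \<in> Hom \<C> ?X R" and \<beta>k: "Comp \<C> ?X R B (restrict \<beta> ?tR) k = ?px"
        and ksx: "Comp \<C> B ?X R k ?sx = restrict sec ?tB" using k by (simp_all add: Pt_simps coind_simps)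
      note kin = Grp_Hom_in[OF X R kR]
      have \<beta>k': "\<beta> (k a) = ?px a" if "a \<in> ?tX" for a using fun_cong[OF \<beta>k, of a] that kin by (simp add: Comp_Grp)
      have ksx': "k (?sx b) = sec b" if "b \<in> ?tB" for b using fun_cong[OF ksx, of b] that by (simp add: Comp_Grp)
      have "F (k a) c = G a c" if a: "a \<in> ?tX" and c: "c \<in> ?tB" for a c
      proof -
        note cb = closed(4)[OF c pxin[OF a]]
        let ?w = "v' \<one>\<^bsub>grp E\<^esub> (n a c)"
        have "G a c = F (k (n a c)) \<one>\<^bsub>grp B\<^esub> \<otimes>\<^bsub>grp A\<^esub> \<sigma> \<one>\<^bsub>grp E\<^esub>"
          using fun_cong[OF kh, of ?w] v'n[OF a c] by (simp add: G_def)
        also have "\<dots> = F (k (n a c)) \<one>\<^bsub>grp B\<^esub>"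
          using F_in[OF kin[OF n_in[OF a c]] closed(5)] by (simp add: Grp_Hom_one[OF E A \<sigma>] A.r_one[simplified])
        also have "\<dots> = F (k (n a c) \<otimes>\<^bsub>grp R\<^esub> sec (c \<otimes>\<^bsub>grp B\<^esub> ?px a)) \<one>\<^bsub>grp B\<^esub>"
          using F_one[OF kin[OF n_in[OF a c]] cb] by simp
        also have "k (n a c) \<otimes>\<^bsub>grp R\<^esub> sec (c \<otimes>\<^bsub>grp B\<^esub> ?px a) = k (n a c \<otimes>\<^bsub>grp ?X\<^esub> ?sx (c \<otimes>\<^bsub>grp B\<^esub> ?px a))"
          using Grp_Hom_mult[OF X R kR n_in[OF a c] sxin[OF cb]] ksx'[OF cb] by simp
        also have "\<dots> = sec c \<otimes>\<^bsub>grp R\<^esub> k a"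
          using n_sx[OF a c] Grp_Hom_mult[OF X R kR sxin[OF c] a] ksx'[OF c] by simp
        also have "F (sec c \<otimes>\<^bsub>grp R\<^esub> k a) \<one>\<^bsub>grp B\<^esub> = F (k a) c" by (rule F_shift[OF kin[OF a] c])
        finally show ?thesis by simp
      qed
      then have "k a = g a" if "a \<in> ?tX" for a
        by (intro coinduced_eqI[OF kin[OF that] gin[OF that]]) (simp_all add: \<beta>k' \<beta>g Fg that)
      then show "k = ?u"
        by (intro Hom_Top_eqI[OF Grp_Hom_Top[OF X R kR] Grp_Hom_Top[OF X R uR]]) simp
    qed
  qed
qed

end

theorem (in convenient_class) Grp_LACC: "LACC (Grp (Top T))"
  unfolding LACC_def
proof (intro conjI ballI)
  fix E B \<alpha> x assume "E \<in> Ob (Grp (Top T))" "B \<in> Ob (Grp (Top T))" "\<alpha> \<in> Hom (Grp (Top T)) E B" "x \<in> Ob (Pt (Grp (Top T)) B)"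
  then show "\<exists>t. is_pullback (Grp (Top T)) E (ptot x) B \<alpha> (pproj x) t" by (rule group_pullback_exists)
next
  fix E B \<alpha> assume E: "E \<in> Ob (Grp (Top T))" and B: "B \<in> Ob (Grp (Top T))" and \<alpha>: "\<alpha> \<in> Hom (Grp (Top T)) E B"
  show "has_right_adjoint (Pt (Grp (Top T)) B) (Pt (Grp (Top T)) E)
     (reindex_ob (Grp (Top T)) E B \<alpha>) (reindex_ar (Grp (Top T)) E B \<alpha>)"
  proof (rule right_adjoint_if_cofree_objects[OF Pt_category[OF Grp_category B] Pt_category[OF Grp_category E]
        reindex_functor[OF Grp_category E B \<alpha> group_pullback_exists[OF E B \<alpha>]]])
    fix y assume y: "y \<in> Ob (Pt (Grp (Top T)) E)"
    from coinduced_exists[OF _ _ \<alpha> y] E B obtain R F \<beta> where "coinduced T E B \<alpha> y R F \<beta>"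
      by (auto simp: Ob_Grp)
    then interpret coinduced T E B \<alpha> y R F \<beta> .
    show "\<exists>R\<in>Ob (Pt \<C> B). \<exists>\<epsilon>\<in>Hom (Pt \<C> E) (reindex_ob \<C> E B \<alpha> R) y. \<forall>a\<in>Ob (Pt \<C> B). \<forall>h\<in>Hom (Pt \<C> E) (reindex_ob \<C> E B \<alpha> a) y.
      \<exists>!u. u \<in> Hom (Pt \<C> B) a R \<and> Comp (Pt \<C> E) (reindex_ob \<C> E B \<alpha> a) (reindex_ob \<C> E B \<alpha> R) y \<epsilon> (reindex_ar \<C> E B \<alpha> a R u) = h"
      by (rule bexI[where x = coind]) (rule coind_cofree, rule coind_point)
  qed
qed

section \<open>Small sets\<close>

text \<open>Products and function spaces of small sets live on other types and have to be encoded by small sets of the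
  universe. A universe is closed under this: pairs are encoded using infinity and regularity, functions by their
  graphs using that power sets of small sets are small.\<close>

locale universe =
  fixes u :: "'u itself"
  assumes universe: "universe_type TYPE('u)"
begin

lemma infinite_UNIV_u: "infinite (UNIV :: 'u set)"
  using universe by (simp add: universe_type_def)

lemma small_lepoll: "A \<lesssim> B \<Longrightarrow> small (B :: 'u set) \<Longrightarrow> small (A :: 'u set)"
  unfolding small_def by (rule lesspoll_trans1)

lemma small_subset: "small (B :: 'u set) \<Longrightarrow> A \<subseteq> B \<Longrightarrow> small A"
  by (rule small_lepoll[OF subset_imp_lepoll])

lemma small_image: "small (A :: 'u set) \<Longrightarrow> small (f ` A :: 'u set)"
  by (rule small_lepoll[OF image_lepoll])

lemma small_finite: "finite (A :: 'u set) \<Longrightarrow> small A"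
  unfolding small_def by (rule finite_lesspoll_infinite[OF infinite_UNIV_u])

lemma small_UN:
  assumes "small (I :: 'u set)" "\<And>i. i \<in> I \<Longrightarrow> small (F i :: 'u set)"
  shows "small (\<Union>i\<in>I. F i)"
proof -
  have "\<forall>(I :: 'u set) (F :: 'u \<Rightarrow> 'u set). small I \<and> (\<forall>i\<in>I. small (F i)) \<longrightarrow> small (\<Union>i\<in>I. F i)"
    using universe unfolding universe_type_def by (elim conjE)
  from this[rule_format, of I F] show ?thesis using assms by simp
qed

lemma small_Pow: "small (A :: 'u set) \<Longrightarrow> Pow A \<prec> (UNIV :: 'u set)"
  using universe unfolding universe_type_def by (elim conjE) simp

lemma encode_pairs:
  obtains j :: "'u \<times> 'u \<Rightarrow> 'u" where "inj j" "\<And>A B. small A \<Longrightarrow> small B \<Longrightarrow> small (j ` (A \<times> B))"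
proof -
  obtain j :: "'u \<times> 'u \<Rightarrow> 'u" where j: "bij_betw j (UNIV \<times> UNIV) UNIV"
    using card_of_Times_same_infinite[OF infinite_UNIV_u] unfolding card_of_ordIso[symmetric] by blast
  have small: "small (j ` (A \<times> B))" if A: "small A" and B: "small B" for A B
  proof -
    have "small (\<Union>a\<in>A. (\<lambda>b. j (a, b)) ` B)"
      by (intro small_UN A small_image B)
    moreover have "(\<Union>a\<in>A. (\<lambda>b. j (a, b)) ` B) = j ` (A \<times> B)" by auto
    ultimately show ?thesis by simp
  qed
  have "inj j" using j by (simp add: bij_betw_def)
  from that[OF this small] show thesis .
qed

lemma encode_functions:
  assumes "small (A :: 'u set)" "small (B :: 'u set)"
  obtains e :: "('u \<Rightarrow> 'u) \<Rightarrow> 'u" where "inj_on e (A \<rightarrow>\<^sub>E B)" "small (e ` (A \<rightarrow>\<^sub>E B))"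
proof -
  obtain j :: "'u \<times> 'u \<Rightarrow> 'u" where j: "inj j" "\<And>A B. small A \<Longrightarrow> small B \<Longrightarrow> small (j ` (A \<times> B))" using encode_pairs by blast
  define S where "S = j ` (A \<times> B)"
  have Pow: "Pow S \<prec> (UNIV :: 'u set)"
    using j(2)[OF assms] unfolding S_def by (rule small_Pow)
  then obtain i :: "'u set \<Rightarrow> 'u" where i: "inj_on i (Pow S)"
    using lesspoll_imp_lepoll[OF Pow] unfolding lepoll_def by blast
  define graph where "graph f = (\<lambda>x. j (x, f x)) ` A" for f :: "'u \<Rightarrow> 'u"
  have graph: "graph f \<in> Pow S" if "f \<in> A \<rightarrow>\<^sub>E B" for f using that by (auto simp: graph_def S_def PiE_iff)
  have "inj_on graph (A \<rightarrow>\<^sub>E B)"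
  proof (rule inj_onI)
    fix f g assume f: "f \<in> A \<rightarrow>\<^sub>E B" and g: "g \<in> A \<rightarrow>\<^sub>E B" and eq: "graph f = graph g"
    have "f x = g x" if "x \<in> A" for x
    proof -
      have "j (x, f x) \<in> graph g" using that eq[symmetric] by (auto simp: graph_def)
      then show ?thesis using injD[OF j(1)] by (auto simp: graph_def)
    qed
    then show "f = g" using f g by (intro extensionalityI[of _ A]) (auto simp: PiE_def)
  qed
  then have "inj_on (i \<circ> graph) (A \<rightarrow>\<^sub>E B)"
    using graph by (intro comp_inj_on inj_on_subset[OF i]) auto
  moreover have "(i \<circ> graph) ` (A \<rightarrow>\<^sub>E B) \<subseteq> i ` Pow S" using graph by auto
  then have "(i \<circ> graph) ` (A \<rightarrow>\<^sub>E B) \<lesssim> Pow S"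
    by (intro lepoll_trans[OF subset_imp_lepoll image_lepoll])
  then have "small ((i \<circ> graph) ` (A \<rightarrow>\<^sub>E B))" unfolding small_def using Pow by (rule lesspoll_trans1)
  ultimately show thesis by (rule that)
qed

end

definition transfer_topology :: "('b \<Rightarrow> 'c) \<Rightarrow> 'b topology \<Rightarrow> 'c topology" where
  "transfer_topology j Z = pullback_topology (j ` topspace Z) (inv_into (topspace Z) j) Z"

lemma transfer_topology:
  assumes "inj_on j (topspace Z)"
  shows topspace_transfer: "topspace (transfer_topology j Z) = j ` topspace Z"
    and transfer_continuous: "continuous_map Z (transfer_topology j Z) j"
    and transfer_inv_continuous: "continuous_map (transfer_topology j Z) Z (inv_into (topspace Z) j)"
    and transfer_homeomorphic: "Z homeomorphic_space transfer_topology j Z"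
proof -
  let ?i = "inv_into (topspace Z) j"
  show ts: "topspace (transfer_topology j Z) = j ` topspace Z"
    using assms by (auto simp: transfer_topology_def topspace_pullback_topology)
  have "continuous_map Z Z (?i \<circ> j)"
    using assms by (intro continuous_map_eq[OF continuous_map_id]) simp
  then show c: "continuous_map Z (transfer_topology j Z) j"
    unfolding transfer_topology_def by (rule continuous_map_pullback') auto
  show c': "continuous_map (transfer_topology j Z) Z ?i"
    using continuous_map_pullback[OF continuous_map_id, of "j ` topspace Z" ?i Z] by (simp add: transfer_topology_def)
  have "homeomorphic_maps Z (transfer_topology j Z) j ?i"
    unfolding homeomorphic_maps_def using c c' assms ts by (auto simp: f_inv_into_f)
  then show "Z homeomorphic_space transfer_topology j Z" unfolding homeomorphic_space_def by blast
qed

section \<open>Compactly generated topologies\<close>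

text \<open>The coarsest compactly generated refinement of a topology: the open sets are those whose preimages
  under all probes are open, a probe being a continuous map from a small compact Hausdorff space.\<close>

definition k_ification :: "'u topology \<Rightarrow> 'u topology" where
  "k_ification X = topology (\<lambda>U. U \<subseteq> topspace X \<and>
     (\<forall>(K :: 'u topology) f. compact_Hausdorff K \<and> continuous_map K X f \<longrightarrow> openin K {k \<in> topspace K. f k \<in> U}))"

lemma openin_k_ification:
  "openin (k_ification X) U \<longleftrightarrow> U \<subseteq> topspace X \<and>
     (\<forall>(K :: 'u topology) f. compact_Hausdorff K \<and> continuous_map K X f \<longrightarrow> openin K {k \<in> topspace K. f k \<in> U})"
  for X :: "'u topology"
proof -
  have "istopology (\<lambda>U. U \<subseteq> topspace X \<and>
     (\<forall>(K :: 'u topology) f. compact_Hausdorff K \<and> continuous_map K X f \<longrightarrow> openin K {k \<in> topspace K. f k \<in> U}))"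
    unfolding istopology_def
  proof (intro conjI allI impI)
    fix U V and K :: "'u topology" and f
    assume U: "U \<subseteq> topspace X \<and> (\<forall>(K :: 'u topology) f. compact_Hausdorff K \<and> continuous_map K X f \<longrightarrow> openin K {k \<in> topspace K. f k \<in> U})"
      and V: "V \<subseteq> topspace X \<and> (\<forall>(K :: 'u topology) f. compact_Hausdorff K \<and> continuous_map K X f \<longrightarrow> openin K {k \<in> topspace K. f k \<in> V})"
      and K: "compact_Hausdorff K \<and> continuous_map K X f"
    have "openin K ({k \<in> topspace K. f k \<in> U} \<inter> {k \<in> topspace K. f k \<in> V})" using U V K by blast
    moreover have "{k \<in> topspace K. f k \<in> U} \<inter> {k \<in> topspace K. f k \<in> V} = {k \<in> topspace K. f k \<in> U \<inter> V}" by auto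
    ultimately show "openin K {k \<in> topspace K. f k \<in> U \<inter> V}" by simp
  next
    fix \<U> and K :: "'u topology" and f
    assume U: "\<forall>U\<in>\<U>. U \<subseteq> topspace X \<and> (\<forall>(K :: 'u topology) f. compact_Hausdorff K \<and> continuous_map K X f \<longrightarrow> openin K {k \<in> topspace K. f k \<in> U})"
      and K: "compact_Hausdorff K \<and> continuous_map K X f"
    have "openin K (\<Union>U\<in>\<U>. {k \<in> topspace K. f k \<in> U})" using U K by blast
    moreover have "(\<Union>U\<in>\<U>. {k \<in> topspace K. f k \<in> U}) = {k \<in> topspace K. f k \<in> \<Union>\<U>}" by auto
    ultimately show "openin K {k \<in> topspace K. f k \<in> \<Union>\<U>}" by simp
  qed auto
  then show ?thesis unfolding k_ification_def by (simp add: topology_inverse')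
qed

lemma openin_imp_openin_k_ification: "openin X U \<Longrightarrow> openin (k_ification X) U"
  unfolding openin_k_ification by (auto simp: continuous_map_def openin_subset)

lemma topspace_k_ification [simp]: "topspace (k_ification X) = topspace X"
proof (rule antisym)
  show "topspace (k_ification X) \<subseteq> topspace X"
    using openin_topspace[of "k_ification X"] unfolding openin_k_ification by (rule conjunct1)
  show "topspace X \<subseteq> topspace (k_ification X)"
    by (rule openin_subset[OF openin_imp_openin_k_ification[OF openin_topspace]])
qed

lemma k_ification_continuous: "continuous_map X Y f \<Longrightarrow> continuous_map (k_ification X) Y f"
  by (auto simp: continuous_map_def openin_imp_openin_k_ification)

lemma k_ification_probe:
  "compact_Hausdorff (K :: 'u topology) \<Longrightarrow> continuous_map K X f \<Longrightarrow> continuous_map K (k_ification X) f"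
  for X :: "'u topology"
  by (auto simp: continuous_map_def openin_k_ification)

lemma k_ification_compactly_generated: "compactly_generated (k_ification X)" for X :: "'u topology"
  unfolding compactly_generated_def
proof (intro allI impI)
  fix A assume A: "A \<subseteq> topspace (k_ification X) \<and>
        (\<forall>(K :: 'u topology) f. compact_Hausdorff K \<and> continuous_map K (k_ification X) f \<longrightarrow>
           closedin K {k \<in> topspace K. f k \<in> A})"
  have "openin K {k \<in> topspace K. f k \<in> topspace X - A}"
    if K: "compact_Hausdorff K" and f: "continuous_map K X f" for K :: "'u topology" and f
  proof -
    have "closedin K {k \<in> topspace K. f k \<in> A}" using A K k_ification_probe[OF K f] by blast
    moreover have "{k \<in> topspace K. f k \<in> topspace X - A} = topspace K - {k \<in> topspace K. f k \<in> A}"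
      using continuous_map_in[OF f] by auto
    ultimately show ?thesis by auto
  qed
  then show "closedin (k_ification X) A" using A by (simp add: closedin_def openin_k_ification)
qed

lemma compactly_generatedD:
  assumes "compactly_generated (X :: 'u topology)" "A \<subseteq> topspace X"
    and "\<And>(K :: 'u topology) f. compact_Hausdorff K \<Longrightarrow> continuous_map K X f \<Longrightarrow> closedin K {k \<in> topspace K. f k \<in> A}"
  shows "closedin X A"
  by (rule assms(1)[unfolded compactly_generated_def, THEN spec, THEN mp], intro conjI allI impI assms(2), elim conjE)
    (rule assms(3))

lemma compactly_generated_continuous:
  assumes X: "compactly_generated (X :: 'u topology)" and f: "\<And>x. x \<in> topspace X \<Longrightarrow> f x \<in> topspace Y"
    and probe: "\<And>(K :: 'u topology) k. compact_Hausdorff K \<Longrightarrow> continuous_map K X k \<Longrightarrow> continuous_map K Y (\<lambda>t. f (k t))"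
  shows "continuous_map X Y f"
  unfolding continuous_map_closedin
proof (intro conjI allI impI)
  fix C assume C: "closedin Y C"
  have "closedin K {t \<in> topspace K. k t \<in> {x \<in> topspace X. f x \<in> C}}"
    if K: "compact_Hausdorff K" and k: "continuous_map K X k" for K :: "'u topology" and k
  proof -
    have "{t \<in> topspace K. k t \<in> {x \<in> topspace X. f x \<in> C}} = {t \<in> topspace K. f (k t) \<in> C}"
      using continuous_map_in[OF k] by auto
    then show ?thesis using probe[OF K k] C by (simp add: continuous_map_closedin)
  qed
  then show "closedin X {x \<in> topspace X. f x \<in> C}" by (intro compactly_generatedD[OF X]) auto
qed (use f in auto)

lemma continuous_k_ification:
  fixes Y :: "'u topology"
  assumes X: "compactly_generated (X :: 'u topology)" and f: "continuous_map X Y f"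
  shows "continuous_map X (k_ification Y) f"
proof (rule compactly_generated_continuous[OF X])
  show "continuous_map K (k_ification Y) (\<lambda>t. f (k t))"
    if "compact_Hausdorff K" "continuous_map K X k" for K :: "'u topology" and k
    by (rule k_ification_probe[OF that(1) continuous_map_comp[OF that(2) f]])
qed (simp add: continuous_map_in[OF f])

section \<open>Weakly Hausdorff topologies\<close>

context universe
begin

lemma compact_Hausdorff_point: "compact_Hausdorff (discrete_topology {a :: 'u})"
  by (simp add: compact_Hausdorff_def compact_space_discrete_topology small_finite)

lemma compact_Hausdorff_closed_subspace:
  "compact_Hausdorff (K :: 'u topology) \<Longrightarrow> closedin K C \<Longrightarrow> compact_Hausdorff (subtopology K C)"
  unfolding compact_Hausdorff_def
  by (auto intro: small_subset compact_space_subtopology closedin_compact_space Hausdorff_space_subtopology)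

lemma weakly_Hausdorff_closed_points:
  assumes "weakly_Hausdorff (X :: 'u topology)" "x \<in> topspace X"
  shows "closedin X {x}"
proof -
  have "closedin X ((\<lambda>_. x) ` topspace (discrete_topology {x}))"
    using assms compact_Hausdorff_point[of x] unfolding weakly_Hausdorff_def
    by (metis continuous_map_const)
  then show ?thesis by simp
qed

text \<open>The image of a probe is a Hausdorff subspace, being the image of a normal space under a closed map
  and having closed points.\<close>

lemma Hausdorff_probe_image:
  assumes X: "weakly_Hausdorff (X :: 'u topology)" and K: "compact_Hausdorff (K :: 'u topology)" and f: "continuous_map K X f"
  shows "Hausdorff_space (subtopology X (f ` topspace K))"
proof (rule Hausdorff_normal_space_closed_continuous_map_image)
  let ?W = "subtopology X (f ` topspace K)"
  show "normal_space K" using K by (simp add: compact_Hausdorff_def compact_Hausdorff_or_regular_imp_normal_space)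
  show "continuous_map K ?W f" using f by (simp add: continuous_map_in_subtopology)
  show "f ` topspace K = topspace ?W" using continuous_map_in[OF f] by auto
  show "closed_map K ?W f"
    unfolding closed_map_def
  proof (intro allI impI)
    fix C assume C: "closedin K C"
    have "C \<subseteq> topspace K" using C by (rule closedin_subset)
    moreover have "closedin X (f ` topspace (subtopology K C))"
      using X compact_Hausdorff_closed_subspace[OF K C] continuous_map_from_subtopology[OF f] unfolding weakly_Hausdorff_def by blast
    ultimately have "closedin X (f ` C)" "f ` C \<subseteq> f ` topspace K" by (auto simp: inf.absorb2)
    then show "closedin ?W (f ` C)" by (intro closedin_subset_topspace)
  qed
  show "t1_space ?W"
    unfolding t1_space_closedin_singleton
    using weakly_Hausdorff_closed_points[OF X] by (auto intro: closedin_subset_topspace)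
qed

text \<open>Restricting the second probe to the preimage of the image of the first, the two maps take values in a
  common Hausdorff space, where the set of coincidences is closed.\<close>

lemma closedin_agreement_set:
  assumes X: "weakly_Hausdorff (X :: 'u topology)"
    and K: "compact_Hausdorff (K :: 'u topology)" and f: "continuous_map K X f"
    and L: "compact_Hausdorff (L :: 'u topology)" and g: "continuous_map L X g"
  shows "closedin (prod_topology K L) {z \<in> topspace K \<times> topspace L. f (fst z) = g (snd z)}"
proof -
  let ?D = "f ` topspace K"
  let ?L = "{l \<in> topspace L. g l \<in> ?D}"
  let ?W = "subtopology X ?D"
  have "closedin X ?D" using X K f unfolding weakly_Hausdorff_def by blast
  then have L': "closedin L ?L" using g by (simp add: continuous_map_closedin)
  have P: "closedin (prod_topology K L) (topspace K \<times> ?L)" using L' by (simp add: closedin_prod_Times_iff)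
  let ?P = "prod_topology K (subtopology L ?L)"
  have "continuous_map ?P ?W (\<lambda>z. f (fst z))"
    by (rule continuous_map_comp[OF continuous_map_fst]) (use f in \<open>simp add: continuous_map_in_subtopology\<close>)
  moreover have "continuous_map ?P ?W (\<lambda>z. g (snd z))"
    by (rule continuous_map_comp[OF continuous_map_snd])
      (use continuous_map_from_subtopology[OF g] in \<open>auto simp: continuous_map_in_subtopology\<close>)
  ultimately have "closedin ?P {z \<in> topspace ?P. f (fst z) = g (snd z)}"
    by (intro closedin_continuous_maps_eq[OF Hausdorff_probe_image[OF X K f]])
  moreover have "{z \<in> topspace ?P. f (fst z) = g (snd z)} = {z \<in> topspace K \<times> topspace L. f (fst z) = g (snd z)}"
    by (force simp: inf.absorb2)
  ultimately show ?thesis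
    unfolding prod_topology_subtopology using P by (auto intro: closedin_trans_full)
qed

text \<open>Two probes of the refined topology agree on the intersection of the closed sets on which their
  composites with the separating maps agree; projecting along a compact factor shows that the points of one
  probe that lie in the image of the other form a closed set.\<close>

lemma weakly_Hausdorff_k_ification:
  fixes Z :: "'u topology"
  assumes sep: "\<And>x y. x \<in> topspace Z \<Longrightarrow> y \<in> topspace Z \<Longrightarrow> x \<noteq> y \<Longrightarrow>
    \<exists>(X :: 'u topology) h. weakly_Hausdorff X \<and> continuous_map Z X h \<and> h x \<noteq> h y"
  shows "weakly_Hausdorff (k_ification Z)"
  unfolding weakly_Hausdorff_def
proof (intro allI impI)
  fix K :: "'u topology" and f assume "compact_Hausdorff K \<and> continuous_map K (k_ification Z) f"
  then have K: "compact_Hausdorff K" and "continuous_map K (k_ification Z) f" by auto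
  then have f: "continuous_map K Z f"
    using continuous_map_comp[OF _ k_ification_continuous[OF continuous_map_id]] by fastforce
  have "closedin L {l \<in> topspace L. g l \<in> f ` topspace K}"
    if L: "compact_Hausdorff L" and g: "continuous_map L Z g" for L :: "'u topology" and g
  proof -
    let ?P = "prod_topology K L"
    let ?F = "{(X :: 'u topology, h). weakly_Hausdorff X \<and> continuous_map Z X h}"
    let ?eq = "\<lambda>(X :: 'u topology, h). {z \<in> topspace K \<times> topspace L. (h (f (fst z)) :: 'u) = h (g (snd z))}"
    let ?R = "{z \<in> topspace K \<times> topspace L. f (fst z) = g (snd z)}"
    have "openin ?P (\<Union>p\<in>?F. topspace ?P - ?eq p)"
    proof (intro openin_Union ballI, clarsimp)
      fix X :: "'u topology" and h assume "weakly_Hausdorff X" "continuous_map Z X h"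
      then have "closedin ?P {z \<in> topspace K \<times> topspace L. h (f (fst z)) = h (g (snd z))}"
        by (intro closedin_agreement_set[OF _ K _ L] continuous_map_comp[OF f] continuous_map_comp[OF g])
      then show "openin ?P (topspace K \<times> topspace L - {z \<in> topspace K \<times> topspace L. h (f (fst z)) = h (g (snd z))})"
        by (simp add: closedin_def)
    qed
    moreover have "(\<Union>p\<in>?F. topspace ?P - ?eq p) = topspace ?P - ?R"
    proof (intro equalityI subsetI)
      fix z assume z: "z \<in> topspace ?P - ?R"
      then have "f (fst z) \<in> topspace Z" "g (snd z) \<in> topspace Z" "f (fst z) \<noteq> g (snd z)"
        using continuous_map_in[OF f] continuous_map_in[OF g] by auto
      from sep[OF this] obtain X :: "'u topology" and h where "weakly_Hausdorff X" "continuous_map Z X h" "h (f (fst z)) \<noteq> h (g (snd z))" by blast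
      then show "z \<in> (\<Union>p\<in>?F. topspace ?P - ?eq p)" using z by (intro UN_I[of "(X, h)"]) auto
    qed auto
    ultimately have "closedin ?P ?R" by (auto simp: closedin_def)
    moreover have "closed_map ?P L snd"
      using K by (intro Abstract_Topological_Spaces.closed_map_snd) (simp add: compact_Hausdorff_def)
    ultimately have "closedin L (snd ` ?R)" by (simp add: closed_map_def)
    moreover have "snd ` ?R = {l \<in> topspace L. g l \<in> f ` topspace K}" by force
    ultimately show ?thesis by simp
  qed
  then have "openin L {l \<in> topspace L. g l \<in> topspace Z - f ` topspace K}"
    if "compact_Hausdorff L" "continuous_map L Z g" for L :: "'u topology" and g
  proof -
    have "{l \<in> topspace L. g l \<in> topspace Z - f ` topspace K} = topspace L - {l \<in> topspace L. g l \<in> f ` topspace K}"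
      using continuous_map_in[OF that(2)] by auto
    then show ?thesis using \<open>\<And>L g. compact_Hausdorff L \<Longrightarrow> continuous_map L Z g \<Longrightarrow> closedin L {l \<in> topspace L. g l \<in> f ` topspace K}\<close>[OF that]
      by auto
  qed
  then show "closedin (k_ification Z) (f ` topspace K)"
    using continuous_map_in[OF f] by (auto simp: closedin_def openin_k_ification)
qed

lemma k_ification_CGWH:
  fixes Z :: "'u topology"
  assumes "small (topspace Z)" "\<And>x y. x \<in> topspace Z \<Longrightarrow> y \<in> topspace Z \<Longrightarrow> x \<noteq> y \<Longrightarrow>
    \<exists>(X :: 'u topology) h. weakly_Hausdorff X \<and> continuous_map Z X h \<and> h x \<noteq> h y"
  shows "k_ification Z \<in> CGWH"
  using assms weakly_Hausdorff_k_ification[of Z] by (simp add: CGWH_def k_ification_compactly_generated)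

lemma compact_Hausdorff_CGWH:
  assumes K: "compact_Hausdorff (K :: 'u topology)"
  shows "K \<in> CGWH"
proof -
  have "closedin K A" if A: "A \<subseteq> topspace K"
    "\<forall>(L :: 'u topology) f. compact_Hausdorff L \<and> continuous_map L K f \<longrightarrow> closedin L {k \<in> topspace L. f k \<in> A}" for A
  proof -
    have "closedin K {k \<in> topspace K. id k \<in> A}" using A(2) K continuous_map_id by blast
    moreover have "{k \<in> topspace K. id k \<in> A} = A" using A(1) by auto
    ultimately show ?thesis by simp
  qed
  moreover have "closedin K (f ` topspace L)" if "compact_Hausdorff L" "continuous_map L K f" for L :: "'u topology" and f
  proof (rule compactin_imp_closedin)
    show "compactin K (f ` topspace L)"
      using that by (intro image_compactin[OF _ that(2)]) (simp add: compact_Hausdorff_def compact_space_def)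
  qed (use K in \<open>simp add: compact_Hausdorff_def\<close>)
  ultimately show ?thesis
    using K by (auto simp: CGWH_def compact_Hausdorff_def compactly_generated_def weakly_Hausdorff_def)
qed

section \<open>Products, subspaces and exponentials of compactly generated weakly Hausdorff spaces\<close>

lemma CGWH_compactly_generated: "X \<in> CGWH \<Longrightarrow> compactly_generated (X :: 'u topology)"
  and CGWH_weakly_Hausdorff: "X \<in> CGWH \<Longrightarrow> weakly_Hausdorff (X :: 'u topology)"
  and CGWH_small: "X \<in> CGWH \<Longrightarrow> small (topspace (X :: 'u topology))"
  by (simp_all add: CGWH_def)

lemma compact_Hausdorff_product:
  assumes K: "compact_Hausdorff (K :: 'u topology)" and L: "compact_Hausdorff (L :: 'u topology)"
  obtains j where "inj_on j (topspace (prod_topology K L))" "compact_Hausdorff (transfer_topology j (prod_topology K L) :: 'u topology)"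
proof -
  obtain j :: "'u \<times> 'u \<Rightarrow> 'u" where j: "inj j" "\<And>A B. small A \<Longrightarrow> small B \<Longrightarrow> small (j ` (A \<times> B))" using encode_pairs by blast
  have inj: "inj_on j (topspace (prod_topology K L))" using j(1) by (rule inj_on_subset) simp
  have "compact_space (prod_topology K L)" "Hausdorff_space (prod_topology K L)"
    using K L by (simp_all add: compact_Hausdorff_def compact_space_prod_topology Hausdorff_space_prod_topology)
  then have "compact_Hausdorff (transfer_topology j (prod_topology K L))"
    using homeomorphic_compact_space[OF transfer_homeomorphic[OF inj]] homeomorphic_Hausdorff_space[OF transfer_homeomorphic[OF inj]]
      K L j(2) by (simp add: compact_Hausdorff_def topspace_transfer[OF inj])
  with inj show thesis by (rule that)
qed

text \<open>The product of topological spaces, moved to the universe and refined. Continuity of the pairing of two maps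
  survives the refinement because their domain is compactly generated.\<close>

lemma CGWH_products: "has_finite_products (Top (CGWH :: 'u topology set))"
  unfolding has_finite_products_def
proof (intro conjI ballI)
  let ?Z = "discrete_topology {undefined :: 'u}"
  have "is_terminal (Top CGWH) ?Z"
    unfolding is_terminal_def
  proof (intro conjI ballI)
    show "?Z \<in> Ob (Top CGWH)" using compact_Hausdorff_CGWH[OF compact_Hausdorff_point] by simp
    fix X :: "'u topology"
    have r: "restrict (\<lambda>_. undefined) (topspace X) \<in> Hom (Top CGWH) X ?Z" by (rule restrict_Hom_Top) simp
    show "\<exists>!h. h \<in> Hom (Top CGWH) X ?Z"
    proof (rule ex1I[of _ "restrict (\<lambda>_. undefined) (topspace X)"])
      fix h assume h: "h \<in> Hom (Top CGWH) X ?Z"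
      show "h = restrict (\<lambda>_. undefined) (topspace X)"
        using Hom_Top_in[OF h] by (intro Hom_Top_eqI[OF h r]) simp
    qed (rule r)
  qed
  then show "\<exists>Z. is_terminal (Top (CGWH :: 'u topology set)) Z" by blast
next
  fix X Y :: "'u topology" assume "X \<in> Ob (Top CGWH)" "Y \<in> Ob (Top CGWH)"
  then have X: "X \<in> CGWH" and Y: "Y \<in> CGWH" by simp_all
  obtain j :: "'u \<times> 'u \<Rightarrow> 'u" where j: "inj j" "\<And>A B. small A \<Longrightarrow> small B \<Longrightarrow> small (j ` (A \<times> B))" using encode_pairs by blast
  let ?XY = "prod_topology X Y"
  have inj: "inj_on j (topspace ?XY)" using j(1) by (rule inj_on_subset) simp
  let ?Z = "transfer_topology j ?XY"
  note tsZ = topspace_transfer[OF inj]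
  let ?P = "k_ification ?Z"
  let ?i = "inv_into (topspace ?XY) j"
  have ij: "?i (j z) = z" if "z \<in> topspace ?XY" for z using inj that by simp
  have c: "continuous_map ?Z X (\<lambda>w. fst (?i w))" "continuous_map ?Z Y (\<lambda>w. snd (?i w))"
    using continuous_map_comp[OF transfer_inv_continuous[OF inj] continuous_map_fst]
      continuous_map_comp[OF transfer_inv_continuous[OF inj] continuous_map_snd] by auto
  let ?p = "restrict (\<lambda>w. fst (?i w)) (topspace ?P)" and ?q = "restrict (\<lambda>w. snd (?i w)) (topspace ?P)"
  have P: "?P \<in> CGWH"
  proof (rule k_ification_CGWH)
    show "small (topspace ?Z)" using tsZ j(2)[OF CGWH_small[OF X] CGWH_small[OF Y]] by simp
    fix z z' assume "z \<in> topspace ?Z" "z' \<in> topspace ?Z" "z \<noteq> z'"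
    then have "?i z \<noteq> ?i z'" using tsZ by (metis inv_into_injective)
    then have "fst (?i z) \<noteq> fst (?i z') \<or> snd (?i z) \<noteq> snd (?i z')" by (auto simp: prod_eq_iff)
    then show "\<exists>(X :: 'u topology) h. weakly_Hausdorff X \<and> continuous_map ?Z X h \<and> h z \<noteq> h z'"
      using c CGWH_weakly_Hausdorff[OF X] CGWH_weakly_Hausdorff[OF Y] by blast
  qed
  have "is_product (Top CGWH) X Y (?P, ?p, ?q)"
    unfolding is_product_def prod.case
  proof (intro conjI ballI)
    show "?P \<in> Ob (Top CGWH)" using P by simp
    show "?p \<in> Hom (Top CGWH) ?P X" "?q \<in> Hom (Top CGWH) ?P Y"
      by (rule restrict_Hom_Top, rule k_ification_continuous, rule c)+
    fix W f g assume W: "W \<in> Ob (Top CGWH)" and f: "f \<in> Hom (Top CGWH) W X" and g: "g \<in> Hom (Top CGWH) W Y"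
    have fg: "f w \<in> topspace X" "g w \<in> topspace Y" if "w \<in> topspace W" for w
      using Hom_Top_in[OF f that] Hom_Top_in[OF g that] .
    have "continuous_map W ?XY (\<lambda>w. (f w, g w))" using f g by (simp add: Hom_Top continuous_map_pairedI)
    then have "continuous_map W ?P (\<lambda>w. j (f w, g w))"
      using W CGWH_compactly_generated continuous_map_comp[OF _ transfer_continuous[OF inj]]
      by (intro continuous_k_ification) auto
    then have h: "restrict (\<lambda>w. j (f w, g w)) (topspace W) \<in> Hom (Top CGWH) W ?P" by (rule restrict_Hom_Top)
    show "\<exists>!h. h \<in> Hom (Top CGWH) W ?P \<and> Comp (Top CGWH) W ?P X ?p h = f \<and> Comp (Top CGWH) W ?P Y ?q h = g"
    proof (rule ex1I[of _ "restrict (\<lambda>w. j (f w, g w)) (topspace W)"], intro conjI)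
      show "Comp (Top CGWH) W ?P X ?p (restrict (\<lambda>w. j (f w, g w)) (topspace W)) = f"
        using f fg by (intro extensionalityI[of _ "topspace W"]) (auto simp: Comp_Top Hom_Top ij[unfolded topspace_prod_topology] tsZ)
      show "Comp (Top CGWH) W ?P Y ?q (restrict (\<lambda>w. j (f w, g w)) (topspace W)) = g"
        using g fg by (intro extensionalityI[of _ "topspace W"]) (auto simp: Comp_Top Hom_Top ij[unfolded topspace_prod_topology] tsZ)
      fix k assume k: "k \<in> Hom (Top CGWH) W ?P \<and> Comp (Top CGWH) W ?P X ?p k = f \<and> Comp (Top CGWH) W ?P Y ?q k = g"
      have k': "k \<in> Hom (Top CGWH) W ?P" using k by blast
      show "k = restrict (\<lambda>w. j (f w, g w)) (topspace W)"
      proof (rule Hom_Top_eqI[OF k' h])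
        fix w assume w: "w \<in> topspace W"
        have kw: "k w \<in> j ` topspace ?XY" using Hom_Top_in[OF k' w] tsZ by simp
        have "f w = fst (?i (k w))" "g w = snd (?i (k w))"
          using k w kw tsZ by (auto simp: Comp_Top)
        then have "j (f w, g w) = j (?i (k w))" by simp
        also have "\<dots> = k w" using kw by (rule f_inv_into_f)
        finally show "k w = restrict (\<lambda>w. j (f w, g w)) (topspace W) w" using w by simp
      qed
    qed (rule h)
  qed
  then show "\<exists>t. is_product (Top CGWH) X Y t" by blast
qed

lemma CGWH_subspaces:
  assumes X: "X \<in> (CGWH :: 'u topology set)" and S: "S \<subseteq> topspace X"
  shows "\<exists>Y\<in>CGWH. topspace Y = S \<and> continuous_map Y X id \<and>
        (\<forall>Z\<in>(CGWH :: 'u topology set). \<forall>f. continuous_map Z X f \<and> f ` topspace Z \<subseteq> S \<longrightarrow> continuous_map Z Y f)"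
proof (rule bexI[of _ "k_ification (subtopology X S)"], intro conjI ballI allI impI)
  have c: "continuous_map (subtopology X S) X id" by (simp add: continuous_map_from_subtopology)
  show ts: "topspace (k_ification (subtopology X S)) = S" using S by auto
  show "continuous_map (k_ification (subtopology X S)) X id" by (rule k_ification_continuous[OF c])
  show "k_ification (subtopology X S) \<in> CGWH"
  proof (rule k_ification_CGWH)
    show "small (topspace (subtopology X S))" using CGWH_small[OF X] by (rule small_subset) simp
    fix x y :: 'u assume "x \<noteq> y"
    then show "\<exists>(X' :: 'u topology) h. weakly_Hausdorff X' \<and> continuous_map (subtopology X S) X' h \<and> h x \<noteq> h y"
      using c CGWH_weakly_Hausdorff[OF X] by (intro exI[of _ X] exI[of _ id]) simp
  qed
  fix Z f assume "Z \<in> (CGWH :: 'u topology set)" "continuous_map Z X f \<and> f ` topspace Z \<subseteq> S"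
  then show "continuous_map Z (k_ification (subtopology X S)) f"
    by (intro continuous_k_ification CGWH_compactly_generated) (auto simp: continuous_map_in_subtopology)
qed

sublocale CGWH: space_class "CGWH :: 'u topology set"
proof
  show "\<exists>X\<in>(CGWH :: 'u topology set). \<exists>x. topspace X = {x}"
    using compact_Hausdorff_CGWH[OF compact_Hausdorff_point] by (intro bexI[of _ "discrete_topology {undefined}"]) auto
  show "has_finite_products (Top (CGWH :: 'u topology set))" by (rule CGWH_products)
qed

end

text \<open>The compact-open topology, with compact sets replaced by images of probes.\<close>

definition mapping_topology :: "'u topology \<Rightarrow> 'u topology \<Rightarrow> ('u \<Rightarrow> 'u) topology" where
  "mapping_topology X Y = topology_generated_by (insert {h \<in> extensional (topspace X). continuous_map X Y h}
     {{h \<in> extensional (topspace X). continuous_map X Y h \<and> (\<forall>l\<in>topspace L. h (b l) \<in> U)} | (L :: 'u topology) b U.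
        compact_Hausdorff L \<and> continuous_map L X b \<and> openin Y U})"

lemma topspace_mapping_topology:
  "topspace (mapping_topology X Y) = {h \<in> extensional (topspace X). continuous_map X Y h}"
  unfolding mapping_topology_def topology_generated_by_topspace by auto

lemma openin_mapping_topology:
  fixes L X :: "'u topology"
  assumes "compact_Hausdorff L" "continuous_map L X b" "openin Y U"
  shows "openin (mapping_topology X Y) {h \<in> extensional (topspace X). continuous_map X Y h \<and> (\<forall>l\<in>topspace L. h (b l) \<in> U)}"
  unfolding mapping_topology_def
  by (rule topology_generated_by_Basis, rule insertI2, rule CollectI, rule exI[of _ L], rule exI[of _ b], rule exI[of _ U])
    (use assms in simp)

lemma continuous_into_mapping_topology:
  fixes X :: "'u topology"
  assumes "\<And>t. t \<in> topspace K \<Longrightarrow> \<phi> t \<in> extensional (topspace X) \<and> continuous_map X Y (\<phi> t)"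
    and "\<And>(L :: 'u topology) b U. compact_Hausdorff L \<Longrightarrow> continuous_map L X b \<Longrightarrow> openin Y U \<Longrightarrow>
      openin K {t \<in> topspace K. \<forall>l\<in>topspace L. \<phi> t (b l) \<in> U}"
  shows "continuous_map K (mapping_topology X Y) \<phi>"
  unfolding mapping_topology_def continuous_on_generated_topo_iff
proof (intro conjI allI impI)
  fix N assume N: "N \<in> insert {h \<in> extensional (topspace X). continuous_map X Y h}
     {{h \<in> extensional (topspace X). continuous_map X Y h \<and> (\<forall>l\<in>topspace L. h (b l) \<in> U)} | (L :: 'u topology) b U.
        compact_Hausdorff L \<and> continuous_map L X b \<and> openin Y U}"
  show "openin K (\<phi> -` N \<inter> topspace K)"
  proof (cases "N = {h \<in> extensional (topspace X). continuous_map X Y h}")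
    case True
    then have "\<phi> -` N \<inter> topspace K = topspace K" using assms(1) by auto
    then show ?thesis by simp
  next
    case False
    then obtain L :: "'u topology" and b U where L: "compact_Hausdorff L" "continuous_map L X b" "openin Y U"
      and N: "N = {h \<in> extensional (topspace X). continuous_map X Y h \<and> (\<forall>l\<in>topspace L. h (b l) \<in> U)}"
      using N by (elim insertE CollectE exE conjE) simp_all
    have "\<phi> -` N \<inter> topspace K = {t \<in> topspace K. \<forall>l\<in>topspace L. \<phi> t (b l) \<in> U}"
      unfolding N using assms(1) by auto
    then show ?thesis using assms(2)[OF L] by simp
  qed
qed (use assms(1) in auto)

context universe
begin

text \<open>Evaluation is continuous along probes because a compact Hausdorff space has small closed neighbourhoods,
  which are again probes.\<close>

lemma probe_evaluation:
  fixes L X Y :: "'u topology"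
  assumes L: "compact_Hausdorff L" and \<phi>: "continuous_map L (mapping_topology X Y) \<phi>" and b: "continuous_map L X b"
  shows "continuous_map L Y (\<lambda>l. \<phi> l (b l))"
proof -
  have \<phi>in: "continuous_map X Y (\<phi> l)" if "l \<in> topspace L" for l
    using continuous_map_in[OF \<phi> that] by (simp add: topspace_mapping_topology)
  have "openin L {l \<in> topspace L. \<phi> l (b l) \<in> U}" if U: "openin Y U" for U
    unfolding openin_subopen[of L "{l \<in> topspace L. \<phi> l (b l) \<in> U}"]
  proof (intro ballI)
    fix l0 assume "l0 \<in> {l \<in> topspace L. \<phi> l (b l) \<in> U}"
    then have l0: "l0 \<in> topspace L" "\<phi> l0 (b l0) \<in> U" by auto
    have "continuous_map L Y (\<lambda>l. \<phi> l0 (b l))" by (rule continuous_map_comp[OF b \<phi>in[OF l0(1)]])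
    then have V: "openin L {l \<in> topspace L. \<phi> l0 (b l) \<in> U}" using U by (simp add: continuous_map_def)
    have "neighbourhood_base_of (closedin L) L"
      using L by (simp add: compact_Hausdorff_def compact_Hausdorff_imp_regular_space neighbourhood_base_of_closedin)
    from this[unfolded neighbourhood_base_of, rule_format, OF conjI[OF V], of l0] obtain O' C where C: "openin L O'" "closedin L C" "l0 \<in> O'" "O' \<subseteq> C" "C \<subseteq> {l \<in> topspace L. \<phi> l0 (b l) \<in> U}"
      using l0 by (elim meta_impE exE conjE) simp_all
    let ?N = "{h \<in> extensional (topspace X). continuous_map X Y h \<and> (\<forall>l\<in>topspace (subtopology L C). h (b l) \<in> U)}"
    have "openin (mapping_topology X Y) ?N"
      by (rule openin_mapping_topology[OF compact_Hausdorff_closed_subspace[OF L C(2)] continuous_map_from_subtopology[OF b] U])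
    then have "openin L {l \<in> topspace L. \<phi> l \<in> ?N}" by (rule openin_continuous_map_preimage[OF \<phi>])
    then have "openin L (O' \<inter> {l \<in> topspace L. \<phi> l \<in> ?N})" using C(1) by blast
    moreover have "l0 \<in> O' \<inter> {l \<in> topspace L. \<phi> l \<in> ?N}"
      using C l0 continuous_map_in[OF \<phi> l0(1)] by (auto simp: topspace_mapping_topology)
    moreover have "O' \<inter> {l \<in> topspace L. \<phi> l \<in> ?N} \<subseteq> {l \<in> topspace L. \<phi> l (b l) \<in> U}"
      using C by auto
    ultimately show "\<exists>T. openin L T \<and> l0 \<in> T \<and> T \<subseteq> {l \<in> topspace L. \<phi> l (b l) \<in> U}" by blast
  qed
  moreover have "\<phi> l (b l) \<in> topspace Y" if "l \<in> topspace L" for l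
    using continuous_map_in[OF \<phi>in[OF that]] continuous_map_in[OF b that] by blast
  ultimately show ?thesis by (simp add: continuous_map_def)
qed

text \<open>The space of continuous maps, moved to the universe and refined. Evaluation is continuous because this
  can be tested on probes. Conversely the transpose of a map of two variables is tested on probes \<open>K\<close>: for a probe
  \<open>L\<close> of \<open>X\<close> the function on \<open>K \<times> L\<close> is continuous since \<open>K \<times> L\<close> is again compact Hausdorff, and projecting a closed set
  along the compact \<open>L\<close> shows that the points of \<open>K\<close> with the image of \<open>L\<close> sent into an open set form an open set.\<close>

lemma CGWH_exponentials:
  assumes X: "X \<in> (CGWH :: 'u topology set)" and Y: "Y \<in> (CGWH :: 'u topology set)"
  shows "\<exists>Z\<in>CGWH. \<exists>ap. continuous_map (CGWH.pO Z X) Y (\<lambda>w. ap (CGWH.p1 Z X w) (CGWH.p2 Z X w)) \<and>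
        (\<forall>z\<in>topspace Z. \<forall>z'\<in>topspace Z. (\<forall>a\<in>topspace X. ap z a = ap z' a) \<longrightarrow> z = z') \<and>
        (\<forall>W\<in>CGWH. \<forall>f. continuous_map (CGWH.pO W X) Y (\<lambda>w. f (CGWH.p1 W X w) (CGWH.p2 W X w)) \<longrightarrow>
           (\<exists>g. continuous_map W Z g \<and> (\<forall>x\<in>topspace W. \<forall>a\<in>topspace X. ap (g x) a = f x a)))"
proof -
  let ?M = "mapping_topology X Y"
  have M_PiE: "topspace ?M \<subseteq> topspace X \<rightarrow>\<^sub>E topspace Y"
    by (auto simp: topspace_mapping_topology continuous_map_in PiE_def)
  obtain e :: "('u \<Rightarrow> 'u) \<Rightarrow> 'u" where e: "inj_on e (topspace X \<rightarrow>\<^sub>E topspace Y)" "small (e ` (topspace X \<rightarrow>\<^sub>E topspace Y))"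
    by (rule encode_functions[OF CGWH_small[OF X] CGWH_small[OF Y]]) (rule that)
  have inj: "inj_on e (topspace ?M)" by (rule inj_on_subset[OF e(1) M_PiE])
  let ?T = "transfer_topology e ?M" and ?i = "inv_into (topspace ?M) e"
  let ?Z = "k_ification ?T"
  note ts = topspace_transfer[OF inj]
  have i_in: "?i z \<in> topspace ?M" if "z \<in> topspace ?T" for z using that ts by (metis inv_into_into)
  have i_fun: "?i z \<in> extensional (topspace X)" "continuous_map X Y (?i z)" if "z \<in> topspace ?T" for z
    using i_in[OF that] by (auto simp: topspace_mapping_topology)
  have ei: "e (?i z) = z" if "z \<in> topspace ?T" for z using that ts by (simp add: f_inv_into_f)
  have ext: "z = z'" if "z \<in> topspace ?T" "z' \<in> topspace ?T" "\<forall>a\<in>topspace X. ?i z a = ?i z' a" for z z'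
  proof -
    have "?i z = ?i z'" using i_fun that by (intro extensionalityI[of _ "topspace X"]) auto
    then show ?thesis using ei that by metis
  qed
  have Z: "?Z \<in> CGWH"
  proof (rule k_ification_CGWH)
    show "small (topspace ?T)" unfolding ts by (rule small_subset[OF e(2)]) (use M_PiE in auto)
    fix z z' assume z: "z \<in> topspace ?T" "z' \<in> topspace ?T" "z \<noteq> z'"
    then obtain a where a: "a \<in> topspace X" "?i z a \<noteq> ?i z' a" using ext by blast
    have "continuous_map ?M Y (\<lambda>h. h a)"
      unfolding continuous_map_def
    proof (intro conjI allI impI)
      fix U assume U: "openin Y U"
      have "openin ?M {h \<in> extensional (topspace X). continuous_map X Y h \<and> (\<forall>l\<in>topspace (discrete_topology {a}). h (id l) \<in> U)}"
        using a(1) U by (intro openin_mapping_topology compact_Hausdorff_point) simp_all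
      then show "openin ?M {h \<in> topspace ?M. h a \<in> U}" by (simp add: topspace_mapping_topology)
    qed (use a(1) in \<open>auto simp: topspace_mapping_topology continuous_map_in\<close>)
    from continuous_map_comp[OF transfer_inv_continuous[OF inj] this]
    show "\<exists>(X' :: 'u topology) h. weakly_Hausdorff X' \<and> continuous_map ?T X' h \<and> h z \<noteq> h z'"
      using a(2) CGWH_weakly_Hausdorff[OF Y] by blast
  qed
  have ev: "continuous_map (CGWH.pO ?Z X) Y (\<lambda>w. ?i (CGWH.p1 ?Z X w) (CGWH.p2 ?Z X w))"
  proof (rule compactly_generated_continuous[OF CGWH_compactly_generated[OF CGWH.pO_in[OF Z X]]])
    fix w assume w: "w \<in> topspace (CGWH.pO ?Z X)"
    have "CGWH.p1 ?Z X w \<in> topspace ?T" "CGWH.p2 ?Z X w \<in> topspace X"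
      using CGWH.p1_in[OF Z X w] CGWH.p2_in[OF Z X w] by simp_all
    then show "?i (CGWH.p1 ?Z X w) (CGWH.p2 ?Z X w) \<in> topspace Y" using continuous_map_in[OF i_fun(2)] by blast
  next
    fix K :: "'u topology" and k assume K: "compact_Hausdorff K" and k: "continuous_map K (CGWH.pO ?Z X) k"
    have i: "continuous_map ?Z ?M ?i" by (rule k_ification_continuous[OF transfer_inv_continuous[OF inj]])
    show "continuous_map K Y (\<lambda>t. ?i (CGWH.p1 ?Z X (k t)) (CGWH.p2 ?Z X (k t)))"
      by (rule probe_evaluation[OF K continuous_map_comp[OF continuous_map_comp[OF k CGWH.p1_continuous[OF Z X]] i]
          continuous_map_comp[OF k CGWH.p2_continuous[OF Z X]]])
  qed
  have curry: "\<exists>g. continuous_map W ?Z g \<and> (\<forall>x\<in>topspace W. \<forall>a\<in>topspace X. ?i (g x) a = f x a)"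
    if W: "W \<in> CGWH" and f: "continuous_map (CGWH.pO W X) Y (\<lambda>w. f (CGWH.p1 W X w) (CGWH.p2 W X w))" for W :: "'u topology" and f
  proof -
    have fpr: "continuous_map V Y (\<lambda>v. f (k v) (b v))"
      if V: "V \<in> CGWH" and k: "continuous_map V W k" and b: "continuous_map V X b" for V :: "'u topology" and k b
    proof (rule continuous_map_eq[OF continuous_map_comp[OF CGWH.pr_continuous[OF W X V k b] f]])
      fix v assume "v \<in> topspace V"
      then show "f (CGWH.p1 W X (CGWH.pr W X (k v) (b v))) (CGWH.p2 W X (CGWH.pr W X (k v) (b v))) = f (k v) (b v)"
        using continuous_map_in[OF k] continuous_map_in[OF b] by (simp add: CGWH.p1_pr[OF W X] CGWH.p2_pr[OF W X])
    qed
    let ?g = "\<lambda>w. restrict (f w) (topspace X)"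
    have g_in: "?g w \<in> extensional (topspace X) \<and> continuous_map X Y (?g w)" if "w \<in> topspace W" for w
    proof -
      have "continuous_map X Y (f w)" using that by (intro fpr[OF X, of "\<lambda>_. w" "\<lambda>x. x"]) simp_all
      then have "continuous_map X Y (?g w)" by (rule continuous_map_eq) simp
      then show ?thesis by simp
    qed
    have g: "continuous_map W ?M ?g"
    proof (rule compactly_generated_continuous[OF CGWH_compactly_generated[OF W]])
      fix K :: "'u topology" and k assume K: "compact_Hausdorff K" and k: "continuous_map K W k"
      show "continuous_map K ?M (\<lambda>t. ?g (k t))"
      proof (rule continuous_into_mapping_topology)
        show "?g (k t) \<in> extensional (topspace X) \<and> continuous_map X Y (?g (k t))" if "t \<in> topspace K" for t
          using g_in continuous_map_in[OF k that] by blast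
        fix L :: "'u topology" and b U assume L: "compact_Hausdorff L" and b: "continuous_map L X b" and U: "openin Y U"
        let ?KL = "prod_topology K L"
        obtain j where j: "inj_on j (topspace ?KL)" "compact_Hausdorff (transfer_topology j ?KL :: 'u topology)"
          by (rule compact_Hausdorff_product[OF K L]) (rule that)
        let ?V = "transfer_topology j ?KL" and ?ij = "inv_into (topspace ?KL) j"
        have "continuous_map ?V Y (\<lambda>v. f (k (fst (?ij v))) (b (snd (?ij v))))"
          by (intro fpr compact_Hausdorff_CGWH[OF j(2)] continuous_map_comp[OF _ k] continuous_map_comp[OF _ b]
              continuous_map_comp[OF transfer_inv_continuous[OF j(1)] continuous_map_fst]
              continuous_map_comp[OF transfer_inv_continuous[OF j(1)] continuous_map_snd])
        from continuous_map_comp[OF transfer_continuous[OF j(1)] this]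
        have "continuous_map ?KL Y (\<lambda>z. f (k (fst z)) (b (snd z)))"
          by (rule continuous_map_eq) (use j(1) in simp)
        then have "closedin ?KL {z \<in> topspace ?KL. f (k (fst z)) (b (snd z)) \<in> topspace Y - U}"
          by (rule closedin_continuous_map_preimage) (rule closedin_diff[OF closedin_topspace U])
        moreover have "closed_map ?KL K fst"
          using L by (intro Abstract_Topological_Spaces.closed_map_fst) (simp add: compact_Hausdorff_def)
        ultimately have "closedin K (fst ` {z \<in> topspace ?KL. f (k (fst z)) (b (snd z)) \<in> topspace Y - U})"
          by (simp add: closed_map_def)
        then have "openin K (topspace K - fst ` {z \<in> topspace ?KL. f (k (fst z)) (b (snd z)) \<in> topspace Y - U})" by blast
        moreover have "topspace K - fst ` {z \<in> topspace ?KL. f (k (fst z)) (b (snd z)) \<in> topspace Y - U}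
          = {t \<in> topspace K. \<forall>l\<in>topspace L. ?g (k t) (b l) \<in> U}"
        proof -
          have "f (k t) (b l) \<in> topspace Y" if "t \<in> topspace K" "l \<in> topspace L" for t l
            using continuous_map_in[OF conjunct2[OF g_in[OF continuous_map_in[OF k that(1)]]] continuous_map_in[OF b that(2)]]
              continuous_map_in[OF b that(2)] by simp
          then show ?thesis using continuous_map_in[OF b] by (force simp: image_iff)
        qed
        ultimately show "openin K {t \<in> topspace K. \<forall>l\<in>topspace L. ?g (k t) (b l) \<in> U}" by simp
      qed
    qed (use g_in in \<open>auto simp: topspace_mapping_topology\<close>)
    have "continuous_map W ?Z (\<lambda>w. e (?g w))"
      by (rule continuous_k_ification[OF CGWH_compactly_generated[OF W] continuous_map_comp[OF g transfer_continuous[OF inj]]])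
    moreover have "?i (e (?g w)) a = f w a" if "w \<in> topspace W" "a \<in> topspace X" for w a
      using inv_into_f_f[OF inj, of "?g w"] g_in[OF that(1)] that(2) by (simp add: topspace_mapping_topology)
    ultimately show ?thesis by blast
  qed
  show ?thesis
    by (rule bexI[OF _ Z], rule exI[of _ ?i]) (use ev ext curry in auto)
qed

lemma CGWH_convenient_class: "convenient_class (CGWH :: 'u topology set)"
  by unfold_locales (rule CGWH_subspaces CGWH_exponentials; assumption)+

end

theorem theorem3p2:
  assumes "universe_type TYPE('u)"
  shows "LACC (Grp (Top (CGWH :: 'u topology set))) \<and>
    (\<forall>T :: 'u topology set. convenient T \<longrightarrow> LACC (Grp (Top T)))"
proof (intro conjI allI impI)
  interpret universe "TYPE('u)" using assms by unfold_locales
  interpret CGWH: convenient_class "CGWH :: 'u topology set" by (rule CGWH_convenient_class)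
  show "LACC (Grp (Top (CGWH :: 'u topology set)))" by (rule CGWH.Grp_LACC)
next
  fix T :: "'u topology set" assume "convenient T"
  then interpret convenient_class T by (rule convenient_class_if_convenient)
  show "LACC (Grp (Top T))" by (rule Grp_LACC)
qed

end
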